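(* Let $\mathcal{M}_{m\times n}$ be a 2D string and let $G$ be a 2D SLP generating $\mathcal{M}_{m\times n}$. We can build in $O(|G|)$ preprocessing time a data structure of $O(|G|\log mn)$ bits of space which supports direct access queries to any cell $\mathcal{M}[i][j]$ in $O(\log mn \log \log \max(m,n))$ time.
   Context: A 2D string $\mathcal{M}_{m\times n}$ is an $m\times n$ matrix over a finite alphabet $\Sigma$. Horizontal concatenation, denoted here $A\oplus B$ (written in the paper with a rotated $\ominus$ symbol), places $B$ to the right of $A$ and requires equal numbers of rows; vertical concatenation $A\ominus B$ places $B$ below $A$ and requires equal numbers of columns. A 2D SLP for $\mathcal{M}$ is a context-free grammar $(V,\Sigma,R,S)$ uniquely generating $\mathcal{M}$ whose rules have the form $A\to a$ ($a\in\Sigma$), $A\to B\oplus C$ or $A\to B\ominus C$ ($B,C\in V$), with expansions $\mathtt{exp}(A)=a$, $\mathtt{exp}(B)\oplus\mathtt{exp}(C)$, $\mathtt{exp}(B)\ominus\mathtt{exp}(C)$ respectively. The size $|G|$ is the sum of rule sizes: terminal rules have size 1, horizontal and vertical rules have size 2. *)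

theory Defs
  imports Complex_Main "Jordan_Normal_Form.Matrix"
begin

section \<open>2D strings and 2D straight-line programs\<close>

text \<open>An \<open>m \<times> n\<close> 2D string is an element of \<^term>\<open>carrier_mat m n\<close>; cells are indexed from 0.\<close>

definition hconcat :: "'a mat \<Rightarrow> 'a mat \<Rightarrow> 'a mat" where
  "hconcat A B = mat (dim_row A) (dim_col A + dim_col B)
     (\<lambda>(i, j). if j < dim_col A then A $$ (i, j) else B $$ (i, j - dim_col A))"

definition vconcat :: "'a mat \<Rightarrow> 'a mat \<Rightarrow> 'a mat" where
  "vconcat A B = mat (dim_row A + dim_row B) (dim_col A)
     (\<lambda>(i, j). if i < dim_row A then A $$ (i, j) else B $$ (i - dim_row A, j))"

datatype ('v, 'a) rhs = Letter 'a | Horiz 'v 'v | Vert 'v 'v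

record ('v, 'a) grammar =
  nonterms :: "'v set"
  alphabet :: "'a set"
  rules :: "('v \<times> ('v, 'a) rhs) set"
  start :: 'v

fun rhs_size :: "('v, 'a) rhs \<Rightarrow> nat" where
  "rhs_size (Letter a) = 1"
| "rhs_size (Horiz B C) = 2"
| "rhs_size (Vert B C) = 2"

definition grammar_size :: "('v, 'a) grammar \<Rightarrow> nat" where
  "grammar_size G = (\<Sum>(A, r)\<in>rules G. rhs_size r)"

text \<open>\<open>expands G A X\<close>: the 2D string \<open>X\<close> is derivable from the nonterminal \<open>A\<close>.\<close>

inductive expands :: "('v, 'a) grammar \<Rightarrow> 'v \<Rightarrow> 'a mat \<Rightarrow> bool" for G where
  letter: "(A, Letter a) \<in> rules G \<Longrightarrow> expands G A (mat 1 1 (\<lambda>_. a))"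
| horiz: "(A, Horiz B C) \<in> rules G \<Longrightarrow> expands G B X \<Longrightarrow> expands G C Y \<Longrightarrow>
    dim_row X = dim_row Y \<Longrightarrow> expands G A (hconcat X Y)"
| vert: "(A, Vert B C) \<in> rules G \<Longrightarrow> expands G B X \<Longrightarrow> expands G C Y \<Longrightarrow>
    dim_col X = dim_col Y \<Longrightarrow> expands G A (vconcat X Y)"

text \<open>Every nonterminal has exactly one rule and has an expansion (so the grammar is acyclic
  and all concatenations are between matching dimensions). Nonterminals that are not reachable
  from the start symbol are allowed.\<close>

definition is_slp2d :: "('v, 'a) grammar \<Rightarrow> 'a mat \<Rightarrow> bool" where
  "is_slp2d G M \<longleftrightarrow>
     finite (nonterms G) \<and> finite (alphabet G) \<and> start G \<in> nonterms G \<and>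
     (\<forall>(A, r)\<in>rules G. A \<in> nonterms G \<and>
        (case r of Letter a \<Rightarrow> a \<in> alphabet G
         | Horiz B C \<Rightarrow> B \<in> nonterms G \<and> C \<in> nonterms G
         | Vert B C \<Rightarrow> B \<in> nonterms G \<and> C \<in> nonterms G)) \<and>
     (\<forall>A\<in>nonterms G. \<exists>!r. (A, r) \<in> rules G) \<and>
     (\<forall>A\<in>nonterms G. \<exists>X. expands G A X) \<and>
     {X. expands G (start G) X} = {M}"

section \<open>The word RAM\<close>

text \<open>Words are natural numbers below \<open>2 ^ w\<close>, where \<open>w\<close> is the word length; a program is the same
  for all \<open>w\<close>. A program mentions only finitely many registers. Execution halts when the program
  counter leaves the program, and every executed instruction takes one unit of time.\<close>

datatype binop = Add | Sub | Mul | Div | Mod | And | Or | Xor | Shl | Shr | Less | Equal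

datatype instr =
    Const nat nat
  | Width nat
  | Op binop nat nat nat
  | Load nat nat
  | Store nat nat
  | JumpZero nat nat

type_synonym program = "instr list"

record ram_state =
  pc :: nat
  reg :: "nat \<Rightarrow> nat"
  mem :: "nat \<Rightarrow> nat"

context
  includes bit_operations_syntax
begin

fun binop_val :: "nat \<Rightarrow> binop \<Rightarrow> nat \<Rightarrow> nat \<Rightarrow> nat" where
  "binop_val w Add x y = (x + y) mod 2 ^ w"
| "binop_val w Sub x y = (x + 2 ^ w - y) mod 2 ^ w"
| "binop_val w Mul x y = (x * y) mod 2 ^ w"
| "binop_val w Div x y = x div y"
| "binop_val w Mod x y = x mod y"
| "binop_val w And x y = x AND y"
| "binop_val w Or x y = x OR y"
| "binop_val w Xor x y = x XOR y"
| "binop_val w Shl x y = (x * 2 ^ y) mod 2 ^ w"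
| "binop_val w Shr x y = x div 2 ^ y"
| "binop_val w Less x y = of_bool (x < y)"
| "binop_val w Equal x y = of_bool (x = y)"

end

definition set_reg :: "nat \<Rightarrow> nat \<Rightarrow> ram_state \<Rightarrow> ram_state" where
  "set_reg d x s = s\<lparr>pc := Suc (pc s), reg := (reg s)(d := x)\<rparr>"

text \<open>\<open>Width d\<close> loads the word length. In \<open>Load d a\<close> and \<open>Store a r\<close> register \<open>a\<close> holds the
  address. The reduction in \<open>Width\<close> and \<open>Const\<close> keeps register contents words.\<close>

fun exec_instr :: "nat \<Rightarrow> instr \<Rightarrow> ram_state \<Rightarrow> ram_state" where
  "exec_instr w (Const d k) s = set_reg d (k mod 2 ^ w) s"
| "exec_instr w (Width d) s = set_reg d (w mod 2 ^ w) s"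
| "exec_instr w (Op f d a b) s = set_reg d (binop_val w f (reg s a) (reg s b)) s"
| "exec_instr w (Load d a) s = set_reg d (mem s (reg s a)) s"
| "exec_instr w (Store a r) s =
     s\<lparr>pc := Suc (pc s), mem := (mem s)(reg s a := reg s r)\<rparr>"
| "exec_instr w (JumpZero r l) s = s\<lparr>pc := (if reg s r = 0 then l else Suc (pc s))\<rparr>"

definition step :: "nat \<Rightarrow> program \<Rightarrow> ram_state \<Rightarrow> ram_state" where
  "step w P s = (if pc s < length P then exec_instr w (P ! pc s) s else s)"

definition halts_within :: "nat \<Rightarrow> program \<Rightarrow> ram_state \<Rightarrow> real \<Rightarrow> ram_state \<Rightarrow> bool" where
  "halts_within w P s T s' \<longleftrightarrow>
     (\<exists>t. real t \<le> T \<and> (step w P ^^ t) s = s' \<and> length P \<le> pc s')"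

text \<open>Initial state with the arguments \<open>xs\<close> in registers \<open>0, 1, \<dots>\<close>, all other registers zero,
  and memory contents \<open>\<mu>\<close>.\<close>

definition init_state :: "nat list \<Rightarrow> (nat \<Rightarrow> nat) \<Rightarrow> ram_state" where
  "init_state xs \<mu> =
     \<lparr>pc = 0, reg = (\<lambda>k. if k < length xs then xs ! k else 0), mem = \<mu>\<rparr>"

definition stores :: "(nat \<Rightarrow> nat) \<Rightarrow> nat list \<Rightarrow> bool" where
  "stores \<mu> D \<longleftrightarrow> (\<forall>k<length D. \<mu> k = D ! k)"

definition memory_of :: "nat list \<Rightarrow> nat \<Rightarrow> nat" where
  "memory_of D = (\<lambda>k. if k < length D then D ! k else 0)"

section \<open>Input representation\<close>

text \<open>As machine input, nonterminals and letters are numbered consecutively from 0, in any order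
  (in particular not necessarily bottom-up). The grammar is given by the number of nonterminals,
  the start symbol, and three words for the rule of each nonterminal.\<close>

fun encode_rhs :: "(nat, nat) rhs \<Rightarrow> nat list" where
  "encode_rhs (Letter a) = [0, a, 0]"
| "encode_rhs (Horiz B C) = [1, B, C]"
| "encode_rhs (Vert B C) = [2, B, C]"

definition encode_grammar :: "(nat, nat) grammar \<Rightarrow> nat list" where
  "encode_grammar G =
     card (nonterms G) # start G #
     concat (map (\<lambda>A. encode_rhs (THE r. (A, r) \<in> rules G)) [0..<card (nonterms G)])"

section \<open>Direct access data structures\<close>

text \<open>The memory image \<open>D\<close> (at addresses \<open>0, 1, \<dots>\<close>) supports direct access to \<open>M\<close> by the program
  \<open>query\<close> in time \<open>T\<close>. The memory outside \<open>D\<close> may initially hold arbitrary words and may be used as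
  scratch space, but \<open>D\<close> is intact after the query, so that queries can be repeated. The result is
  returned in register 0.\<close>

definition direct_access :: "nat \<Rightarrow> program \<Rightarrow> nat list \<Rightarrow> nat mat \<Rightarrow> real \<Rightarrow> bool" where
  "direct_access w query D M T \<longleftrightarrow>
     (\<forall>i<dim_row M. \<forall>j<dim_col M. \<forall>\<mu>. stores \<mu> D \<longrightarrow> (\<forall>a. \<mu> a < 2 ^ w) \<longrightarrow>
        (\<exists>s. halts_within w query (init_state [i, j] \<mu>) T s \<and>
             reg s 0 = M $$ (i, j) \<and> stores (mem s) D))"

text \<open>\<open>D\<close> occupies at most \<open>B\<close> bits, as an array of fields of a common width \<open>b\<close>.\<close>

definition fits_in_bits :: "nat list \<Rightarrow> real \<Rightarrow> bool" where
  "fits_in_bits D B \<longleftrightarrow> (\<exists>b. (\<forall>x\<in>set D. x < 2 ^ b) \<and> real (length D * b) \<le> B)"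

text \<open>The logarithmic factors of an asymptotic bound, bounded below by 1 so that the bound is
  meaningful for the finitely many small arguments where they vanish or are undefined.\<close>

definition lg :: "real \<Rightarrow> real" where
  "lg x = max 1 (log 2 x)"

definition lglg :: "real \<Rightarrow> real" where
  "lglg x = max 1 (log 2 (log 2 x))"

end

theory Submission imports Defs "HOL-Library.Discrete_Functions" begin

text \<open>
  Write \<open>p u\<close> for the number of cells of a node \<open>u\<close> and \<open>pi u\<close> for its number of occurrences in the
  parse tree. The edges that preserve \<open>\<lfloor>log p\<rfloor>\<close> and less than double \<open>pi\<close> form disjoint paths, and a
  root-to-leaf walk leaves such paths \<open>O(log mn)\<close> times. Along a path the cells of the successive
  nodes are nested rectangles, so that the node at which a query leaves the path can be found by a
  search. For this the path is stored as a Cartesian tree, with the key of \<open>u\<close> being the position of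
  the highest bit in which \<open>p u\<close> and the size of its successor on the path differ (that size being \<open>0\<close>
  for the last node). These keys are at least \<open>\<lfloor>log p v\<rfloor>\<close> for the child \<open>v\<close> that hangs off the path at \<open>u\<close>,
  hence they never increase during a query, and the searches on all paths together take \<open>O(log mn)\<close>
  steps. The Cartesian trees of all paths are built together, bottom-up, with the usual amortised
  stacks.
\<close>

section \<open>A structured language for the word RAM\<close>

text \<open>In a tree, sizes alone would give disjoint heavy paths. In a grammar a node can have
  many parents, and the condition on \<open>pi\<close> leaves at most one of them heavy; as
  \<open>p\<close> and \<open>pi\<close> both lie between 1 and \<open>mn\<close>, either kind of
  light edge occurs only \<open>O(log mn)\<close> times in a walk. Bisecting every path would cost a
  further logarithm per path. The Cartesian tree makes the cost telescope instead, like an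
  interval-biased search tree: each step lowers the key, and the tree of the next path starts with a
  key no larger than the last one reached. The key comes from an exclusive or, not from the
  logarithm of a difference, because the sizes on a path form a monotone sequence of leaves of a
  binary trie and the key is the level at which neighbours branch. Between two branchings to the
  same side at one level lies a branching at a higher level, so the maximum of an interval is
  attained only once and every step down is strict. The key also suits a machine without a
  logarithm: highest bits can be compared by one exclusive or and two comparisons.\<close>

datatype expr = N nat | V nat | Bin binop expr expr | Ld expr

datatype com =
    Skip
  | Asg nat expr
  | Sto expr expr
  | Seq com com (infixr \<open>;;\<close> 60)
  | Iff expr com com
  | Whl expr com

type_synonym state = "(nat \<Rightarrow> nat) \<times> (nat \<Rightarrow> nat)"

text \<open>Arithmetic is exact; \<open>op_ok\<close> demands that no operation overflows on the machine.\<close>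

fun opv :: "binop \<Rightarrow> nat \<Rightarrow> nat \<Rightarrow> nat" where
  "opv Add x y = x + y"
| "opv Sub x y = x - y"
| "opv Mul x y = x * y"
| "opv f x y = binop_val 0 f x y"

fun op_ok :: "nat \<Rightarrow> binop \<Rightarrow> nat \<Rightarrow> nat \<Rightarrow> bool" where
  "op_ok w Add x y \<longleftrightarrow> x + y < 2 ^ w"
| "op_ok w Sub x y \<longleftrightarrow> y \<le> x \<and> x < 2 ^ w"
| "op_ok w Mul x y \<longleftrightarrow> x * y < 2 ^ w"
| "op_ok w Shl x y \<longleftrightarrow> False"
| "op_ok w f x y \<longleftrightarrow> True"

text \<open>Apart from addition, subtraction and multiplication, \<open>opv\<close> evaluates the
  machine operation at width 0. These values do not depend on the width, with the exception of
  \<open>Shl\<close>, which \<open>op_ok\<close> therefore never admits.\<close>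

lemma binop_val_eq_opv: "op_ok w f x y \<Longrightarrow> binop_val w f x y = opv f x y"
proof (cases f)
  case Sub
  assume "op_ok w f x y"
  then have "y \<le> x" "x < 2 ^ w" using Sub by auto
  then have "x + 2 ^ w - y = (x - y) + 2 ^ w" "x - y < 2 ^ w" by auto
  then show ?thesis by (simp only: Sub binop_val.simps opv.simps mod_add_self2 mod_less)
qed simp_all

fun eval :: "expr \<Rightarrow> state \<Rightarrow> nat" where
  "eval (N k) s = k"
| "eval (V r) s = fst s r"
| "eval (Bin f a b) s = opv f (eval a s) (eval b s)"
| "eval (Ld a) s = snd s (eval a s)"

fun safe :: "nat \<Rightarrow> expr \<Rightarrow> state \<Rightarrow> bool" where
  "safe w (N k) s \<longleftrightarrow> k < 2 ^ w"
| "safe w (V r) s \<longleftrightarrow> True"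
| "safe w (Bin f a b) s \<longleftrightarrow> safe w a s \<and> safe w b s \<and> op_ok w f (eval a s) (eval b s)"
| "safe w (Ld a) s \<longleftrightarrow> safe w a s"

text \<open>The machine has no move instruction, so \<open>r OR r\<close> copies a register.
  Register \<open>t\<close> receives the result and those above it are free, as on an evaluation
  stack.\<close>

fun cpe :: "expr \<Rightarrow> nat \<Rightarrow> instr list" where
  "cpe (N k) t = [Const t k]"
| "cpe (V r) t = [Op Or t r r]"
| "cpe (Bin f a b) t = cpe a t @ cpe b (Suc t) @ [Op f t t (Suc t)]"
| "cpe (Ld a) t = cpe a t @ [Load t t]"

fun ce :: "expr \<Rightarrow> nat" where
  "ce (N k) = 1"
| "ce (V r) = 1"
| "ce (Bin f a b) = ce a + ce b + 1"
| "ce (Ld a) = ce a + 1"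

lemma length_cpe [simp]: "length (cpe e t) = ce e"
  by (induction e arbitrary: t) auto

text \<open>Registers below \<open>tmp\<close> are program variables, the others hold intermediate results.\<close>

abbreviation tmp :: nat where "tmp \<equiv> 32"

fun wfe :: "expr \<Rightarrow> bool" where
  "wfe (N k) \<longleftrightarrow> True"
| "wfe (V r) \<longleftrightarrow> r < tmp"
| "wfe (Bin f a b) \<longleftrightarrow> wfe a \<and> wfe b"
| "wfe (Ld a) \<longleftrightarrow> wfe a"

fun wfc :: "com \<Rightarrow> bool" where
  "wfc Skip \<longleftrightarrow> True"
| "wfc (Asg d e) \<longleftrightarrow> d < tmp \<and> wfe e"
| "wfc (Sto a e) \<longleftrightarrow> wfe a \<and> wfe e"
| "wfc (Seq a b) \<longleftrightarrow> wfc a \<and> wfc b"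
| "wfc (Iff e a b) \<longleftrightarrow> wfe e \<and> wfc a \<and> wfc b"
| "wfc (Whl e a) \<longleftrightarrow> wfe e \<and> wfc a"

fun len :: "com \<Rightarrow> nat" where
  "len Skip = 0"
| "len (Asg d e) = ce e + 1"
| "len (Sto a e) = ce a + ce e + 1"
| "len (Seq a b) = len a + len b"
| "len (Iff e a b) = ce e + len a + len b + 3"
| "len (Whl e a) = ce e + len a + 3"

text \<open>Jump targets are absolute, hence the parameter \<open>p\<close>, the address of the
  first instruction. A jump without condition is a \<open>JumpZero\<close> on a register that has
  just been set to 0.\<close>

fun cp :: "com \<Rightarrow> nat \<Rightarrow> instr list" where
  "cp Skip p = []"
| "cp (Asg d e) p = cpe e tmp @ [Op Or d tmp tmp]"
| "cp (Sto a e) p = cpe a tmp @ cpe e (Suc tmp) @ [Store tmp (Suc tmp)]"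
| "cp (Seq a b) p = cp a p @ cp b (p + len a)"
| "cp (Iff e a b) p = cpe e tmp @ [JumpZero tmp (p + ce e + len a + 3)] @
     cp a (p + ce e + 1) @ [Const tmp 0, JumpZero tmp (p + ce e + len a + len b + 3)] @
     cp b (p + ce e + len a + 3)"
| "cp (Whl e a) p = cpe e tmp @ [JumpZero tmp (p + ce e + len a + 3)] @
     cp a (p + ce e + 1) @ [Const tmp 0, JumpZero tmp p]"

lemma length_cp [simp]: "length (cp c p) = len c"
  by (induction c arbitrary: p) auto

text \<open>The cost is the exact number of executed instructions; the 3 of a true test consists of
  the test jump and the two instructions of the jump behind the branch. A run that overflows or
  diverges has no derivation, so deriving \<open>bs\<close> also excludes overflow.\<close>

inductive bs :: "nat \<Rightarrow> com \<Rightarrow> state \<Rightarrow> nat \<Rightarrow> state \<Rightarrow> bool" for w where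
  bs_Skip: "bs w Skip s 0 s"
| bs_Asg: "safe w e s \<Longrightarrow> bs w (Asg d e) s (ce e + 1) ((fst s)(d := eval e s), snd s)"
| bs_Sto: "safe w a s \<Longrightarrow> safe w e s \<Longrightarrow>
    bs w (Sto a e) s (ce a + ce e + 1) (fst s, (snd s)(eval a s := eval e s))"
| bs_Seq: "bs w a s k s' \<Longrightarrow> bs w b s' l s'' \<Longrightarrow> bs w (Seq a b) s (k + l) s''"
| bs_IfT: "safe w e s \<Longrightarrow> eval e s \<noteq> 0 \<Longrightarrow> bs w a s k s' \<Longrightarrow> bs w (Iff e a b) s (ce e + k + 3) s'"
| bs_IfF: "safe w e s \<Longrightarrow> eval e s = 0 \<Longrightarrow> bs w b s k s' \<Longrightarrow> bs w (Iff e a b) s (ce e + k + 1) s'"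
| bs_WhF: "safe w e s \<Longrightarrow> eval e s = 0 \<Longrightarrow> bs w (Whl e a) s (ce e + 1) s"
| bs_WhT: "safe w e s \<Longrightarrow> eval e s \<noteq> 0 \<Longrightarrow> bs w a s k s' \<Longrightarrow> bs w (Whl e a) s' l s'' \<Longrightarrow>
    bs w (Whl e a) s (ce e + 3 + k + l) s''"

section \<open>Correctness of the compiler\<close>

definition code_at :: "program \<Rightarrow> nat \<Rightarrow> program \<Rightarrow> bool" where
  "code_at P p c \<longleftrightarrow> (\<exists>pre post. P = pre @ c @ post \<and> length pre = p)"

lemma code_at_append: "code_at P p (a @ b) \<longleftrightarrow> code_at P p a \<and> code_at P (p + length a) b"
proof
  assume "code_at P p (a @ b)"
  then obtain pre post where *: "P = pre @ (a @ b) @ post" "length pre = p"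
    unfolding code_at_def by blast
  then have "P = pre @ a @ (b @ post)" "P = (pre @ a) @ b @ post" by auto
  with *(2) show "code_at P p a \<and> code_at P (p + length a) b"
    unfolding code_at_def by (metis length_append)
next
  assume "code_at P p a \<and> code_at P (p + length a) b"
  then obtain pre post pre' post' where *: "P = pre @ a @ post" "length pre = p"
    "P = pre' @ b @ post'" "length pre' = p + length a"
    unfolding code_at_def by blast
  then have "(pre @ a) @ post = pre' @ b @ post'" "length (pre @ a) = length pre'" by auto
  then have "pre' = pre @ a" "b @ post' = post"
    by (metis append_eq_append_conv)+
  with * show "code_at P p (a @ b)" unfolding code_at_def by auto
qed

lemma code_at_Nil: "code_at P p [] \<longleftrightarrow> p \<le> length P"
proof
  assume "p \<le> length P"
  then have "P = take p P @ [] @ drop p P" "length (take p P) = p" by auto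
  then show "code_at P p []" unfolding code_at_def by blast
qed (auto simp: code_at_def)

lemma code_at_Cons: "code_at P p (i # c) \<longleftrightarrow> p < length P \<and> P ! p = i \<and> code_at P (Suc p) c"
proof -
  have "code_at P p [i] \<longleftrightarrow> p < length P \<and> P ! p = i"
  proof
    assume "p < length P \<and> P ! p = i"
    then have "P = take p P @ [i] @ drop (Suc p) P" "length (take p P) = p"
      by (auto simp: id_take_nth_drop[symmetric])
    then show "code_at P p [i]" unfolding code_at_def by blast
  qed (auto simp: code_at_def nth_append)
  then show ?thesis using code_at_append[of P p "[i]" c] by simp
qed

definition run :: "nat \<Rightarrow> program \<Rightarrow> nat \<Rightarrow> ram_state \<Rightarrow> ram_state" where
  "run w P k s = (step w P ^^ k) s"

lemma run_0: "run w P 0 s = s"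
  by (simp add: run_def)

lemma run_add: "run w P (k + l) s = run w P l (run w P k s)"
  by (simp add: run_def funpow_add add.commute[of k])

lemma run_1: "pc s < length P \<Longrightarrow> run w P (Suc 0) s = exec_instr w (P ! pc s) s"
  by (simp add: run_def step_def)

definition agree :: "state \<Rightarrow> ram_state \<Rightarrow> bool" where
  "agree S s \<longleftrightarrow> (\<forall>r<tmp. reg s r = fst S r) \<and> mem s = snd S"

lemma cpe_correct:
  assumes "code_at P (pc s) (cpe e t)" "tmp \<le> t" "wfe e" "agree S s" "safe w e S"
  shows "pc (run w P (ce e) s) = pc s + ce e \<and> reg (run w P (ce e) s) t = eval e S \<and>
    mem (run w P (ce e) s) = mem s \<and> (\<forall>r<t. reg (run w P (ce e) s) r = reg s r)"
  using assms
proof (induction e arbitrary: t s)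
  case (N k)
  then show ?case by (simp add: code_at_Cons code_at_Nil run_1 set_reg_def)
next
  case (V r)
  then show ?case by (simp add: code_at_Cons code_at_Nil run_1 set_reg_def agree_def)
next
  case (Ld e)
  let ?s = "run w P (ce e) s"
  have c: "code_at P (pc s) (cpe e t)" "code_at P (pc s + ce e) [Load t t]"
    using Ld.prems(1) by (auto simp: code_at_append)
  have 1: "pc ?s = pc s + ce e \<and> reg ?s t = eval e S \<and> mem ?s = mem s \<and>
      (\<forall>r<t. reg ?s r = reg s r)"
    using Ld c by auto
  then have "run w P (Suc 0) ?s = set_reg t (mem ?s (reg ?s t)) ?s"
    using c(2) by (simp add: code_at_Cons code_at_Nil run_1)
  then show ?case using 1 Ld.prems(4)
    by (simp add: run_add[of w P "ce e" "Suc 0", simplified] set_reg_def agree_def)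
next
  case (Bin f a b)
  let ?s = "run w P (ce a) s"
  let ?s' = "run w P (ce b) ?s"
  have c: "code_at P (pc s) (cpe a t)" "code_at P (pc s + ce a) (cpe b (Suc t))"
    "code_at P (pc s + ce a + ce b) [Op f t t (Suc t)]"
    using Bin.prems(1) by (auto simp: code_at_append add.assoc)
  have 1: "pc ?s = pc s + ce a \<and> reg ?s t = eval a S \<and> mem ?s = mem s \<and>
      (\<forall>r<t. reg ?s r = reg s r)"
    using Bin c by auto
  \<comment> \<open>Register \<open>t\<close> with the value of \<open>a\<close> survives, since
    \<open>b\<close> writes only to registers from \<open>Suc t\<close> on.\<close>
  have 2: "pc ?s' = pc ?s + ce b \<and> reg ?s' (Suc t) = eval b S \<and> mem ?s' = mem ?s \<and>
      (\<forall>r<Suc t. reg ?s' r = reg ?s r)"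
    using Bin.prems 1 c by (intro Bin.IH(2)) (auto simp: agree_def)
  have "run w P (Suc 0) ?s' = set_reg t (eval (Bin f a b) S) ?s'"
    using c(3) 1 2 Bin.prems(5) by (simp add: code_at_Cons code_at_Nil run_1 binop_val_eq_opv)
  then have "run w P (ce (Bin f a b)) s = set_reg t (eval (Bin f a b) S) ?s'"
    using run_add[of w P "ce a + ce b" "Suc 0" s] by (simp add: run_add)
  then show ?case using 1 2 by (simp add: set_reg_def)
qed

lemma cp_correct:
  assumes "bs w c S n S'" "code_at P (pc s) (cp c (pc s))" "wfc c" "agree S s"
  shows "\<exists>s'. run w P n s = s' \<and> pc s' = pc s + len c \<and> agree S' s'"
  using assms
proof (induction arbitrary: s rule: bs.induct)
  case (bs_Skip S)
  then show ?case by (simp add: run_0)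
next
  case (bs_Asg e S d)
  let ?s = "run w P (ce e) s"
  have c: "code_at P (pc s) (cpe e tmp)" "code_at P (pc s + ce e) [Op Or d tmp tmp]"
    using bs_Asg.prems(1) by (auto simp: code_at_append)
  have 1: "pc ?s = pc s + ce e \<and> reg ?s tmp = eval e S \<and> mem ?s = mem s \<and>
      (\<forall>r<tmp. reg ?s r = reg s r)"
    using cpe_correct[OF c(1)] bs_Asg by auto
  then have "run w P (Suc 0) ?s = set_reg d (eval e S) ?s"
    using c(2) by (simp add: code_at_Cons code_at_Nil run_1)
  then show ?case using 1 bs_Asg.prems
    by (simp add: run_add[of w P "ce e" "Suc 0", simplified] set_reg_def agree_def)
next
  case (bs_Sto a S e)
  let ?s = "run w P (ce a) s"
  let ?s' = "run w P (ce e) ?s"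
  have c: "code_at P (pc s) (cpe a tmp)" "code_at P (pc s + ce a) (cpe e (Suc tmp))"
    "code_at P (pc s + ce a + ce e) [Store tmp (Suc tmp)]"
    using bs_Sto.prems(1) by (auto simp: code_at_append add.assoc)
  have 1: "pc ?s = pc s + ce a \<and> reg ?s tmp = eval a S \<and> mem ?s = mem s \<and>
      (\<forall>r<tmp. reg ?s r = reg s r)"
    using cpe_correct[OF c(1)] bs_Sto by auto
  have 2: "pc ?s' = pc ?s + ce e \<and> reg ?s' (Suc tmp) = eval e S \<and> mem ?s' = mem ?s \<and>
      (\<forall>r<Suc tmp. reg ?s' r = reg ?s r)"
    using c 1 bs_Sto by (intro cpe_correct) (auto simp: agree_def)
  have "run w P (Suc 0) ?s' = ?s'\<lparr>pc := Suc (pc ?s'), mem := (mem ?s')(eval a S := eval e S)\<rparr>"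
    using c(3) 1 2 by (simp add: code_at_Cons code_at_Nil run_1)
  then have "run w P (ce a + ce e + 1) s =
      ?s'\<lparr>pc := Suc (pc ?s'), mem := (mem ?s')(eval a S := eval e S)\<rparr>"
    using run_add[of w P "ce a + ce e" "Suc 0" s] by (simp add: run_add)
  then show ?case using 1 2 bs_Sto.prems by (simp add: agree_def)
next
  case (bs_Seq a S k S' b l S'')
  have c: "code_at P (pc s) (cp a (pc s))" "code_at P (pc s + len a) (cp b (pc s + len a))"
    using bs_Seq.prems(1) by (auto simp: code_at_append)
  let ?s = "run w P k s"
  have 1: "pc ?s = pc s + len a \<and> agree S' ?s"
    using bs_Seq c by auto
  then have "\<exists>s'. run w P l ?s = s' \<and> pc s' = pc ?s + len b \<and> agree S'' s'"
    using bs_Seq c by auto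
  then show ?case using 1 by (simp add: run_add)
next
  case (bs_IfT e S a k S' b)
  let ?p = "pc s" and ?s = "run w P (ce e) s"
  have c: "code_at P ?p (cpe e tmp)" "code_at P (?p + ce e) [JumpZero tmp (?p + ce e + len a + 3)]"
     "code_at P (?p + ce e + 1) (cp a (?p + ce e + 1))"
     "code_at P (?p + ce e + 1 + len a) [Const tmp 0, JumpZero tmp (?p + ce e + len a + len b + 3)]"
    using bs_IfT.prems(1) by (auto simp: code_at_append code_at_Cons code_at_Nil add.assoc)
  have 1: "pc ?s = pc s + ce e \<and> reg ?s tmp = eval e S \<and> mem ?s = mem s \<and>
      (\<forall>r<tmp. reg ?s r = reg s r)"
    using cpe_correct[OF c(1)] bs_IfT by auto
  let ?s1 = "run w P (Suc 0) ?s"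
  have 2: "pc ?s1 = ?p + ce e + 1 \<and> agree S ?s1"
    using c(2) 1 bs_IfT.hyps(2) bs_IfT.prems(3) by (auto simp: code_at_Cons code_at_Nil run_1 agree_def)
  let ?s2 = "run w P k ?s1"
  have 3: "pc ?s2 = ?p + ce e + 1 + len a \<and> agree S' ?s2"
    using bs_IfT.IH[of ?s1] 2 c(3) bs_IfT.prems by auto
  let ?s3 = "run w P (Suc 0) ?s2"
  have 4: "pc ?s3 = ?p + ce e + 2 + len a \<and> agree S' ?s3 \<and> reg ?s3 tmp = 0"
    using 3 c(4) by (auto simp: code_at_Cons code_at_Nil run_1 set_reg_def agree_def)
  let ?s4 = "run w P (Suc 0) ?s3"
  have 5: "pc ?s4 = ?p + ce e + len a + len b + 3 \<and> agree S' ?s4"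
    using 4 c(4) by (auto simp: code_at_Cons code_at_Nil run_1 agree_def)
  have "run w P (ce e + k + 3) s = ?s4"
    using run_add[of w P "ce e" "Suc 0 + (k + (Suc 0 + Suc 0))" s]
    by (simp only: run_add[of w P "Suc 0"] run_add[of w P k]) (simp add: add.commute eval_nat_numeral)
  then show ?case using 5 by simp
next
  case (bs_IfF e S b k S' a)
  let ?p = "pc s" and ?s = "run w P (ce e) s"
  have c: "code_at P ?p (cpe e tmp)" "code_at P (?p + ce e) [JumpZero tmp (?p + ce e + len a + 3)]"
     "code_at P (?p + ce e + len a + 3) (cp b (?p + ce e + len a + 3))"
    using bs_IfF.prems(1) by (auto simp: code_at_append code_at_Cons code_at_Nil eval_nat_numeral add_ac)
  have 1: "pc ?s = pc s + ce e \<and> reg ?s tmp = eval e S \<and> mem ?s = mem s \<and>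
      (\<forall>r<tmp. reg ?s r = reg s r)"
    using cpe_correct[OF c(1)] bs_IfF by auto
  let ?s1 = "run w P (Suc 0) ?s"
  have 2: "pc ?s1 = ?p + ce e + len a + 3 \<and> agree S ?s1"
    using c(2) 1 bs_IfF.hyps(2) bs_IfF.prems(3) by (auto simp: code_at_Cons code_at_Nil run_1 agree_def)
  let ?s2 = "run w P k ?s1"
  have 3: "pc ?s2 = ?p + ce e + len a + 3 + len b \<and> agree S' ?s2"
    using bs_IfF.IH[of ?s1] 2 c(3) bs_IfF.prems by auto
  have "run w P (ce e + k + 1) s = ?s2"
    using run_add[of w P "ce e" "Suc 0 + k" s]
    by (simp only: run_add[of w P "Suc 0"]) (simp add: add.commute)
  then show ?case using 3 by simp
next
  case (bs_WhF e S a)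
  let ?p = "pc s" and ?s = "run w P (ce e) s"
  have c: "code_at P ?p (cpe e tmp)" "code_at P (?p + ce e) [JumpZero tmp (?p + ce e + len a + 3)]"
    using bs_WhF.prems(1) by (auto simp: code_at_append code_at_Cons code_at_Nil)
  have 1: "pc ?s = pc s + ce e \<and> reg ?s tmp = eval e S \<and> mem ?s = mem s \<and>
      (\<forall>r<tmp. reg ?s r = reg s r)"
    using cpe_correct[OF c(1)] bs_WhF by auto
  let ?s1 = "run w P (Suc 0) ?s"
  have 2: "pc ?s1 = ?p + ce e + len a + 3 \<and> agree S ?s1"
    using c(2) 1 bs_WhF.hyps(2) bs_WhF.prems(3) by (auto simp: code_at_Cons code_at_Nil run_1 agree_def)
  then show ?case using run_add[of w P "ce e" "Suc 0" s] by auto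
next
  case (bs_WhT e S a k S' l S'')
  let ?p = "pc s" and ?s = "run w P (ce e) s"
  have c: "code_at P ?p (cpe e tmp)" "code_at P (?p + ce e) [JumpZero tmp (?p + ce e + len a + 3)]"
     "code_at P (?p + ce e + 1) (cp a (?p + ce e + 1))"
     "code_at P (?p + ce e + 1 + len a) [Const tmp 0, JumpZero tmp ?p]"
    using bs_WhT.prems(1) by (auto simp: code_at_append code_at_Cons code_at_Nil add.assoc)
  have 1: "pc ?s = pc s + ce e \<and> reg ?s tmp = eval e S \<and> mem ?s = mem s \<and>
      (\<forall>r<tmp. reg ?s r = reg s r)"
    using cpe_correct[OF c(1)] bs_WhT by auto
  let ?s1 = "run w P (Suc 0) ?s"
  have 2: "pc ?s1 = ?p + ce e + 1 \<and> agree S ?s1"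
    using c(2) 1 bs_WhT.hyps(2) bs_WhT.prems(3) by (auto simp: code_at_Cons code_at_Nil run_1 agree_def)
  let ?s2 = "run w P k ?s1"
  have 3: "pc ?s2 = ?p + ce e + 1 + len a \<and> agree S' ?s2"
    using bs_WhT.IH(1)[of ?s1] 2 c(3) bs_WhT.prems by auto
  let ?s3 = "run w P (Suc 0) ?s2"
  have 4: "pc ?s3 = ?p + ce e + 2 + len a \<and> agree S' ?s3 \<and> reg ?s3 tmp = 0"
    using 3 c(4) by (auto simp: code_at_Cons code_at_Nil run_1 set_reg_def agree_def)
  let ?s4 = "run w P (Suc 0) ?s3"
  have 5: "pc ?s4 = ?p \<and> agree S' ?s4"
    using 4 c(4) by (auto simp: code_at_Cons code_at_Nil run_1 agree_def)
  have 6: "run w P (ce e + 3 + k) s = ?s4"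
    using run_add[of w P "ce e" "Suc 0 + (k + (Suc 0 + Suc 0))" s]
    by (simp only: run_add[of w P "Suc 0"] run_add[of w P k]) (simp add: add.commute eval_nat_numeral)
  show ?case using bs_WhT.IH(2)[of ?s4] 5 6 bs_WhT.prems by (simp add: run_add)
qed

lemma cp_halts:
  assumes "bs w c S n S'" "wfc c" "agree S s" "pc s = 0" "real n \<le> T"
  shows "\<exists>s'. halts_within w (cp c 0) s T s' \<and> agree S' s'"
proof -
  have "code_at (cp c 0) (pc s) (cp c (pc s))"
    using assms(4) by (auto simp: code_at_def)
  from cp_correct[OF assms(1) this assms(2,3)] obtain s' where
    "(step w (cp c 0) ^^ n) s = s'" "pc s' = len c" "agree S' s'"
    using assms(4) by (auto simp: run_def)
  then show ?thesis unfolding halts_within_def using assms(5) by (metis length_cp order_refl)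
qed

section \<open>Time bounds from weakest preconditions and loop invariants\<close>

fun loop_free :: "com \<Rightarrow> bool" where
  "loop_free (Seq a b) \<longleftrightarrow> loop_free a \<and> loop_free b"
| "loop_free (Iff e a b) \<longleftrightarrow> loop_free a \<and> loop_free b"
| "loop_free (Whl e a) \<longleftrightarrow> False"
| "loop_free _ \<longleftrightarrow> True"

fun wp :: "nat \<Rightarrow> com \<Rightarrow> (state \<Rightarrow> bool) \<Rightarrow> state \<Rightarrow> bool" where
  "wp w Skip Q s \<longleftrightarrow> Q s"
| "wp w (Asg d e) Q s \<longleftrightarrow> safe w e s \<and> Q ((fst s)(d := eval e s), snd s)"
| "wp w (Sto a e) Q s \<longleftrightarrow> safe w a s \<and> safe w e s \<and> Q (fst s, (snd s)(eval a s := eval e s))"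
| "wp w (Seq a b) Q s \<longleftrightarrow> wp w a (wp w b Q) s"
| "wp w (Iff e a b) Q s \<longleftrightarrow> safe w e s \<and> (if eval e s \<noteq> 0 then wp w a Q s else wp w b Q s)"
| "wp w (Whl e a) Q s \<longleftrightarrow> False"

text \<open>Without loops every instruction is executed at most once, so the length of the code
  bounds the time and \<open>wp\<close> need not count steps.\<close>

lemma wp_bs: "loop_free c \<Longrightarrow> wp w c Q s \<Longrightarrow> \<exists>n s'. bs w c s n s' \<and> n \<le> len c \<and> Q s'"
proof (induction c arbitrary: s Q)
  case Skip
  then show ?case using bs_Skip[of w s] by fastforce
next
  case (Asg d e)
  then show ?case by (auto intro!: exI bs.intros)
next
  case (Sto a e)
  then show ?case by (auto intro!: exI bs.intros)
next
  case (Seq a b)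
  from Seq.prems have "loop_free a" "loop_free b" "wp w a (wp w b Q) s" by auto
  with Seq.IH(1) obtain k s' where 1: "bs w a s k s'" "k \<le> len a" "wp w b Q s'" by blast
  with Seq.IH(2) \<open>loop_free b\<close> obtain l s'' where
    2: "bs w b s' l s''" "l \<le> len b" "Q s''" by blast
  with 1 have "bs w (Seq a b) s (k + l) s''" by (blast intro: bs.intros)
  moreover have "k + l \<le> len (Seq a b)" using 1 2 by simp
  ultimately show ?case using 2 by blast
next
  case (Iff e a b)
  then have s: "safe w e s" and lf: "loop_free a" "loop_free b" by auto
  show ?case
  proof (cases "eval e s = 0")
    case True
    with Iff.prems have "wp w b Q s" by simp
    with Iff.IH(2) lf obtain k s' where 1: "bs w b s k s'" "k \<le> len b" "Q s'" by blast
    with True s have "bs w (Iff e a b) s (ce e + k + 1) s'" by (blast intro: bs.intros)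
    moreover have "ce e + k + 1 \<le> len (Iff e a b)" using 1 by simp
    ultimately show ?thesis using 1 by blast
  next
    case False
    with Iff.prems have "wp w a Q s" by simp
    with Iff.IH(1) lf obtain k s' where 1: "bs w a s k s'" "k \<le> len a" "Q s'" by blast
    with False s have "bs w (Iff e a b) s (ce e + k + 3) s'" by (blast intro: bs.intros)
    moreover have "ce e + k + 3 \<le> len (Iff e a b)" using 1 by simp
    ultimately show ?thesis using 1 by blast
  qed
qed simp

text \<open>The index \<open>i\<close> of the invariant is a bound on the number of remaining time units.\<close>

lemma while_bs:
  assumes "I i s"
    and "\<And>i s. I i s \<Longrightarrow> safe w e s"
    and "\<And>i s. I i s \<Longrightarrow> eval e s \<noteq> 0 \<Longrightarrow>
      \<exists>k s' i'. bs w c s k s' \<and> I i' s' \<and> ce e + 3 + k + i' \<le> i"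
  shows "\<exists>k s' i'. bs w (Whl e c) s k s' \<and> I i' s' \<and> eval e s' = 0 \<and> k + i' \<le> i + ce e + 1"
  using assms(1)
proof (induction i arbitrary: s rule: less_induct)
  case (less i)
  show ?case
  proof (cases "eval e s = 0")
    case True
    then have "bs w (Whl e c) s (ce e + 1) s" using assms(2) less.prems by (blast intro: bs.intros)
    then show ?thesis using True less.prems by fastforce
  next
    case False
    with assms(3) less.prems obtain k s' i' where
      1: "bs w c s k s'" "I i' s'" "ce e + 3 + k + i' \<le> i" by blast
    then have "i' < i" by simp
    from less.IH[OF this 1(2)] obtain l s'' i'' where
      2: "bs w (Whl e c) s' l s''" "I i'' s''" "eval e s'' = 0" "l + i'' \<le> i' + ce e + 1" by blast
    have "bs w (Whl e c) s (ce e + 3 + k + l) s''"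
      using False assms(2) less.prems 1 2 by (blast intro: bs.intros)
    moreover have "ce e + 3 + k + l + i'' \<le> i + ce e + 1" using 1 2 by simp
    ultimately show ?thesis using 2 by blast
  qed
qed

section \<open>Heavy paths\<close>

context includes bit_operations_syntax begin

section \<open>Highest bits and exclusive or\<close>

lemma div_floor_log: "x > 0 \<Longrightarrow> x div 2 ^ floor_log x = (1::nat)"
  using floor_log_exp2_le[of x] floor_log_exp2_gt[of x]
  by (intro div_nat_eqI) auto

lemma floor_log_less_iff_div: "x > 0 \<Longrightarrow> floor_log x < k \<longleftrightarrow> x div 2 ^ k = (0::nat)"
proof -
  assume x: "x > 0"
  have "floor_log x < k" if "x < 2 ^ k"
  proof (rule ccontr)
    assume "\<not> floor_log x < k"
    then have "(2::nat) ^ k \<le> 2 ^ floor_log x" by simp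
    with floor_log_exp2_le[OF x] that show False by linarith
  qed
  moreover have "x < 2 ^ k" if "floor_log x < k"
  proof -
    have "2 * (2::nat) ^ floor_log x \<le> 2 ^ k"
      using that by (metis power_Suc power_increasing Suc_leI one_le_numeral)
    with floor_log_exp2_gt[of x] show ?thesis by linarith
  qed
  ultimately show ?thesis by (auto simp: div_eq_0_iff)
qed

lemma xor_div_exp: "(x XOR y) div 2 ^ k = (x div 2 ^ k) XOR (y div 2 ^ k :: nat)"
  by (simp flip: drop_bit_eq_div)

lemma xor_eq_0_iff_nat: "x XOR y = 0 \<longleftrightarrow> x = (y::nat)"
proof
  assume "x XOR y = 0"
  then have "bit x n = bit y n" for n using bit_xor_iff[of x y n] by simp
  then show "x = y" by (simp add: bit_eq_iff)
qed simp

text \<open>If the highest bit of \<open>y\<close> lies above that of \<open>x\<close>, it survives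
  in the exclusive or; if the two highest bits coincide, they cancel and the result drops below both
  numbers. This compares logarithms on a machine that cannot compute them.\<close>

lemma floor_log_less_iff_xor:
  assumes "x > 0" "y > 0"
  shows "floor_log x < floor_log y \<longleftrightarrow> x < y \<and> x < x XOR y"
proof
  assume l: "floor_log x < floor_log y"
  let ?k = "floor_log y"
  have x0: "x div 2 ^ ?k = 0" using l assms floor_log_less_iff_div by blast
  have "(x XOR y) div 2 ^ ?k = 1"
    by (simp only: xor_div_exp x0 div_floor_log[OF assms(2)] xor_self_eq) simp
  then have "2 ^ ?k \<le> x XOR y" "2 ^ ?k \<le> y" "x < 2 ^ ?k"
    using x0 div_floor_log[OF assms(2)] by (auto simp: div_eq_0_iff not_less[symmetric])
  then show "x < y \<and> x < x XOR y" by linarith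
next
  assume *: "x < y \<and> x < x XOR y"
  show "floor_log x < floor_log y"
  proof (rule ccontr)
    assume "\<not> floor_log x < floor_log y"
    with * floor_log_le_iff[of x y] have e: "floor_log y = floor_log x" by simp
    have "(x XOR y) div 2 ^ floor_log x = 0"
      using div_floor_log[OF assms(1)] div_floor_log[OF assms(2)]
      by (simp only: xor_div_exp e xor_self_eq)
    then have "x XOR y < 2 ^ floor_log x" by (simp add: div_eq_0_iff)
    with * floor_log_exp2_le[OF assms(1)] show False by linarith
  qed
qed

lemma floor_log_eq_iff_xor:
  assumes "0 < y" "y \<le> x"
  shows "floor_log x = floor_log y \<longleftrightarrow> x XOR y < y"
proof (cases "floor_log x = floor_log y")
  case True
  have "(x XOR y) div 2 ^ floor_log y = 0"
    using div_floor_log[of x] div_floor_log[of y] assms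
    by (simp only: xor_div_exp True xor_self_eq)
  then have "x XOR y < 2 ^ floor_log y" by (simp add: div_eq_0_iff)
  with True floor_log_exp2_le[of y] assms show ?thesis by simp
next
  case False
  with assms floor_log_le_iff[of y x] have "floor_log y < floor_log x" by simp
  then have "y < y XOR x" using floor_log_less_iff_xor[of y x] assms by simp
  then show ?thesis using False by (simp add: xor.commute)
qed

lemma floor_log_xor_less:
  assumes "0 < y" "0 < x" "x \<noteq> y" "floor_log x = floor_log y"
  shows "floor_log (x XOR y) < floor_log y"
proof -
  have "x XOR y > 0" using assms(3) xor_eq_0_iff_nat by (simp add: zero_less_iff_neq_zero)
  moreover have "(x XOR y) div 2 ^ floor_log y = 0"
    using div_floor_log[of x] div_floor_log[of y] assms
    by (simp only: xor_div_exp xor_self_eq)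
  ultimately show ?thesis using floor_log_less_iff_div by blast
qed

lemma div_exp_eq_if_xor_less:
  assumes "x XOR y > 0" "floor_log (x XOR y) < k"
  shows "x div 2 ^ k = y div (2 ^ k :: nat)"
  using assms floor_log_less_iff_div[of "x XOR y" k] xor_eq_0_iff_nat xor_div_exp by metis

text \<open>In the binary trie the two numbers branch at level \<open>k\<close>, the larger one to
  the right; without the \<open>k\<close> lowest bits they are siblings.\<close>

lemma div_exp_floor_log_xor:
  assumes "y < x"
  defines "k \<equiv> floor_log (x XOR y)"
  shows "x div 2 ^ k = Suc (y div 2 ^ k)" "even (y div 2 ^ k)"
proof -
  let ?x = "x div 2 ^ k" and ?y = "y div 2 ^ k"
  have pos: "x XOR y > 0" using assms(1) xor_eq_0_iff_nat by (simp add: zero_less_iff_neq_zero)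
  have "x div 2 ^ Suc k = y div 2 ^ Suc k"
    by (rule div_exp_eq_if_xor_less[OF pos]) (simp add: k_def)
  then have d: "?x div 2 = ?y div 2" by (metis div_mult2_eq power_Suc2)
  have "?x XOR ?y = 1" using div_floor_log[OF pos] by (simp add: k_def xor_div_exp)
  then have ne: "?x \<noteq> ?y" by auto
  have le: "?y \<le> ?x" using assms by (simp add: div_le_mono)
  have "X = Suc Y \<and> even Y" if "X div 2 = Y div 2" "X \<noteq> Y" "Y \<le> X" for X Y :: nat
    using that by presburger
  with d ne le show "?x = Suc ?y" "even ?y" by blast+
qed

text \<open>Above the highest differing bit the numbers agree, so their difference is a difference
  of remainders modulo the next power of two. The bound ties the size of a light child to the
  key.\<close>

lemma floor_log_diff_le_xor:
  assumes "y < x"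
  shows "floor_log (x - y) \<le> floor_log (x XOR y)"
proof -
  let ?k = "Suc (floor_log (x XOR y))"
  have pos: "x XOR y > 0" using assms(1) xor_eq_0_iff_nat by (simp add: zero_less_iff_neq_zero)
  have "x div 2 ^ ?k = y div 2 ^ ?k"
    by (rule div_exp_eq_if_xor_less[OF pos]) simp
  then have "x - y = x mod 2 ^ ?k - y mod 2 ^ ?k"
    by (metis add_diff_cancel_left div_mult_mod_eq)
  also have "\<dots> < 2 ^ ?k" by (simp add: less_imp_diff_less)
  finally have "(x - y) div 2 ^ ?k = 0" by simp
  then have "floor_log (x - y) < ?k" using assms floor_log_less_iff_div[of "x - y" ?k] by simp
  then show ?thesis by simp
qed

end

text \<open>The nodes \<open>1..r\<close> are numbered bottom-up and 0 is free to act as a null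
  pointer: \<open>b k = 0\<close> marks a leaf, whose letter is then \<open>c k\<close>. Horizontal
  and vertical rules need no tag, since for both kinds the second child starts at
  \<open>(h k - h (c k), w k - w (c k))\<close>, with one of the coordinates being 0. By
  \<open>parent\<close>, every node is reachable from the root \<open>r\<close>.\<close>

locale dag =
  fixes r :: nat and b c h w :: "nat \<Rightarrow> nat" and val :: "nat \<Rightarrow> nat \<Rightarrow> nat \<Rightarrow> nat"
  assumes r_pos: "1 \<le> r"
    and leaf: "1 \<le> k \<Longrightarrow> k \<le> r \<Longrightarrow> b k = 0 \<Longrightarrow> h k = 1 \<and> w k = 1 \<and> val k 0 0 = c k"
    and inner: "1 \<le> k \<Longrightarrow> k \<le> r \<Longrightarrow> b k \<noteq> 0 \<Longrightarrow> b k < k \<and> 1 \<le> c k \<and> c k < k"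
    and dims: "1 \<le> k \<Longrightarrow> k \<le> r \<Longrightarrow> b k \<noteq> 0 \<Longrightarrow>
      h k = h (b k) \<and> h k = h (c k) \<and> w k = w (b k) + w (c k) \<or>
      w k = w (b k) \<and> w k = w (c k) \<and> h k = h (b k) + h (c k)"
    and val: "1 \<le> k \<Longrightarrow> k \<le> r \<Longrightarrow> b k \<noteq> 0 \<Longrightarrow> i < h k \<Longrightarrow> j < w k \<Longrightarrow>
      val k i j = (if i < h (b k) \<and> j < w (b k) then val (b k) i j
                   else val (c k) (i - (h k - h (c k))) (j - (w k - w (c k))))"
    and parent: "1 \<le> k \<Longrightarrow> k < r \<Longrightarrow> \<exists>u. k < u \<and> u \<le> r \<and> b u \<noteq> 0 \<and> (b u = k \<or> c u = k)"
begin

definition p :: "nat \<Rightarrow> nat" where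
  "p k = (if k = 0 then 0 else h k * w k)"

lemma dims_pos: "1 \<le> k \<Longrightarrow> k \<le> r \<Longrightarrow> 0 < h k \<and> 0 < w k"
proof (induction k rule: less_induct)
  case (less k)
  show ?case
  proof (cases "b k = 0")
    case False
    with less.prems inner[of k] less.IH[of "b k"] dims[of k] show ?thesis by auto
  qed (use less leaf in auto)
qed

lemma p_0 [simp]: "p 0 = 0"
  by (simp add: p_def)

lemma p_pos: "1 \<le> k \<Longrightarrow> k \<le> r \<Longrightarrow> 0 < p k"
  using dims_pos[of k] by (simp add: p_def)

lemma p_inner: "1 \<le> k \<Longrightarrow> k \<le> r \<Longrightarrow> b k \<noteq> 0 \<Longrightarrow> p k = p (b k) + p (c k)"
  using dims[of k] inner[of k] by (auto simp: p_def algebra_simps)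

lemma p_le_root: "1 \<le> k \<Longrightarrow> k \<le> r \<Longrightarrow> p k \<le> p r"
proof (induction "r - k" arbitrary: k rule: less_induct)
  case less
  show ?case
  proof (cases "k = r")
    case False
    with less.prems parent[of k] obtain u where
      u: "k < u" "u \<le> r" "b u \<noteq> 0" "b u = k \<or> c u = k" by auto
    then have "p k \<le> p u" using p_inner[of u] by auto
    also have "p u \<le> p r" using u less.prems by (intro less.hyps) auto
    finally show ?thesis .
  qed simp
qed

lemma dims_le_root: "1 \<le> k \<Longrightarrow> k \<le> r \<Longrightarrow> h k \<le> p r \<and> w k \<le> p r"
  using p_le_root[of k] dims_pos[of k] order_trans[of "h k" "h k * w k"] order_trans[of "w k" "h k * w k"]
  by (auto simp: p_def)

inductive_set sub :: "nat \<Rightarrow> nat set" for k where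
  "k \<in> sub k"
| "u \<in> sub k \<Longrightarrow> b u \<noteq> 0 \<Longrightarrow> b u \<in> sub k"
| "u \<in> sub k \<Longrightarrow> b u \<noteq> 0 \<Longrightarrow> c u \<in> sub k"

lemma sub_inner: "sub k \<subseteq> (if b k = 0 then {k} else insert k (sub (b k) \<union> sub (c k)))"
proof
  fix x assume "x \<in> sub k"
  then show "x \<in> (if b k = 0 then {k} else insert k (sub (b k) \<union> sub (c k)))"
    by induction (auto split: if_splits intro: sub.intros)
qed

text \<open>A binary parse tree with \<open>p k\<close> leaves has \<open>2 * p k - 1\<close> nodes,
  and sharing can only identify some of them.\<close>

lemma card_sub: "1 \<le> k \<Longrightarrow> k \<le> r \<Longrightarrow> finite (sub k) \<and> card (sub k) < 2 * p k"
proof (induction k rule: less_induct)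
  case (less k)
  show ?case
  proof (cases "b k = 0")
    case True
    then have "sub k \<subseteq> {k}" using sub_inner[of k] by simp
    then have "finite (sub k)" "card (sub k) \<le> 1"
      using card_mono[of "{k}" "sub k"] finite_subset by auto
    then show ?thesis using p_pos[of k] less.prems by simp
  next
    case False
    then have s: "sub k \<subseteq> insert k (sub (b k) \<union> sub (c k))" using sub_inner[of k] by simp
    have ib: "finite (sub (b k)) \<and> card (sub (b k)) < 2 * p (b k)"
      using inner[of k] less False by (intro less.IH) auto
    have ic: "finite (sub (c k)) \<and> card (sub (c k)) < 2 * p (c k)"
      using inner[of k] less False by (intro less.IH) auto
    have "card (sub k) \<le> card (insert k (sub (b k) \<union> sub (c k)))"
      using s ib ic by (intro card_mono) auto
    also have "\<dots> \<le> Suc (card (sub (b k) \<union> sub (c k)))" by (rule card_insert_le_m1) auto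
    also have "\<dots> \<le> Suc (card (sub (b k)) + card (sub (c k)))" by (simp add: card_Un_le)
    finally show ?thesis using ib ic s p_inner[OF less.prems False]
      by (auto intro: finite_subset)
  qed
qed

text \<open>Bounds the node numbers by the size of the string and not only by that of the grammar;
  this is what allows pointers to be stored in \<open>O(log mn)\<close> bits.\<close>

lemma r_less: "r < 2 * p r"
proof -
  have "1 \<le> k \<Longrightarrow> k \<le> r \<Longrightarrow> k \<in> sub r" for k
  proof (induction "r - k" arbitrary: k rule: less_induct)
    case less
    show ?case
    proof (cases "k = r")
      case False
      with less.prems parent[of k] obtain u where
        u: "k < u" "u \<le> r" "b u \<noteq> 0" "b u = k \<or> c u = k" by auto
      then have "u \<in> sub r" using less.prems by (intro less.hyps) auto
      with u show ?thesis by (auto intro: sub.intros)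
    qed (auto intro: sub.intros)
  qed
  then have "{1..r} \<subseteq> sub r" by auto
  then have "card {1..r} \<le> card (sub r)" using card_sub[of r] r_pos by (intro card_mono) auto
  then show ?thesis using card_sub[of r] r_pos by simp
qed

section \<open>Occurrence counts, propagated from the root downwards\<close>

definition cnt :: "nat \<Rightarrow> nat \<Rightarrow> nat" where
  "cnt u k = (if b u = 0 then 0 else of_bool (b u = k) + of_bool (c u = k))"

text \<open>The two updates are sequential because the children of \<open>u\<close> may coincide and
  must then receive \<open>A u\<close> twice.\<close>

definition push :: "nat \<Rightarrow> (nat \<Rightarrow> nat) \<Rightarrow> nat \<Rightarrow> nat" where
  "push u A = (if b u = 0 then A else
     (A(b u := A (b u) + A u))(c u := (A(b u := A (b u) + A u)) (c u) + A u))"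

text \<open>The state after all nodes above \<open>u\<close> have been pushed. The occurrences
  counted so far at the nodes up to \<open>u\<close> are disjoint pieces of the whole string, hence
  the sum of their areas is at most \<open>p r\<close>. This is what keeps the counters from
  overflowing.\<close>

definition pinv :: "nat \<Rightarrow> (nat \<Rightarrow> nat) \<Rightarrow> bool" where
  "pinv u A \<longleftrightarrow>
     (\<forall>k\<in>{1..r}. A k = of_bool (k = r) + (\<Sum>v\<in>{u<..r}. cnt v k * A v)) \<and>
     (\<Sum>k\<in>{1..u}. A k * p k) \<le> p r \<and> (\<forall>k\<in>{1..r}. A k * p k \<le> p r)"

lemma push_eq: "push u A k = A k + cnt u k * A u"
  by (simp add: push_def cnt_def)

lemma cnt_less: "1 \<le> u \<Longrightarrow> u \<le> r \<Longrightarrow> u \<le> k \<Longrightarrow> cnt u k = 0"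
  using inner[of u] by (auto simp: cnt_def)

lemma pinv_init: "(\<And>k. 1 \<le> k \<Longrightarrow> k \<le> r \<Longrightarrow> A k = of_bool (k = r)) \<Longrightarrow> pinv r A"
proof -
  assume A: "\<And>k. 1 \<le> k \<Longrightarrow> k \<le> r \<Longrightarrow> A k = of_bool (k = r)"
  have "(\<Sum>k\<in>{1..r}. A k * p k) = (\<Sum>k\<in>{1..r}. if k = r then p r else 0)"
    by (rule sum.cong) (auto simp: A)
  then show ?thesis unfolding pinv_def using A r_pos by simp
qed

text \<open>Pushing replaces every occurrence of \<open>u\<close> by its two children, which cover
  the same cells; a leaf is merely dropped from the sum.\<close>

lemma pinv_step:
  assumes "pinv u A" "1 \<le> u" "u \<le> r"
  shows "pinv (u - 1) (push u A)"
proof -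
  have same: "push u A v = A v" if "u \<le> v" for v
    using cnt_less[of u v] assms that by (simp add: push_eq)
  have set: "{u - 1<..r} = insert u {u<..r}" using assms by auto
  have 1: "push u A k = of_bool (k = r) + (\<Sum>v\<in>{u - 1<..r}. cnt v k * push u A v)"
    if "k \<in> {1..r}" for k
  proof -
    have "(\<Sum>v\<in>{u - 1<..r}. cnt v k * push u A v) =
        cnt u k * push u A u + (\<Sum>v\<in>{u<..r}. cnt v k * push u A v)"
      unfolding set by simp
    also have "\<dots> = cnt u k * A u + (\<Sum>v\<in>{u<..r}. cnt v k * A v)"
      using same by (intro arg_cong2[of _ _ _ _ "(+)"] sum.cong) auto
    finally show ?thesis using assms(1) that by (simp add: pinv_def push_eq)
  qed
  have "(\<Sum>k\<in>{1..u-1}. push u A k * p k) \<le> (\<Sum>k\<in>{1..u}. A k * p k)"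
  proof -
    have "(\<Sum>k\<in>{1..u-1}. cnt u k * p k) \<le> p u"
    proof (cases "b u = 0")
      case False
      have "(\<Sum>k\<in>{1..u-1}. cnt u k * p k) =
          (\<Sum>k\<in>{1..u-1}. if b u = k then p k else 0) + (\<Sum>k\<in>{1..u-1}. if c u = k then p k else 0)"
        unfolding sum.distrib[symmetric] using False by (intro sum.cong) (auto simp: cnt_def)
      also have "\<dots> = p (b u) + p (c u)"
        using False inner[of u] assms by auto
      finally show ?thesis using p_inner[of u] False assms by simp
    qed (simp add: cnt_def)
    then have "A u * (\<Sum>k\<in>{1..u-1}. cnt u k * p k) \<le> A u * p u" by simp
    moreover have "(\<Sum>k\<in>{1..u-1}. push u A k * p k) =
        (\<Sum>k\<in>{1..u-1}. A k * p k) + A u * (\<Sum>k\<in>{1..u-1}. cnt u k * p k)"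
      by (simp add: push_eq algebra_simps sum.distrib sum_distrib_left)
    moreover have "{1..u} = insert u {1..u-1}" using assms by auto
    ultimately show ?thesis using assms(2) by (simp add: algebra_simps)
  qed
  then have 2: "(\<Sum>k\<in>{1..u-1}. push u A k * p k) \<le> p r"
    using assms(1) by (simp add: pinv_def)
  have 3: "push u A k * p k \<le> p r" if "k \<in> {1..r}" for k
  proof (cases "u \<le> k")
    case True
    then have "push u A k = A k" by (rule same)
    moreover have "A k * p k \<le> p r" using assms(1) that unfolding pinv_def by blast
    ultimately show ?thesis by (simp only:)
  next
    case False
    then have "push u A k * p k \<le> (\<Sum>k\<in>{1..u-1}. push u A k * p k)"
      using that by (intro member_le_sum) auto
    with 2 show ?thesis by simp
  qed
  show ?thesis unfolding pinv_def using 1 2 3 by blast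
qed

end

section \<open>Heavy paths of a DAG weighted with occurrence counts\<close>

locale weighted_dag = dag +
  fixes pi :: "nat \<Rightarrow> nat"
  assumes pi_eq: "1 \<le> k \<Longrightarrow> k \<le> r \<Longrightarrow> pi k = of_bool (k = r) + (\<Sum>v\<in>{0<..r}. cnt v k * pi v)"
    and pi_p_le: "1 \<le> k \<Longrightarrow> k \<le> r \<Longrightarrow> pi k * p k \<le> p r"
begin

lemma pi_le: "1 \<le> k \<Longrightarrow> k \<le> r \<Longrightarrow> pi k \<le> p r"
  using pi_p_le[of k] p_pos[of k] by (metis One_nat_def Suc_leI le_trans mult.right_neutral mult_le_mono2)

lemma pi_mono:
  assumes "1 \<le> u" "u \<le> r" "b u \<noteq> 0" "v = b u \<or> v = c u"
  shows "pi u \<le> pi v"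
proof -
  have v: "1 \<le> v" "v \<le> r" using assms inner[of u] by auto
  have "pi u \<le> cnt u v * pi u" using assms by (auto simp: cnt_def)
  also have "\<dots> \<le> (\<Sum>x\<in>{0<..r}. cnt x v * pi x)"
    using assms by (intro member_le_sum) auto
  also have "\<dots> \<le> pi v" using pi_eq[OF v] by simp
  finally show ?thesis .
qed

lemma pi_mono2:
  assumes "1 \<le> u" "u \<le> r" "b u \<noteq> 0" "v = b u \<or> v = c u"
    and "1 \<le> u'" "u' \<le> r" "b u' \<noteq> 0" "v = b u' \<or> v = c u'" "u \<noteq> u'"
  shows "pi u + pi u' \<le> pi v"
proof -
  have v: "1 \<le> v" "v \<le> r" using assms inner[of u] by auto
  have "pi u + pi u' \<le> cnt u v * pi u + cnt u' v * pi u'"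
    using assms by (intro add_mono) (auto simp: cnt_def)
  also have "\<dots> = (\<Sum>x\<in>{u, u'}. cnt x v * pi x)" using assms by simp
  also have "\<dots> \<le> (\<Sum>x\<in>{0<..r}. cnt x v * pi x)"
    using assms by (intro sum_mono2) auto
  also have "\<dots> \<le> pi v" using pi_eq[OF v] by simp
  finally show ?thesis .
qed

lemma pi_pos: "1 \<le> k \<Longrightarrow> k \<le> r \<Longrightarrow> 0 < pi k"
proof (induction "r - k" arbitrary: k rule: less_induct)
  case less
  show ?case
  proof (cases "k = r")
    case True
    then show ?thesis using pi_eq[of r] r_pos by simp
  next
    case False
    with less.prems parent[of k] obtain u where
      u: "k < u" "u \<le> r" "b u \<noteq> 0" "b u = k \<or> c u = k" by auto
    then have "0 < pi u" using less.prems by (intro less.hyps) auto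
    also have "pi u \<le> pi k" using u less.prems by (intro pi_mono) auto
    finally show ?thesis .
  qed
qed

text \<open>The heavy edges form disjoint paths: two children of \<open>u\<close> in the same size class as \<open>u\<close> would
  have too large a total size, and two such parents of \<open>v\<close> would give \<open>v\<close> too many occurrences.\<close>

definition hev :: "nat \<Rightarrow> nat \<Rightarrow> bool" where
  "hev u v \<longleftrightarrow> floor_log (p u) = floor_log (p v) \<and> pi v < 2 * pi u"

definition hv :: "nat \<Rightarrow> nat" where
  "hv u = (if u = 0 \<or> r < u \<or> b u = 0 then 0 else if hev u (b u) then b u
     else if hev u (c u) then c u else 0)"

lemma hvD:
  assumes "hv u \<noteq> 0"
  shows "1 \<le> u" "u \<le> r" "b u \<noteq> 0" "hv u = b u \<or> hv u = c u" "hv u < u" "hev u (hv u)"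
    "p (hv u) < p u" "1 \<le> hv u" "hv u \<le> r"
proof -
  show *: "1 \<le> u" "u \<le> r" "b u \<noteq> 0" "hv u = b u \<or> hv u = c u" "hev u (hv u)"
    using assms by (auto simp: hv_def split: if_splits)
  then show "hv u < u" "p (hv u) < p u" "1 \<le> hv u" "hv u \<le> r"
    using inner[of u] p_inner[of u] p_pos[of "b u"] p_pos[of "c u"] by auto
qed

lemma hv_le: "hv u \<le> r"
  using hvD(9)[of u] by fastforce

lemma not_both_heavy:
  assumes "1 \<le> u" "u \<le> r" "b u \<noteq> 0"
  shows "\<not> (hev u (b u) \<and> hev u (c u))"
proof
  assume *: "hev u (b u) \<and> hev u (c u)"
  let ?k = "2 ^ floor_log (p u) :: nat"
  have "?k \<le> p (b u)" "?k \<le> p (c u)"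
    using * floor_log_exp2_le[of "p (b u)"] floor_log_exp2_le[of "p (c u)"] p_pos inner[OF assms] assms
    by (auto simp: hev_def)
  then show False using p_inner[OF assms] floor_log_exp2_gt[of "p u"] by simp
qed

text \<open>Equal children cannot be heavy, as both together would be too large. Hence comparing
  node numbers decides whether a cell enters the heavy child.\<close>

lemma hv_cases:
  assumes "hv u \<noteq> 0"
  shows "hv u = b u \<and> b u \<noteq> c u \<or> hv u = c u \<and> b u \<noteq> c u"
  using not_both_heavy[OF hvD(1-3)[OF assms]] hvD(4,6)[OF assms] by auto

lemma light:
  assumes "1 \<le> u" "u \<le> r" "b u \<noteq> 0" "v = b u \<or> v = c u" "v \<noteq> hv u"
  shows "floor_log (p v) < floor_log (p u) \<or> 2 * pi u \<le> pi v"
proof -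
  have "\<not> hev u v" using assms not_both_heavy[OF assms(1-3)] by (auto simp: hv_def)
  moreover have "p v \<le> p u" using assms p_inner[of u] by auto
  ultimately show ?thesis using floor_log_le_iff[of "p v" "p u"] by (auto simp: hev_def)
qed

lemma hv_inj:
  assumes "hv u = hv u'" "hv u \<noteq> 0"
  shows "u = u'"
proof (rule ccontr)
  assume "u \<noteq> u'"
  have ne: "hv u' \<noteq> 0" using assms by simp
  have "pi u + pi u' \<le> pi (hv u)"
    using hvD(1-4)[OF assms(2)] hvD(1-4)[OF ne] assms(1) \<open>u \<noteq> u'\<close> by (intro pi_mono2) auto
  then show False using hvD(6)[OF assms(2)] hvD(6)[OF ne] assms(1) by (auto simp: hev_def)
qed

text \<open>Reachability along heavy edges. Node numbers fall on the way, so the order of numbers is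
  the order on the path and intervals of a path can be described by \<open><\<close>.\<close>

inductive desc :: "nat \<Rightarrow> nat \<Rightarrow> bool" where
  refl: "0 < u \<Longrightarrow> u \<le> r \<Longrightarrow> desc u u"
| step: "hv u \<noteq> 0 \<Longrightarrow> desc (hv u) y \<Longrightarrow> desc u y"

lemma descD: "desc u y \<Longrightarrow> y \<le> u \<and> 1 \<le> y \<and> u \<le> r"
proof (induction rule: desc.induct)
  case (step u y)
  then show ?case using hvD(2,5)[of u] by auto
qed auto

lemma desc_trans: "desc u y \<Longrightarrow> desc y x \<Longrightarrow> desc u x"
  by (induction rule: desc.induct) (auto intro: desc.intros)

lemma desc_hv: "hv u \<noteq> 0 \<Longrightarrow> desc u (hv u)"
  using hvD(8,9)[of u] desc.intros by simp

lemma desc_strict: "desc u y \<Longrightarrow> y < u \<Longrightarrow> hv u \<noteq> 0 \<and> desc (hv u) y"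
  by (auto elim: desc.cases)

lemma desc_linear: "desc u y \<Longrightarrow> desc u y' \<Longrightarrow> y' \<le> y \<Longrightarrow> desc y y'"
proof (induction rule: desc.induct)
  case (step u y)
  have "y' < u" using descD[OF step.hyps(2)] hvD(5)[OF step.hyps(1)] step.prems by simp
  then show ?case using step desc_strict by blast
qed auto

lemma desc_snoc: "desc u y \<Longrightarrow> y < u \<Longrightarrow> \<exists>x. desc u x \<and> hv x = y"
proof (induction rule: desc.induct)
  case (step u y)
  show ?case
  proof (cases "y = hv u")
    case True
    then show ?thesis using hvD(1,2)[OF step.hyps(1)] desc.refl[of u] by auto
  next
    case False
    with step.IH descD[OF step.hyps(2)] step.hyps(1) show ?thesis by (force intro: desc.step)
  qed
qed simp

text \<open>Linearity upwards rests on the uniqueness of the heavy parent, \<open>hv_inj\<close>,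
  whereas \<open>desc_linear\<close> rests on that of the heavy child.\<close>

lemma desc_linear2: "desc x j \<Longrightarrow> desc u j \<Longrightarrow> x \<le> u \<Longrightarrow> desc u x"
proof (induction arbitrary: u rule: desc.induct)
  case (step x j)
  have "hv x < u" using hvD(5)[OF step.hyps(1)] step.prems by simp
  then have "desc u (hv x)" using step by simp
  with \<open>hv x < u\<close> obtain y where "desc u y" "hv y = hv x" using desc_snoc by blast
  then show ?case using hv_inj step.hyps(1) by metis
qed

lemma desc_attr: "desc u y \<Longrightarrow> floor_log (p y) = floor_log (p u) \<and> p y \<le> p u \<and> pi u \<le> pi y"
proof (induction rule: desc.induct)
  case (step u y)
  have "pi u \<le> pi (hv u)" using hvD(1-4)[OF step.hyps(1)] by (intro pi_mono) auto
  then show ?case using step.IH hvD(6,7)[OF step.hyps(1)] by (auto simp: hev_def)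
qed simp

text \<open>The number itself is stored, and its logarithm \<open>z\<close> occurs only in proofs;
  two keys are compared through \<open>z_less_test\<close>.\<close>

definition dz :: "nat \<Rightarrow> nat" where
  "dz u = Bit_Operations.xor (p u) (p (hv u))"

definition z :: "nat \<Rightarrow> nat" where
  "z u = floor_log (dz u)"

lemma dz_pos: "1 \<le> u \<Longrightarrow> u \<le> r \<Longrightarrow> 0 < dz u"
  using xor_eq_0_iff_nat[of "p u" "p (hv u)"] hvD(7)[of u] p_pos[of u]
  by (cases "hv u = 0") (auto simp: dz_def)

text \<open>Because of \<open>p 0 = 0\<close> the last node of a path has its whole size class as
  key, while \<open>z_inner\<close> keeps all other keys of the path below that class. Thus the last
  node is the root of the Cartesian tree.\<close>

lemma z_tail: "hv u = 0 \<Longrightarrow> z u = floor_log (p u)"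
  by (simp add: z_def dz_def)

lemma z_inner: "hv u \<noteq> 0 \<Longrightarrow> z u < floor_log (p u)"
  using floor_log_xor_less[of "p (hv u)" "p u"] hvD[of u] p_pos[of u] p_pos[of "hv u"]
  by (auto simp: z_def dz_def hev_def)

lemma z_le: "z u \<le> floor_log (p u)"
  using z_tail[of u] z_inner[of u] by fastforce

lemma p_hv_less: "1 \<le> u \<Longrightarrow> u \<le> r \<Longrightarrow> p (hv u) < p u"
  using hvD(7)[of u] p_pos[of u] by (cases "hv u = 0") auto

text \<open>A step with a key below \<open>k\<close> changes no bit from position \<open>k\<close>
  on, so the size stays in the same block of length \<open>2 ^ k\<close>.\<close>

lemma desc_div_eq:
  "desc u y \<Longrightarrow> (\<And>v. desc u v \<Longrightarrow> y < v \<Longrightarrow> z v < k) \<Longrightarrow> p u div 2 ^ k = p y div 2 ^ k"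
proof (induction rule: desc.induct)
  case (step u y)
  have "y < u" using descD[OF step.hyps(2)] hvD(5)[OF step.hyps(1)] by simp
  then have "z u < k" using hvD(1,2)[OF step.hyps(1)] step.prems[of u] desc.refl[of u] by simp
  then have "p u div 2 ^ k = p (hv u) div 2 ^ k"
    using dz_pos[OF hvD(1,2)[OF step.hyps(1)]]
    by (intro div_exp_eq_if_xor_less) (auto simp: z_def dz_def)
  also have "\<dots> = p y div 2 ^ k"
    using step.prems step.hyps by (intro step.IH) (auto intro: desc.step)
  finally show ?case .
qed simp

text \<open>Two odd multiples of \<open>2 ^ k\<close> are separated by a multiple of \<open>2 ^ (k + 1)\<close>; hence the maximum of
  \<open>z\<close> on an interval of a path is attained only once.\<close>

lemma z_first_ge:
  assumes "desc u y" "y < u" "z u \<le> z y" "\<And>v. desc u v \<Longrightarrow> y < v \<Longrightarrow> v < u \<Longrightarrow> z v < z u"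
  shows "z u < z y"
proof (rule ccontr)
  assume "\<not> z u < z y"
  with assms(3) have e: "z y = z u" by simp
  have u: "hv u \<noteq> 0" "desc (hv u) y" using desc_strict[OF assms(1,2)] by auto
  have y: "1 \<le> y" "y \<le> r" using descD[OF assms(1)] by auto
  let ?k = "2 ^ z u :: nat"
  \<comment> \<open>After \<open>u\<close> the size lies in an even block of length
    \<open>2 ^ z u\<close>, and no key strictly between \<open>u\<close> and \<open>y\<close> leads
    out of it; but a key of the same value at \<open>y\<close> requires an odd block.\<close>
  have "p (hv u) div ?k = p y div ?k"
  proof (rule desc_div_eq[OF u(2)])
    fix v assume v: "desc (hv u) v" "y < v"
    then have "v < u" using descD[OF v(1)] hvD(5)[OF u(1)] by simp
    then show "z v < z u" using assms(4) v u(1) by (auto intro: desc.step)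
  qed
  moreover have "even (p (hv u) div ?k)"
    using div_exp_floor_log_xor(2)[OF p_hv_less[OF hvD(1,2)[OF u(1)]]] by (simp add: z_def dz_def)
  moreover have "odd (p y div 2 ^ z y)"
    using div_exp_floor_log_xor[OF p_hv_less[OF y]] by (simp add: z_def dz_def)
  ultimately show False using e by simp
qed

lemma z_max_unique:
  assumes "desc u y" "y < u" "\<And>v. desc u v \<Longrightarrow> y \<le> v \<Longrightarrow> z v \<le> z u"
  shows "z y < z u"
proof (rule ccontr)
  assume "\<not> z y < z u"
  \<comment> \<open>The maximum of \<open>S\<close> is the first node after \<open>u\<close> whose
    key reaches \<open>z u\<close>; by \<open>z_first_ge\<close> it exceeds \<open>z u\<close>,
    against the maximality of \<open>u\<close>.\<close>
  define S where "S = {v. desc u v \<and> y \<le> v \<and> v < u \<and> z u \<le> z v}"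
  have S: "finite S" "y \<in> S"
    using assms(1,2) \<open>\<not> z y < z u\<close> by (auto simp: S_def intro: finite_subset[of _ "{..u}"])
  define m where "m = Max S"
  have "S \<noteq> {}" using S(2) by blast
  with S(1) have m: "m \<in> S" "\<And>v. v \<in> S \<Longrightarrow> v \<le> m" unfolding m_def by (rule Max_in, simp)
  have "z u < z m"
  proof (rule z_first_ge)
    fix v assume v: "desc u v" "m < v" "v < u"
    show "z v < z u"
    proof (rule ccontr)
      assume "\<not> z v < z u"
      then have "v \<in> S" using v m(1) by (auto simp: S_def)
      with m(2) v(2) show False by fastforce
    qed
  qed (use m in \<open>auto simp: S_def\<close>)
  then show False using assms(3)[of m] m by (auto simp: S_def)
qed

lemma z_max_unique':
  assumes "desc u y" "y < u" "\<And>v. desc u v \<Longrightarrow> y \<le> v \<Longrightarrow> z v \<le> z y"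
  shows "z u < z y"
proof (rule ccontr)
  assume "\<not> z u < z y"
  then have "z y = z u" using assms(3)[of u] assms(1,2) descD by (fastforce intro: desc.refl)
  then show False using z_max_unique[of u y] assms by fastforce
qed

text \<open>The right and the left subtree of a node in the Cartesian tree of its path; paths are listed
  from the larger to the smaller nodes.\<close>

definition Rg :: "nat \<Rightarrow> nat set" where
  "Rg x = {y. desc x y \<and> y < x \<and> (\<forall>v. desc x v \<and> y \<le> v \<and> v < x \<longrightarrow> z v < z x)}"

definition Lf :: "nat \<Rightarrow> nat set" where
  "Lf x = {y. desc y x \<and> x < y \<and> (\<forall>v. desc y v \<and> x < v \<longrightarrow> z v < z x)}"

text \<open>An absent child is left unspecified: a query descends only towards its exit node, hence
  never into an empty subtree.\<close>

definition is_max :: "nat set \<Rightarrow> nat \<Rightarrow> bool" where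
  "is_max S x \<longleftrightarrow> (S \<noteq> {} \<longrightarrow> x \<in> S \<and> (\<forall>y\<in>S. z y \<le> z x))"

definition offi :: "nat \<Rightarrow> nat" where
  "offi u = (if hv u = b u then 0 else h u - h (hv u))"

definition offj :: "nat \<Rightarrow> nat" where
  "offj u = (if hv u = b u then 0 else w u - w (hv u))"

end

section \<open>Cartesian trees\<close>

context weighted_dag
begin

lemma off_le: "hv x \<noteq> 0 \<Longrightarrow> offi x + h (hv x) \<le> h x \<and> offj x + w (hv x) \<le> w x"
  using dims[OF hvD(1-3)[of x]] hvD(4)[of x] by (auto simp: offi_def offj_def)

lemma dz_le: "0 < u \<Longrightarrow> u \<le> r \<Longrightarrow> dz u \<le> 2 * p r"
proof -
  assume u: "0 < u" "u \<le> r"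
  have "dz u < 2 * 2 ^ z u" unfolding z_def by (rule floor_log_exp2_gt)
  also have "\<dots> \<le> 2 * 2 ^ floor_log (p u)" using z_le[of u] by simp
  also have "\<dots> \<le> 2 * p u" using floor_log_exp2_le[of "p u"] p_pos[of u] u by simp
  also have "\<dots> \<le> 2 * p r" using p_le_root[of u] u by simp
  finally show ?thesis by simp
qed

lemma heavy_test:
  assumes "0 < u" "u \<le> r" "b u \<noteq> 0" "v = b u \<or> v = c u"
  shows "hev u v \<longleftrightarrow> Bit_Operations.xor (p u) (p v) < p v \<and> pi v < 2 * pi u"
proof -
  have "0 < p v" "p v \<le> p u" using inner[of u] p_inner[of u] p_pos[of v] assms by auto
  then show ?thesis using floor_log_eq_iff_xor[of "p v" "p u"] by (auto simp: hev_def)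
qed

lemma z_less_test:
  assumes "0 < j" "j \<le> r" "0 < u" "u \<le> r"
  shows "z j < z u \<longleftrightarrow> dz j < dz u \<and> dz j < Bit_Operations.xor (dz j) (dz u)"
  using floor_log_less_iff_xor[of "dz j" "dz u"] dz_pos[of j] dz_pos[of u] assms by (simp add: z_def)

end

section \<open>Search in the Cartesian trees and its potential\<close>

locale chain_tree = weighted_dag +
  fixes al be tail lf rg :: "nat \<Rightarrow> nat"
  assumes al_eq: "0 < k \<Longrightarrow> k \<le> r \<Longrightarrow> al k = (if hv k = 0 then 0 else al (hv k) + offi k)"
    and be_eq: "0 < k \<Longrightarrow> k \<le> r \<Longrightarrow> be k = (if hv k = 0 then 0 else be (hv k) + offj k)"
    and tl_eq: "0 < k \<Longrightarrow> k \<le> r \<Longrightarrow> tail k = (if hv k = 0 then k else tail (hv k))"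
    and lf_max: "0 < k \<Longrightarrow> k \<le> r \<Longrightarrow> is_max (Lf k) (lf k)"
    and rg_max: "0 < k \<Longrightarrow> k \<le> r \<Longrightarrow> is_max (Rg k) (rg k)"
begin

lemma desc_tl_self: "0 < u \<Longrightarrow> u \<le> r \<Longrightarrow> desc u (tail u) \<and> hv (tail u) = 0"
proof (induction u rule: less_induct)
  case (less u)
  then show ?case using hvD(5,8,9)[of u] tl_eq[of u] by (cases "hv u = 0") (auto intro: desc.intros)
qed

lemma desc_tl: "desc u y \<Longrightarrow> desc y (tail u)"
proof (induction rule: desc.induct)
  case (refl u)
  then show ?case using desc_tl_self by simp
next
  case (step u y)
  then show ?case using tl_eq[of u] hvD(1,2)[of u] by simp
qed

text \<open>All coordinates on a path are compared in the frame of its last node, whose upper left cell is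
  cell \<open>(al u, be u)\<close> of a node \<open>u\<close>; cell \<open>(i, j)\<close> of \<open>u0\<close> lies within the node \<open>x\<close> of the path.\<close>

definition ins :: "nat \<Rightarrow> nat \<Rightarrow> nat \<Rightarrow> nat \<Rightarrow> bool" where
  "ins u0 i j x \<longleftrightarrow> al u0 \<le> i + al x \<and> i + al x < al u0 + h x \<and>
     be u0 \<le> j + be x \<and> j + be x < be u0 + w x"

lemma ins_hv: "hv x \<noteq> 0 \<Longrightarrow> ins u0 i j (hv x) \<Longrightarrow> ins u0 i j x"
  using off_le[of x] al_eq[of x] be_eq[of x] hvD(1,2)[of x] by (auto simp: ins_def)

lemma ins_desc: "desc x y \<Longrightarrow> ins u0 i j y \<Longrightarrow> ins u0 i j x"
  by (induction rule: desc.induct) (auto intro: ins_hv)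

lemma ins_self: "i < h u \<Longrightarrow> j < w u \<Longrightarrow> ins u i j u"
  by (simp add: ins_def)

text \<open>Reconciles two tests for entering the heavy child: the one in the frame of the path and
  the one that the rule of \<open>x\<close> prescribes. They agree because the heavy child is one
  definite child, by \<open>hv_cases\<close>.\<close>

lemma ins_child_iff:
  assumes "0 < x" "x \<le> r" "b x \<noteq> 0" "ins u0 i j x"
  defines "t \<equiv> i + al x - al u0" and "u \<equiv> j + be x - be u0"
  shows "hv x \<noteq> 0 \<and> ins u0 i j (hv x) \<longleftrightarrow>
    hv x = (if t < h (b x) \<and> u < w (b x) then b x else c x)"
proof (cases "hv x = 0")
  case True
  then show ?thesis using inner[of x] assms by auto
next
  case False
  have d: "h x = h (b x) \<and> h x = h (c x) \<and> w x = w (b x) + w (c x) \<or>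
      w x = w (b x) \<and> w x = w (c x) \<and> h x = h (b x) + h (c x)"
    using dims[of x] assms by simp
  have eqs: "al x = al (hv x) + offi x" "be x = be (hv x) + offj x"
    using al_eq[of x] be_eq[of x] assms False by auto
  from hv_cases[OF False] show ?thesis
  proof
    assume hb: "hv x = b x \<and> b x \<noteq> c x"
    then have "offi x = 0" "offj x = 0" by (auto simp: offi_def offj_def)
    with eqs hb have e: "al (b x) = al x" "be (b x) = be x" by auto
    have "ins u0 i j (b x) \<longleftrightarrow> t < h (b x) \<and> u < w (b x)"
      using assms(4) e unfolding t_def u_def ins_def by linarith
    then show ?thesis using hb False by simp
  next
    assume hc: "hv x = c x \<and> b x \<noteq> c x"
    then have "offi x = h x - h (c x)" "offj x = w x - w (c x)" by (auto simp: offi_def offj_def)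
    with eqs hc have e: "al x = al (c x) + (h x - h (c x))" "be x = be (c x) + (w x - w (c x))"
      by auto
    have "ins u0 i j (c x) \<longleftrightarrow> \<not> (t < h (b x) \<and> u < w (b x))"
      using d
    proof
      assume "h x = h (b x) \<and> h x = h (c x) \<and> w x = w (b x) + w (c x)"
      then show ?thesis using assms(4) e unfolding t_def u_def ins_def by linarith
    next
      assume "w x = w (b x) \<and> w x = w (c x) \<and> h x = h (b x) + h (c x)"
      then show ?thesis using assms(4) e unfolding t_def u_def ins_def by linarith
    qed
    then show ?thesis using hc False by simp
  qed
qed

lemma val_child:
  assumes "0 < x" "x \<le> r" "b x \<noteq> 0" "ins u0 i j x"
  defines "t \<equiv> i + al x - al u0" and "u \<equiv> j + be x - be u0"
  shows "if t < h (b x) \<and> u < w (b x) then val x t u = val (b x) t u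
    else val x t u = val (c x) (t - (h x - h (c x))) (u - (w x - w (c x))) \<and>
      t - (h x - h (c x)) < h (c x) \<and> u - (w x - w (c x)) < w (c x)"
proof -
  have "t < h x" "u < w x" using assms(4) by (auto simp: t_def u_def ins_def)
  moreover have "h x = h (b x) \<and> h x = h (c x) \<and> w x = w (b x) + w (c x) \<or>
      w x = w (b x) \<and> w x = w (c x) \<and> h x = h (b x) + h (c x)"
    using dims[of x] assms by simp
  moreover have "0 < h (c x)" "0 < w (c x)"
    using dims_pos[of "c x"] inner[of x] assms by auto
  ultimately show ?thesis using val[of x t u] assms by auto
qed

lemma val_desc:
  "desc u y \<Longrightarrow> ins u0 i j y \<Longrightarrow>
    val u (i + al u - al u0) (j + be u - be u0) = val y (i + al y - al u0) (j + be y - be u0)"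
proof (induction rule: desc.induct)
  case (step u y)
  let ?t = "i + al u - al u0" and ?u = "j + be u - be u0" and ?v = "hv u"
  have u: "0 < u" "u \<le> r" "b u \<noteq> 0" using hvD[OF step.hyps(1)] by auto
  have iv: "ins u0 i j ?v" using ins_desc[OF step.hyps(2) step.prems] .
  have iu: "ins u0 i j u" using ins_hv[OF step.hyps(1) iv] .
  have eqs: "al u = al ?v + offi u" "be u = be ?v + offj u"
    using al_eq[of u] be_eq[of u] u step.hyps(1) by auto
  have "?v = (if ?t < h (b u) \<and> ?u < w (b u) then b u else c u)"
    using ins_child_iff[OF u iu] iv step.hyps(1) by blast
  moreover have "?v = b u \<and> ?v \<noteq> c u \<or> (?v = c u \<and> ?v \<noteq> b u)"
    using hv_cases[OF step.hyps(1)] by auto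
  ultimately have "val u ?t ?u = val ?v (?t - offi u) (?u - offj u)"
    using val_child[OF u iu] by (auto simp: offi_def offj_def split: if_splits)
  moreover have "?t - offi u = i + al ?v - al u0" "?u - offj u = j + be ?v - be u0"
    using eqs by auto
  ultimately show ?case using step.IH[OF step.prems] by simp
qed simp

definition is_exit :: "nat \<Rightarrow> nat \<Rightarrow> nat \<Rightarrow> nat \<Rightarrow> bool" where
  "is_exit u0 i j e \<longleftrightarrow> desc u0 e \<and> ins u0 i j e \<and> \<not> (hv e \<noteq> 0 \<and> ins u0 i j (hv e))"

lemma exit_exists:
  assumes "0 < u0" "u0 \<le> r" "i < h u0" "j < w u0"
  shows "\<exists>e. is_exit u0 i j e"
proof -
  let ?Q = "\<lambda>e. desc u0 e \<and> ins u0 i j e"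
  \<comment> \<open>Numbers fall along the path, so the least number belongs to the last node that
    contains the cell.\<close>
  define e where "e = (LEAST e. ?Q e)"
  have "?Q u0" using assms by (auto intro: desc.refl ins_self)
  then have e: "?Q e" unfolding e_def by (rule LeastI)
  have "\<not> (hv e \<noteq> 0 \<and> ins u0 i j (hv e))"
  proof
    assume *: "hv e \<noteq> 0 \<and> ins u0 i j (hv e)"
    then have "?Q (hv e)" using e desc_trans desc_hv by blast
    then have "e \<le> hv e" unfolding e_def by (rule Least_le)
    then show False using hvD(5)[of e] * by simp
  qed
  with e show ?thesis by (auto simp: is_exit_def)
qed

text \<open>The node \<open>e\<close> belongs to the Cartesian subtree of \<open>x\<close>.\<close>

definition in_subtree :: "nat \<Rightarrow> nat \<Rightarrow> bool" where
  "in_subtree x e \<longleftrightarrow>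
     desc x e \<and> (\<forall>v. desc x v \<and> e \<le> v \<longrightarrow> z v \<le> z x) \<or>
     desc e x \<and> (\<forall>v. desc e v \<and> x \<le> v \<longrightarrow> z v \<le> z x)"

text \<open>The key of \<open>x\<close> is maximal between \<open>x\<close> and \<open>e\<close>,
  and a maximum is attained only once. So all keys strictly beyond \<open>x\<close> are smaller,
  which puts \<open>e\<close> into the left subtree and makes the step strict.\<close>

lemma in_subtree_lf:
  assumes "in_subtree x e" "x < e"
  shows "in_subtree (lf x) e \<and> z (lf x) < z x"
proof -
  have d: "desc e x" "\<And>v. desc e v \<Longrightarrow> x \<le> v \<Longrightarrow> z v \<le> z x"
    using assms descD unfolding in_subtree_def by fastforce+
  have "z v < z x" if v: "desc e v" "x < v" for v
  proof -
    have vx: "desc v x" using desc_linear[OF v(1) d(1)] v(2) by simp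
    show ?thesis
    proof (rule z_max_unique'[OF vx v(2)])
      fix y assume "desc v y" "x \<le> y"
      then show "z y \<le> z x" using d(2) desc_trans[OF v(1)] by blast
    qed
  qed
  then have e: "e \<in> Lf x" using d(1) assms(2) by (simp add: Lf_def)
  have x: "0 < x" "x \<le> r" using descD[OF d(1)] by auto
  let ?l = "lf x"
  have l: "?l \<in> Lf x" "\<And>y. y \<in> Lf x \<Longrightarrow> z y \<le> z ?l"
    using lf_max[OF x] e by (auto simp: is_max_def)
  have Lf: "v \<in> Lf x" if "y \<in> Lf x" "desc y v" "x < v" for y v
    using that desc_linear[of y v x] desc_trans[of y v] by (auto simp: Lf_def)
  have lx: "desc ?l x" "x < ?l" "z ?l < z x"
    using l(1) desc.refl[of ?l] descD[of ?l x] by (auto simp: Lf_def)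
  have "in_subtree ?l e"
  proof (cases "e \<le> ?l")
    case True
    then have "desc ?l e" using desc_linear2[OF d(1) lx(1)] by simp
    moreover have "z v \<le> z ?l" if "desc ?l v" "e \<le> v" for v
      using Lf[OF l(1) that(1)] assms(2) that(2) l(2) by simp
    ultimately show ?thesis by (simp add: in_subtree_def)
  next
    case False
    then have "desc e ?l" using desc_linear2[OF lx(1) d(1)] by simp
    moreover have "z v \<le> z ?l" if "desc e v" "?l \<le> v" for v
      using Lf[OF e that(1)] lx(2) that(2) l(2) by simp
    ultimately show ?thesis by (simp add: in_subtree_def)
  qed
  with lx show ?thesis by simp
qed

lemma in_subtree_rg:
  assumes "in_subtree x e" "e < x"
  shows "in_subtree (rg x) e \<and> z (rg x) < z x"
proof -
  have d: "desc x e" "\<And>v. desc x v \<Longrightarrow> e \<le> v \<Longrightarrow> z v \<le> z x"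
    using assms descD unfolding in_subtree_def by fastforce+
  have "z v < z x" if v: "desc x v" "e \<le> v" "v < x" for v
  proof (rule z_max_unique[OF v(1,3)])
    fix y assume "desc x y" "v \<le> y"
    then show "z y \<le> z x" using d(2) v(2) by simp
  qed
  then have e: "e \<in> Rg x" using d(1) assms(2) by (simp add: Rg_def)
  have x: "0 < x" "x \<le> r" using descD[OF d(1)] by auto
  let ?l = "rg x"
  have l: "?l \<in> Rg x" "\<And>y. y \<in> Rg x \<Longrightarrow> z y \<le> z ?l"
    using rg_max[OF x] e by (auto simp: is_max_def)
  have Rg: "v \<in> Rg x" if "y \<in> Rg x" "desc x v" "y \<le> v" "v < x" for y v
    using that by (auto simp: Rg_def)
  have lx: "desc x ?l" "?l < x" "z ?l < z x"
    using l(1) by (auto simp: Rg_def)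
  have "in_subtree ?l e"
  proof (cases "e \<le> ?l")
    case True
    then have "desc ?l e" using desc_linear[OF lx(1) d(1)] by simp
    moreover have "z v \<le> z ?l" if "desc ?l v" "e \<le> v" for v
      using Rg[OF e desc_trans[OF lx(1) that(1)]] descD[OF that(1)] lx(2) that(2) l(2) by simp
    ultimately show ?thesis by (simp add: in_subtree_def)
  next
    case False
    then have "desc e ?l" using desc_linear[OF d(1) lx(1)] by simp
    moreover have "z v \<le> z ?l" if "desc e v" "?l \<le> v" for v
      using Rg[OF l(1) desc_trans[OF d(1) that(1)]] descD[OF that(1)] assms(2) that(2) l(2) by simp
    ultimately show ?thesis by (simp add: in_subtree_def)
  qed
  with lx show ?thesis by simp
qed

lemma in_subtree_tl:
  assumes "desc u e"
  shows "in_subtree (tail u) e"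
proof -
  have u: "0 < u" "u \<le> r" using descD[OF assms] by auto
  have "desc e (tail u)" using desc_tl[OF assms] .
  moreover have "z v \<le> z (tail u)" if "desc e v" for v
  proof -
    have "desc u v" using assms that by (rule desc_trans)
    then have "floor_log (p v) = floor_log (p (tail u))"
      using desc_attr[of u v] desc_attr[of u "tail u"] desc_tl_self[OF u] by simp
    then show ?thesis using z_le[of v] z_tail[of "tail u"] desc_tl_self[OF u] by simp
  qed
  ultimately show ?thesis by (simp add: in_subtree_def)
qed

lemma in_subtreeD: "in_subtree x e \<Longrightarrow> 0 < x \<and> x \<le> r"
  using descD by (fastforce simp: in_subtree_def)

text \<open>Invariant of the query loop; \<open>t\<close> bounds the number of remaining iterations. The three summands
  of the potential account for the steps in the Cartesian trees and for the two kinds of light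
  edges.\<close>

definition qinv :: "nat \<Rightarrow> nat \<Rightarrow> nat \<Rightarrow> nat \<Rightarrow> nat \<Rightarrow> nat \<Rightarrow> bool" where
  "qinv a t u0 i j x \<longleftrightarrow> 0 < u0 \<and> u0 \<le> r \<and> i < h u0 \<and> j < w u0 \<and> val u0 i j = a \<and>
     (\<exists>e. is_exit u0 i j e \<and> in_subtree x e) \<and>
     z x + floor_log (p u0) + (floor_log (p r) - floor_log (pi u0)) \<le> t"

lemma qinvD: "qinv a t u0 i j x \<Longrightarrow> 0 < u0 \<and> u0 \<le> r \<and> 0 < x \<and> x \<le> r \<and> i < h u0 \<and> j < w u0"
  using in_subtreeD by (auto simp: qinv_def)

lemma qinv_init:
  assumes "i < h r" "j < w r"
  shows "qinv (val r i j) (3 * floor_log (p r)) r i j (tail r)"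
proof -
  have r: "0 < r" using r_pos by simp
  obtain e where e: "is_exit r i j e" using exit_exists[OF r _ assms] by auto
  then have "in_subtree (tail r) e" by (auto simp: is_exit_def intro: in_subtree_tl)
  moreover have "z (tail r) = floor_log (p r)"
    using z_tail[of "tail r"] desc_tl_self[OF r] desc_attr[of r "tail r"] by simp
  ultimately show ?thesis using e assms r by (auto simp: qinv_def)
qed

text \<open>The rectangles are nested, so if \<open>x\<close> misses the cell then so does
  everything after \<open>x\<close>, and the exit comes before \<open>x\<close>. The drop of
  \<open>z\<close> pays for the step.\<close>

lemma qinv_left:
  assumes "qinv a t u0 i j x" "\<not> ins u0 i j x"
  shows "0 < t \<and> qinv a (t - 1) u0 i j (lf x)"
proof -
  obtain e where e: "is_exit u0 i j e" "in_subtree x e" using assms(1) by (auto simp: qinv_def)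
  have "\<not> desc x e" using ins_desc assms(2) e(1) by (auto simp: is_exit_def)
  then have "desc e x" using e(2) by (auto simp: in_subtree_def)
  moreover from this have "x \<noteq> e" using \<open>\<not> desc x e\<close> by auto
  ultimately have "x < e" using descD[of e x] by simp
  then have "in_subtree (lf x) e \<and> z (lf x) < z x" using in_subtree_lf e(2) by blast
  with e(1) assms(1) show ?thesis by (auto simp: qinv_def)
qed

lemma exit_eq:
  assumes "is_exit u0 i j e" "in_subtree x e" "ins u0 i j x" "\<not> (hv x \<noteq> 0 \<and> ins u0 i j (hv x))"
  shows "e = x"
proof (rule ccontr)
  assume "e \<noteq> x"
  consider "desc x e" "e < x" | "desc e x" "x < e"
    using assms(2) \<open>e \<noteq> x\<close> descD[of x e] descD[of e x] by (fastforce simp: in_subtree_def)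
  then show False
  proof cases
    case 1
    then have "hv x \<noteq> 0" "desc (hv x) e" using desc_strict by auto
    then show False using ins_desc assms(1,4) by (auto simp: is_exit_def)
  next
    case 2
    then have "hv e \<noteq> 0" "desc (hv e) x" using desc_strict by auto
    then show False using ins_desc assms(1,3) by (auto simp: is_exit_def)
  qed
qed

lemma exit_less:
  assumes "is_exit u0 i j e" "in_subtree x e" "hv x \<noteq> 0" "ins u0 i j (hv x)"
  shows "e < x"
proof (rule ccontr)
  assume "\<not> e < x"
  then have "desc e x" using assms(2) descD by (force simp: in_subtree_def)
  then have "desc e (hv x)" using desc_trans desc_hv[OF assms(3)] by blast
  moreover have "hv x < e" using hvD(5)[OF assms(3)] \<open>\<not> e < x\<close> by simp
  ultimately have "hv e \<noteq> 0" "desc (hv e) (hv x)" using desc_strict by auto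
  then show False using ins_desc assms(1,4) by (auto simp: is_exit_def)
qed

lemma qinv_leaf:
  assumes "qinv a t u0 i j x" "ins u0 i j x" "b x = 0"
  shows "c x = a"
proof -
  have x: "0 < x" "x \<le> r" using qinvD[OF assms(1)] by auto
  obtain e where e: "is_exit u0 i j e" "in_subtree x e" using assms(1) by (auto simp: qinv_def)
  have "hv x = 0" using assms(3) by (simp add: hv_def)
  then have "e = x" using exit_eq e assms(2) by blast
  then have "desc u0 x" using e(1) by (simp add: is_exit_def)
  then have "a = val x (i + al x - al u0) (j + be x - be u0)"
    using val_desc[OF _ assms(2)] assms(1) by (fastforce simp: qinv_def)
  moreover have "i + al x - al u0 = 0" "j + be x - be u0 = 0"
    using assms(2) leaf[of x] x assms(3) by (auto simp: ins_def)
  ultimately show ?thesis using leaf[of x] x assms(3) by simp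
qed

text \<open>Staying on the path means a step to the right in the tree, paid by \<open>z\<close>.
  Leaving it restarts at \<open>tail v\<close>, whose key is at most \<open>z x\<close>, so the
  first summand does not grow; by \<open>light\<close>, either the size class falls or
  \<open>pi\<close> doubles, so one of the other summands falls.\<close>

lemma qinv_step:
  assumes q: "qinv a t u0 i j x" and ins: "ins u0 i j x" and bx: "b x \<noteq> 0"
  defines "i' \<equiv> i + al x - al u0" and "j' \<equiv> j + be x - be u0"
  defines "first \<equiv> i' < h (b x) \<and> j' < w (b x)"
  defines "v \<equiv> (if first then b x else c x)"
  shows "v = hv x \<Longrightarrow> 0 < t \<and> qinv a (t - 1) u0 i j (rg x)"
    and "v \<noteq> hv x \<Longrightarrow> 0 < t \<and> qinv a (t - 1) v
      (if first then i' else i' - (h x - h v)) (if first then j' else j' - (w x - w v)) (tail v)"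
proof -
  have x: "0 < x" "x \<le> r" using qinvD[OF q] by auto
  obtain e where e: "is_exit u0 i j e" "in_subtree x e" using q by (auto simp: qinv_def)
  have hv: "hv x \<noteq> 0 \<and> ins u0 i j (hv x) \<longleftrightarrow> hv x = v"
    using ins_child_iff[OF x bx ins] unfolding v_def first_def i'_def j'_def by simp
  show "0 < t \<and> qinv a (t - 1) u0 i j (rg x)" if "v = hv x"
  proof -
    have "e < x" using exit_less[OF e] hv that by blast
    then have "in_subtree (rg x) e \<and> z (rg x) < z x" using in_subtree_rg e(2) by blast
    with e(1) q show ?thesis by (auto simp: qinv_def)
  qed
  assume "v \<noteq> hv x"
  let ?i = "if first then i' else i' - (h x - h v)" and ?j = "if first then j' else j' - (w x - w v)"
  have ex: "e = x" using exit_eq[OF e ins] hv \<open>v \<noteq> hv x\<close> by metis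
  have u0x: "desc u0 x" using e(1) ex by (simp add: is_exit_def)
  have a: "a = val x i' j'"
    using val_desc[OF u0x ins] q by (simp add: qinv_def i'_def j'_def)
  have vc: "val x i' j' = val v ?i ?j \<and> ?i < h v \<and> ?j < w v"
    using val_child[OF x bx ins] by (auto simp: v_def first_def i'_def j'_def split: if_splits)
  have v: "0 < v" "v \<le> r" "v = b x \<or> v = c x" using inner[of x] x bx by (auto simp: v_def)
  obtain e' where e': "is_exit v ?i ?j e'" using exit_exists[OF v(1,2)] vc by blast
  then have s: "in_subtree (tail v) e'" by (auto simp: is_exit_def intro: in_subtree_tl)
  have ztl: "z (tail v) = floor_log (p v)"
    using z_tail[of "tail v"] desc_tl_self[OF v(1,2)] desc_attr[of v "tail v"] by simp
  \<comment> \<open>A light child fits into what \<open>x\<close> has in excess of its heavy child,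
    and the key of \<open>x\<close> bounds the logarithm of that excess.\<close>
  have pv: "p v \<le> p x - p (hv x)"
  proof (cases "hv x = 0")
    case True
    then show ?thesis using v(3) p_inner[of x] x bx by auto
  next
    case False
    then show ?thesis using hv_cases[OF False] v(3) \<open>v \<noteq> hv x\<close> p_inner[of x] x bx by auto
  qed
  then have zv: "floor_log (p v) \<le> z x"
    using floor_log_le_iff[OF pv] floor_log_diff_le_xor[OF p_hv_less[of x]] x
    by (simp add: z_def dz_def)
  \<comment> \<open>The potential is measured at \<open>u0\<close>, but the path is left at
    \<open>x\<close>: the size class is the same and \<open>pi\<close> has not decreased.\<close>
  have px: "floor_log (p x) = floor_log (p u0)" "pi u0 \<le> pi x" using desc_attr[OF u0x] by auto
  have le: "floor_log (p v) \<le> floor_log (p u0)"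
    using floor_log_le_iff[of "p v" "p x"] pv px by simp
  have piv: "pi u0 \<le> pi v"
    using pi_mono[of x v] x bx v(3) px(2) by simp
  have "floor_log (pi v) \<le> floor_log (p r)" using pi_le[of v] v by (intro floor_log_le_iff) auto
  moreover have "floor_log (p v) < floor_log (p u0) \<or> floor_log (pi u0) < floor_log (pi v)"
  proof -
    have "floor_log (pi u0) < floor_log (pi v)" if "2 * pi x \<le> pi v"
    proof -
      have "0 < pi u0" using pi_pos[of u0] q by (simp add: qinv_def)
      then have "Suc (floor_log (pi u0)) = floor_log (2 * pi u0)" by simp
      also have "\<dots> \<le> floor_log (pi v)" using that px(2) by (intro floor_log_le_iff) simp
      finally show ?thesis by simp
    qed
    then show ?thesis using light[of x v] x bx v(3) \<open>v \<noteq> hv x\<close> px(1) by auto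
  qed
  moreover have "floor_log (pi u0) \<le> floor_log (pi v)" using piv by (rule floor_log_le_iff)
  moreover have "z x + floor_log (p u0) + (floor_log (p r) - floor_log (pi u0)) \<le> t"
    using q by (simp add: qinv_def)
  ultimately have "0 < t"
    "z (tail v) + floor_log (p v) + (floor_log (p r) - floor_log (pi v)) \<le> t - 1"
    using zv le ztl by auto
  then show "0 < t \<and> qinv a (t - 1) v ?i ?j (tail v)"
    using v vc a e' s by (auto simp: qinv_def)
qed

end

section \<open>Construction of all Cartesian trees, bottom-up\<close>

context weighted_dag
begin

text \<open>The next greater element further down the path. The stack of the classical construction
  is the chain of these links starting at the latest node of the path, so one link per node
  represents the stacks of all paths at once.\<close>

definition ngp :: "nat \<Rightarrow> nat \<Rightarrow> bool" where
  "ngp k j \<longleftrightarrow> desc k j \<and> j < k \<and> z k < z j \<and> (\<forall>v. desc k v \<and> j < v \<and> v < k \<longrightarrow> z v < z k)"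

text \<open>The state when the nodes below \<open>u\<close> have been inserted. A right subtree
  consists of smaller nodes and is final at once; a left subtree consists of larger ones, so
  \<open>lf\<close> is correct only for the nodes seen so far.\<close>

definition stage :: "nat \<Rightarrow> (nat \<Rightarrow> nat) \<Rightarrow> (nat \<Rightarrow> nat) \<Rightarrow> (nat \<Rightarrow> nat) \<Rightarrow> (nat \<Rightarrow> nat) \<Rightarrow>
    (nat \<Rightarrow> nat) \<Rightarrow> (nat \<Rightarrow> nat) \<Rightarrow> bool" where
  "stage u al be tail lf rg ng \<longleftrightarrow> (\<forall>k. 0 < k \<and> k < u \<longrightarrow>
     al k = (if hv k = 0 then 0 else al (hv k) + offi k) \<and>
     be k = (if hv k = 0 then 0 else be (hv k) + offj k) \<and>
     tail k = (if hv k = 0 then k else tail (hv k)) \<and>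
     (hv k \<noteq> 0 \<longrightarrow> ngp k (ng k)) \<and>
     is_max {y \<in> Lf k. y < u} (lf k) \<and> is_max (Rg k) (rg k))"

lemma stage_end: "stage (Suc r) al be tail lf rg ng \<Longrightarrow> chain_tree r b c h w val pi al be tail lf rg"
proof unfold_locales
  assume s: "stage (Suc r) al be tail lf rg ng"
  fix k assume k: "0 < k" "k \<le> r"
  have "y < Suc r" if "y \<in> Lf k" for y using that descD[of y k] by (auto simp: Lf_def)
  then have "{y \<in> Lf k. y < Suc r} = Lf k" by blast
  then show "is_max (Lf k) (lf k)" using s k unfolding stage_def by (metis le_imp_less_Suc)
qed (auto simp: stage_def)

text \<open>\<open>scan u j l\<close>: the stack of the path has been popped down to \<open>j\<close>, and \<open>l\<close> was popped last.\<close>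

definition scan :: "nat \<Rightarrow> nat \<Rightarrow> nat \<Rightarrow> bool" where
  "scan u j l \<longleftrightarrow> desc u j \<and> j < u \<and> (if l = 0 then \<forall>v. desc u v \<and> j < v \<longrightarrow> v = u
     else desc u l \<and> j < l \<and> l < u \<and> z l < z j \<and> z l < z u \<and>
       (\<forall>v. desc u v \<and> j < v \<and> v < u \<longrightarrow> z v \<le> z l))"

text \<open>The nodes that have not been popped yet. Every node is popped at most once, which pays for the
  scans of all nodes together.\<close>

definition unpopped :: "nat \<Rightarrow> nat set" where
  "unpopped u = {y. 1 \<le> y \<and> y \<le> r \<and> (\<forall>x. 0 < x \<and> x < u \<longrightarrow> y \<notin> Rg x)}"

definition unscanned :: "nat \<Rightarrow> nat \<Rightarrow> nat set" where
  "unscanned u j = {y \<in> unpopped u. \<not> (desc u y \<and> j < y \<and> y < u)}"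

lemma finite_unpopped: "finite (unpopped u)"
  by (rule finite_subset[of _ "{..r}"]) (auto simp: unpopped_def)

lemma finite_unscanned: "finite (unscanned u j)"
  using finite_unpopped by (simp add: unscanned_def)

lemma card_unpopped: "card (unpopped u) \<le> r"
proof -
  have "unpopped u \<subseteq> {1..r}" by (auto simp: unpopped_def)
  from card_mono[OF _ this] show ?thesis by simp
qed

lemma unpopped_Suc: "unpopped (Suc u) \<subseteq> unpopped u"
  by (auto simp: unpopped_def)

lemma scan_less: "scan u j l \<Longrightarrow> desc u v \<Longrightarrow> j < v \<Longrightarrow> v < u \<Longrightarrow> z v < z u \<and> z v < z j"
  by (fastforce simp: scan_def split: if_splits)

lemma scan_init: "hv u \<noteq> 0 \<Longrightarrow> scan u (hv u) 0 \<and> unscanned u (hv u) = unpopped u"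
proof -
  assume u: "hv u \<noteq> 0"
  have "v = u" if "desc u v" "hv u < v" for v
    using desc_strict[OF that(1)] descD[of "hv u" v] descD[OF that(1)] that(2) by fastforce
  then show ?thesis using desc_hv[OF u] hvD(5)[OF u] by (auto simp: scan_def unscanned_def)
qed

text \<open>No key on the path exceeds that of the last node, so the scan never pops the bottom of
  the stack.\<close>

lemma scan_hv: "scan u j l \<Longrightarrow> z j < z u \<Longrightarrow> hv j \<noteq> 0"
proof
  assume s: "scan u j l" "z j < z u" "hv j = 0"
  then have "z j = floor_log (p u)" using z_tail[of j] desc_attr[of u j] by (simp add: scan_def)
  with s(2) z_le[of u] show False by simp
qed

lemma scan_step:
  assumes "scan u j l" "z j < z u" "ngp j j'"
  shows "scan u j' j" "card (unscanned u j') < card (unscanned u j)"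
proof -
  have j: "desc u j" "j < u" "0 < j" "j \<le> r" using assms(1) descD[of u j] by (auto simp: scan_def)
  have j': "desc j j'" "j' < j" "z j < z j'" "desc u j'"
    using assms(3) j desc_trans by (auto simp: ngp_def)
  show "scan u j' j"
  proof -
    have "z v \<le> z j" if v: "desc u v \<and> j' < v \<and> v < u" for v
    proof (cases "j \<le> v")
      case True
      then show ?thesis using scan_less[OF assms(1)] v by (cases "v = j") (auto simp: less_imp_le)
    next
      case False
      then have "desc j v" using desc_linear[of u j v] j v by simp
      then show ?thesis using assms(3) v False by (simp add: ngp_def less_imp_le)
    qed
    then show ?thesis using j j' assms(2) by (simp add: scan_def)
  qed
  \<comment> \<open>The node \<open>j\<close> has not been popped before: a node \<open>x\<close>
    that popped it would lie between \<open>j\<close> and \<open>u\<close> and have a larger key,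
    but all keys in between are smaller than that of \<open>j\<close>.\<close>
  have "j \<notin> Rg x" if x: "0 < x" "x < u" for x
  proof
    assume jx: "j \<in> Rg x"
    then have d: "desc x j" "j < x" "z j < z x" using j(1) desc.refl[of j] j by (auto simp: Rg_def)
    then have "desc u x" using desc_linear2[OF d(1) j(1)] x by simp
    then have "z x < z j" using scan_less[OF assms(1)] d x by blast
    with d show False by simp
  qed
  then have "j \<in> unscanned u j" using j by (auto simp: unscanned_def unpopped_def)
  moreover have "j \<notin> unscanned u j'" using j j' by (auto simp: unscanned_def)
  moreover have "unscanned u j' \<subseteq> unscanned u j" using j' by (auto simp: unscanned_def)
  ultimately have "unscanned u j' \<subset> unscanned u j" by blast
  then show "card (unscanned u j') < card (unscanned u j)"
    using finite_unscanned by (intro psubset_card_mono)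
qed

lemma scan_end:
  assumes "scan u j l" "\<not> z j < z u"
  shows "ngp u j" "is_max (Rg u) l" "unpopped (Suc u) \<subseteq> unscanned u j"
proof -
  have j: "desc u j" "j < u" "0 < u" using assms(1) descD[of u j] by (auto simp: scan_def)
  \<comment> \<open>The scan stops as soon as the key is no longer smaller; equality is excluded by
    \<open>z_first_ge\<close>, since all keys in between are below \<open>z u\<close>.\<close>
  have "z u < z j" using z_first_ge[OF j(1,2)] scan_less[OF assms(1)] assms(2) by simp
  then show "ngp u j" using j scan_less[OF assms(1)] by (simp add: ngp_def)
  have Rg: "y \<in> Rg u \<longleftrightarrow> desc u y \<and> j < y \<and> y < u" for y
  proof
    assume y: "y \<in> Rg u"
    then have "\<not> y \<le> j" using j \<open>z u < z j\<close> by (auto simp: Rg_def)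
    then show "desc u y \<and> j < y \<and> y < u" using y by (auto simp: Rg_def)
  qed (use scan_less[OF assms(1)] in \<open>auto simp: Rg_def\<close>)
  show "is_max (Rg u) l" using assms(1) Rg by (auto simp: is_max_def scan_def split: if_splits)
  show "unpopped (Suc u) \<subseteq> unscanned u j"
  proof
    fix y assume y: "y \<in> unpopped (Suc u)"
    then have "y \<notin> Rg u" using j(3) by (simp add: unpopped_def)
    then show "y \<in> unscanned u j" using Rg y unpopped_Suc by (auto simp: unscanned_def)
  qed
qed

lemma stage_step_tail:
  assumes "stage u al be tail lf rg ng" "hv u = 0"
  shows "stage (Suc u) (al(u := 0)) (be(u := 0)) (tail(u := u)) lf rg ng"
proof -
  have nd: "\<not> desc u y" if "y < u" for y using desc_strict[OF _ that] assms(2) by auto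
  then have "Rg u = {}" by (auto simp: Rg_def)
  moreover have "{y \<in> Lf u. y < Suc u} = {}" by (auto simp: Lf_def)
  moreover have "{y \<in> Lf k. y < Suc u} = {y \<in> Lf k. y < u}" if "k < u" for k
    using nd[OF that] by (auto simp: Lf_def less_Suc_eq)
  moreover have "hv k \<noteq> u" if "k < u" for k
    using that hvD(5)[of k] by (cases "hv k = 0") auto
  ultimately show ?thesis
    using assms unfolding stage_def by (auto simp: is_max_def less_Suc_eq)
qed

text \<open>The new node \<open>u\<close> becomes the left child of \<open>j\<close>, above all
  nodes it has popped. No other left child changes: if \<open>u\<close> belongs to the left subtree
  of some \<open>k\<close> other than \<open>j\<close>, then so does \<open>j\<close>, whose key is
  larger.\<close>

lemma stage_step:
  assumes s: "stage u al be tail lf rg ng" and "hv u \<noteq> 0" and n: "ngp u j" and l: "is_max (Rg u) l"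
  shows "stage (Suc u) (al(u := al (hv u) + offi u)) (be(u := be (hv u) + offj u))
    (tail(u := tail (hv u))) (lf(j := u)) (rg(u := l)) (ng(u := j))"
proof -
  have j: "desc u j" "j < u" "z u < z j" "\<And>v. desc u v \<Longrightarrow> j < v \<Longrightarrow> v < u \<Longrightarrow> z v < z u"
    using n by (auto simp: ngp_def)
  have e: "{y \<in> Lf u. y < Suc u} = {}" by (auto simp: Lf_def)
  have lf: "is_max {y \<in> Lf k. y < Suc u} ((lf(j := u)) k)" if k: "0 < k" "k < u" for k
  proof (cases "k = j")
    case True
    have "z y \<le> z u" if "y \<in> Lf j" "y < Suc u" for y
    proof (cases "y = u")
      case False
      have "desc y j" "j < y" using that(1) by (auto simp: Lf_def)
      then have "desc u y" using desc_linear2[of y j u] j(1) that(2) by simp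
      then show ?thesis using j(4)[of y] \<open>j < y\<close> that(2) False by simp
    qed simp
    moreover have "z v < z j" if "desc u v" "j < v" for v
      using j(3) j(4)[of v] that descD[OF that(1)] by (cases "v = u") fastforce+
    then have "u \<in> Lf j" using j by (auto simp: Lf_def)
    ultimately show ?thesis using True by (auto simp: is_max_def)
  next
    case False
    have m: "is_max {y \<in> Lf k. y < u} (lf k)" using s k by (simp add: stage_def)
    show ?thesis
    proof (cases "u \<in> Lf k")
      case uk: True
      then have u: "desc u k" "k < u" "\<And>v. desc u v \<Longrightarrow> k < v \<Longrightarrow> z v < z k" by (auto simp: Lf_def)
      have "\<not> j < k"
      proof
        assume "j < k"
        then have "z k < z u" using j(4) u by blast
        moreover have "z u < z k" using u desc.refl[of u] descD[OF u(1)] by simp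
        ultimately show False by simp
      qed
      then have kj: "k < j" using False by simp
      then have "desc j k" using desc_linear[OF j(1) u(1)] by simp
      then have "j \<in> Lf k" using kj u(3) desc_trans[OF j(1)] by (auto simp: Lf_def)
      then have "lf k \<in> Lf k" "lf k < u" "z j \<le> z (lf k)"
        "\<And>y. y \<in> Lf k \<Longrightarrow> y < u \<Longrightarrow> z y \<le> z (lf k)"
        using m j(2) by (auto simp: is_max_def)
      then show ?thesis using False j(3) by (auto simp: is_max_def less_Suc_eq)
    next
      case False
      then have "{y \<in> Lf k. y < Suc u} = {y \<in> Lf k. y < u}" by (auto simp: less_Suc_eq)
      with m \<open>k \<noteq> j\<close> show ?thesis by simp
    qed
  qed
  have hv: "hv k < u" if "k < u" for k
    using that hvD(5)[of k] by (cases "hv k = 0") auto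
  show ?thesis
    unfolding stage_def
  proof (intro allI impI)
    fix k assume k: "0 < k \<and> k < Suc u"
    show "(al(u := al (hv u) + offi u)) k = (if hv k = 0 then 0 else (al(u := al (hv u) + offi u)) (hv k) + offi k) \<and>
     (be(u := be (hv u) + offj u)) k = (if hv k = 0 then 0 else (be(u := be (hv u) + offj u)) (hv k) + offj k) \<and>
     (tail(u := tail (hv u))) k = (if hv k = 0 then k else (tail(u := tail (hv u))) (hv k)) \<and>
     (hv k \<noteq> 0 \<longrightarrow> ngp k ((ng(u := j)) k)) \<and>
     is_max {y \<in> Lf k. y < Suc u} ((lf(j := u)) k) \<and> is_max (Rg k) ((rg(u := l)) k)"
    proof (cases "k = u")
      case True
      then show ?thesis using e l n \<open>hv u \<noteq> 0\<close> hvD(5)[of u] by (simp add: is_max_def)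
    next
      case False
      then show ?thesis using lf[of k] s k hv[of k] by (auto simp: stage_def)
    qed
  qed
qed

end

section \<open>Straight-line programs\<close>

locale slp =
  fixes N S \<sigma> :: nat and kind lk rk H W :: "nat \<Rightarrow> nat" and V :: "nat \<Rightarrow> nat \<Rightarrow> nat \<Rightarrow> nat"
  assumes S_less: "S < N"
    and kind_le: "A < N \<Longrightarrow> kind A \<le> 2"
    and pos: "A < N \<Longrightarrow> 0 < H A \<and> 0 < W A"
    and letter: "A < N \<Longrightarrow> kind A = 0 \<Longrightarrow> H A = 1 \<and> W A = 1 \<and> V A 0 0 = lk A \<and> lk A < \<sigma>"
    and kids: "A < N \<Longrightarrow> kind A \<noteq> 0 \<Longrightarrow> lk A < N \<and> rk A < N"
    and horiz: "A < N \<Longrightarrow> kind A = 1 \<Longrightarrow> H A = H (lk A) \<and> H A = H (rk A) \<and> W A = W (lk A) + W (rk A)"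
    and vert: "A < N \<Longrightarrow> kind A = 2 \<Longrightarrow> W A = W (lk A) \<and> W A = W (rk A) \<and> H A = H (lk A) + H (rk A)"
    and V_kids: "A < N \<Longrightarrow> kind A \<noteq> 0 \<Longrightarrow> i < H A \<Longrightarrow> j < W A \<Longrightarrow>
      V A i j = (if i < H (lk A) \<and> j < W (lk A) then V (lk A) i j
        else V (rk A) (i - (H A - H (rk A))) (j - (W A - W (rk A))))"
begin

definition ar :: "nat \<Rightarrow> nat" where
  "ar A = H A * W A"

definition edge :: "nat \<Rightarrow> nat \<Rightarrow> bool" where
  "edge A B \<longleftrightarrow> A < N \<and> kind A \<noteq> 0 \<and> (B = lk A \<or> B = rk A)"

lemma kind_cases: "A < N \<Longrightarrow> kind A = 0 \<or> kind A = 1 \<or> kind A = 2"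
  using kind_le[of A] by auto

lemma ar_inner: "A < N \<Longrightarrow> kind A \<noteq> 0 \<Longrightarrow> ar A = ar (lk A) + ar (rk A)"
  using kind_cases[of A] horiz[of A] vert[of A] by (auto simp: ar_def algebra_simps)

lemma ar_pos: "A < N \<Longrightarrow> 0 < ar A"
  using pos[of A] by (simp add: ar_def)

text \<open>Areas fall strictly from a nonterminal to its children. This is the form in which
  acyclicity is used, since the given numbering of the nonterminals need not be bottom-up.\<close>

lemma ar_edge: "edge A B \<Longrightarrow> ar B < ar A \<and> B < N"
  using ar_inner[of A] kids[of A] ar_pos[of "lk A"] ar_pos[of "rk A"] by (auto simp: edge_def)

lemma dims_le_ar: "A < N \<Longrightarrow> H A \<le> ar A \<and> W A \<le> ar A"
  using pos[of A] by (simp add: ar_def)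

text \<open>The stack of the depth-first search, top first.\<close>

fun chain :: "nat list \<Rightarrow> bool" where
  "chain [] \<longleftrightarrow> True"
| "chain [A] \<longleftrightarrow> A = S"
| "chain (A # B # xs) \<longleftrightarrow> edge B A \<and> chain (B # xs)"

lemma chain_sorted: "chain xs \<Longrightarrow> sorted_wrt (\<lambda>a b. ar a < ar b) xs"
proof (induction xs rule: chain.induct)
  case (3 A B xs)
  then show ?case using ar_edge[of B A] by auto
qed auto

lemma chain_ar_le: "chain xs \<Longrightarrow> A \<in> set xs \<Longrightarrow> ar A \<le> ar S \<and> A < N"
proof (induction xs arbitrary: A rule: chain.induct)
  case (3 B C xs)
  then have e: "edge C B" "chain (C # xs)" by simp_all
  then have "ar C \<le> ar S" using 3(1)[of C] by simp
  then show ?case using 3(1)[OF e(2), of A] 3(3) ar_edge[OF e(1)] by auto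
qed (use S_less in auto)

lemma chain_distinct: "chain xs \<Longrightarrow> distinct xs"
proof -
  assume "chain xs"
  then have "sorted_wrt (<) (map ar xs)" using chain_sorted by (simp add: sorted_wrt_map)
  then have "distinct (map ar xs)" by (simp add: strict_sorted_iff)
  then show ?thesis by (simp add: distinct_map)
qed

text \<open>\<open>ord\<close> lists the finished nonterminals and \<open>num\<close> is its inverse, \<open>0\<close> marking the unfinished ones.\<close>

definition dinv :: "nat list \<Rightarrow> nat \<Rightarrow> (nat \<Rightarrow> nat) \<Rightarrow> (nat \<Rightarrow> nat) \<Rightarrow> bool" where
  "dinv xs k ord num \<longleftrightarrow> chain xs \<and> (\<forall>A\<in>set xs. num A = 0) \<and>
     (xs = [] \<longrightarrow> 0 < k \<and> ord k = S) \<and>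
     (\<forall>A<N. num A \<noteq> 0 \<longrightarrow> num A \<le> k \<and> ord (num A) = A) \<and>
     (\<forall>i. 0 < i \<and> i \<le> k \<longrightarrow> ord i < N \<and> num (ord i) = i \<and>
        (kind (ord i) \<noteq> 0 \<longrightarrow> 0 < num (lk (ord i)) \<and> num (lk (ord i)) < i \<and>
           0 < num (rk (ord i)) \<and> num (rk (ord i)) < i) \<and>
        ((\<exists>u. i < u \<and> u \<le> k \<and> edge (ord u) (ord i)) \<or> (\<exists>X\<in>set xs. edge X (ord i)) \<or>
         xs = [] \<and> i = k))"

lemma dinv_init: "dinv [S] 0 ord (\<lambda>_. 0)"
  by (simp add: dinv_def)

text \<open>The stack has no repetitions because areas grow along it, and none of its members is
  finished. The bound limits the scratch space and keeps the subtraction in the potential of the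
  search exact.\<close>

lemma dinv_bound:
  assumes "dinv xs k ord num"
  shows "length xs + k \<le> N"
proof -
  have i: "inj_on ord {1..k}"
    by (rule inj_on_inverseI[of _ num]) (use assms in \<open>auto simp: dinv_def\<close>)
  have "set xs \<inter> ord ` {1..k} = {}" using assms by (fastforce simp: dinv_def)
  then have "card (set xs \<union> ord ` {1..k}) = length xs + k"
    using distinct_card[OF chain_distinct[of xs]] assms card_image[OF i]
    by (subst card_Un_disjoint) (auto simp: dinv_def)
  moreover have "set xs \<union> ord ` {1..k} \<subseteq> {..<N}"
    using assms chain_ar_le[of xs] by (auto simp: dinv_def)
  ultimately show ?thesis using card_mono[of "{..<N}" "set xs \<union> ord ` {1..k}"] by simp
qed

lemma dinv_topD: "dinv (A # xs) k ord num \<Longrightarrow> A < N \<and> num A = 0 \<and> ar A \<le> ar S"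
  using chain_ar_le[of "A # xs" A] by (auto simp: dinv_def)

lemma dinv_push:
  assumes "dinv (A # xs) k ord num" "kind A \<noteq> 0" "B = lk A \<or> B = rk A" "num B = 0"
  shows "dinv (B # A # xs) k ord num"
proof -
  have "edge A B" using assms dinv_topD by (auto simp: edge_def)
  then have "chain (B # A # xs)" using assms(1) by (simp add: dinv_def)
  then show ?thesis using assms(1,4) unfolding dinv_def by auto
qed

lemma dinv_finish:
  assumes "dinv (A # xs) k ord num" "kind A \<noteq> 0 \<Longrightarrow> num (lk A) \<noteq> 0 \<and> num (rk A) \<noteq> 0"
  shows "dinv xs (Suc k) (ord(Suc k := A)) (num(A := Suc k))"
proof -
  let ?ord = "ord(Suc k := A)" and ?num = "num(A := Suc k)"
  have A: "A < N" "num A = 0" using dinv_topD[OF assms(1)] by auto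
  have ch: "chain (A # xs)" using assms(1) by (simp add: dinv_def)
  then have c: "chain xs" "A \<notin> set xs" using chain_distinct[OF ch] by (cases xs; simp)+
  have fin: "B \<noteq> A" if "num B \<noteq> 0" for B using A that by auto
  have ordA: "ord i \<noteq> A" if "0 < i" "i \<le> k" for i
    using assms(1) that fin[of "ord i"] by (auto simp: dinv_def)
  have old: "ord i < N \<and> num (ord i) = i \<and>
        (kind (ord i) \<noteq> 0 \<longrightarrow> 0 < num (lk (ord i)) \<and> num (lk (ord i)) < i \<and>
           0 < num (rk (ord i)) \<and> num (rk (ord i)) < i) \<and>
        ((\<exists>u. i < u \<and> u \<le> k \<and> edge (ord u) (ord i)) \<or> (\<exists>X\<in>set (A # xs). edge X (ord i)))"
    if "0 < i" "i \<le> k" for i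
    using assms(1) that unfolding dinv_def by blast
  have numk: "num B \<le> k \<and> ord (num B) = B" if "B < N" "num B \<noteq> 0" for B
    using assms(1) that unfolding dinv_def by blast
  have "?ord i < N \<and> ?num (?ord i) = i \<and>
        (kind (?ord i) \<noteq> 0 \<longrightarrow> 0 < ?num (lk (?ord i)) \<and> ?num (lk (?ord i)) < i \<and>
           0 < ?num (rk (?ord i)) \<and> ?num (rk (?ord i)) < i) \<and>
        ((\<exists>u. i < u \<and> u \<le> Suc k \<and> edge (?ord u) (?ord i)) \<or> (\<exists>X\<in>set xs. edge X (?ord i)) \<or>
         xs = [] \<and> i = Suc k)" if i: "0 < i" "i \<le> Suc k" for i
  proof (cases "i = Suc k")
    case True
    have "xs = [] \<or> (\<exists>X\<in>set xs. edge X A)" using ch by (cases xs) auto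
    moreover have "lk A < N \<and> rk A < N" if "kind A \<noteq> 0" using kids A that by blast
    ultimately show ?thesis using True A assms(2) fin[of "lk A"] fin[of "rk A"] numk[of "lk A"] numk[of "rk A"]
      by (auto simp: less_Suc_eq_le)
  next
    case False
    then have i': "0 < i" "i \<le> k" using i by auto
    \<comment> \<open>A parent that used to be on the stack may be \<open>A\<close>, which is now
      finished with the largest number.\<close>
    have ex: "(\<exists>u. i < u \<and> u \<le> Suc k \<and> edge (?ord u) (ord i)) \<or> (\<exists>X\<in>set xs. edge X (ord i))"
    proof -
      consider u where "i < u" "u \<le> k" "edge (ord u) (ord i)" | "edge A (ord i)"
        | "\<exists>X\<in>set xs. edge X (ord i)" using old[OF i'] by auto
      then show ?thesis
      proof cases
        case (1 u)
        then show ?thesis by (intro disjI1 exI[of _ u]) auto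
      next
        case 2
        then show ?thesis using i' by (intro disjI1 exI[of _ "Suc k"]) auto
      qed blast
    qed
    have "lk (ord i) \<noteq> A \<and> rk (ord i) \<noteq> A" if "kind (ord i) \<noteq> 0"
      using old[OF i'] that fin by auto
    then show ?thesis using False old[OF i'] ordA[OF i'] ex by auto
  qed
  moreover have "\<forall>B<N. ?num B \<noteq> 0 \<longrightarrow> ?num B \<le> Suc k \<and> ?ord (?num B) = B"
    using numk by (fastforce simp: le_Suc_eq)
  moreover have "xs = [] \<longrightarrow> A = S" using ch by auto
  moreover have "\<forall>B\<in>set xs. ?num B = 0" using assms(1) c by (auto simp: dinv_def)
  ultimately show ?thesis using c unfolding dinv_def by auto
qed

lemma dinv_dag:
  assumes d: "dinv [] k ord num"
    and f: "\<And>i. 0 < i \<Longrightarrow> i \<le> k \<Longrightarrow> h i = H (ord i) \<and> w i = W (ord i) \<and>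
      b i = (if kind (ord i) = 0 then 0 else num (lk (ord i))) \<and>
      c i = (if kind (ord i) = 0 then lk (ord i) else num (rk (ord i)))"
  shows "dag k b c h w (\<lambda>i. V (ord i))" "dag.p h w k = ar S" "\<And>i j. V (ord k) i j = V S i j"
    "h k = H S" "w k = W S" "k \<le> N"
proof -
  have old: "ord i < N \<and> num (ord i) = i \<and>
        (kind (ord i) \<noteq> 0 \<longrightarrow> 0 < num (lk (ord i)) \<and> num (lk (ord i)) < i \<and>
           0 < num (rk (ord i)) \<and> num (rk (ord i)) < i) \<and>
        ((\<exists>u. i < u \<and> u \<le> k \<and> edge (ord u) (ord i)) \<or> i = k)"
    if "0 < i" "i \<le> k" for i
    using d that unfolding dinv_def by auto
  have numk: "num B \<le> k \<and> ord (num B) = B" if "B < N" "num B \<noteq> 0" for B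
    using d that unfolding dinv_def by blast
  have k: "0 < k" "ord k = S" using d by (auto simp: dinv_def)
  have kid: "ord (b i) = lk (ord i) \<and> ord (c i) = rk (ord i) \<and> h (b i) = H (lk (ord i)) \<and>
     h (c i) = H (rk (ord i)) \<and> w (b i) = W (lk (ord i)) \<and> w (c i) = W (rk (ord i)) \<and> b i < i \<and>
     0 < c i \<and> c i < i \<and> kind (ord i) \<noteq> 0"
    if i: "0 < i" "i \<le> k" "b i \<noteq> 0" for i
  proof -
    have n: "kind (ord i) \<noteq> 0" "b i = num (lk (ord i))" "c i = num (rk (ord i))"
      using f[OF i(1,2)] i(3) by (auto split: if_splits)
    have l: "lk (ord i) < N" "rk (ord i) < N" using kids n old[OF i(1,2)] by auto
    have lt: "b i < i" "0 < c i" "c i < i" "0 < b i" using old[OF i(1,2)] n by auto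
    have "ord (b i) = lk (ord i)" "ord (c i) = rk (ord i)" using numk l lt n by auto
    then show ?thesis using f[of "b i"] f[of "c i"] lt n i by auto
  qed
  have leaf: "kind (ord i) = 0" if "0 < i" "i \<le> k" "b i = 0" for i
    using f[OF that(1,2)] old[OF that(1,2)] that(3) by (auto split: if_splits)
  show "dag k b c h w (\<lambda>i. V (ord i))"
  proof
    show "1 \<le> k" using k by simp
    fix i assume i: "1 \<le> i" "i \<le> k"
    then have i': "0 < i" by simp
    show "h i = 1 \<and> w i = 1 \<and> V (ord i) 0 0 = c i" if "b i = 0"
      using leaf[OF i' i(2) that] letter[of "ord i"] old[OF i' i(2)] f[OF i' i(2)] by auto
    assume bi: "b i \<noteq> 0"
    note kd = kid[OF i' i(2) bi] and fi = f[OF i' i(2)]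
    have oi: "ord i < N" using old[OF i' i(2)] by simp
    show "b i < i \<and> 1 \<le> c i \<and> c i < i" using kd by auto
    show "h i = h (b i) \<and> h i = h (c i) \<and> w i = w (b i) + w (c i) \<or>
      w i = w (b i) \<and> w i = w (c i) \<and> h i = h (b i) + h (c i)"
      using kind_cases[OF oi] horiz[OF oi] vert[OF oi] kd fi by auto
    fix ii jj assume "ii < h i" "jj < w i"
    then show "V (ord i) ii jj = (if ii < h (b i) \<and> jj < w (b i) then V (ord (b i)) ii jj
        else V (ord (c i)) (ii - (h i - h (c i))) (jj - (w i - w (c i))))"
      using V_kids[OF oi] kd fi by auto
  next
    fix i assume i: "1 \<le> i" "i < k"
    then obtain u where u: "i < u" "u \<le> k" "edge (ord u) (ord i)" using old[of i] by auto
    then have u0: "0 < u" by simp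
    have ku: "kind (ord u) \<noteq> 0" "ord i = lk (ord u) \<or> ord i = rk (ord u)"
      using u(3) by (auto simp: edge_def)
    have "num (ord i) = i" using old[of i] i by simp
    then show "\<exists>u. i < u \<and> u \<le> k \<and> b u \<noteq> 0 \<and> (b u = i \<or> c u = i)"
      using u f[OF u0 u(2)] old[OF u0 u(2)] ku by (intro exI[of _ u]) auto
  qed
  then interpret dag k b c h w "\<lambda>i. V (ord i)" .
  show "p k = ar S" using k f[of k] by (simp add: p_def ar_def)
  show "V (ord k) i j = V S i j" for i j using k by simp
  show "h k = H S" "w k = W S" using f[of k] k by auto
  show "k \<le> N" using dinv_bound[OF d] by simp
qed

end

section \<open>Grammars and their encoding as arrays\<close>

context
  fixes G :: "(nat, nat) grammar" and M :: "nat mat" and N :: nat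
  assumes slp: "is_slp2d G M" and nt: "nonterms G = {..<N}"
begin

definition rl :: "nat \<Rightarrow> (nat, nat) rhs" where
  "rl A = (THE r. (A, r) \<in> rules G)"

definition ex :: "nat \<Rightarrow> nat mat" where
  "ex A = (THE X. expands G A X)"

lemma rl_iff: "A < N \<Longrightarrow> (A, r) \<in> rules G \<longleftrightarrow> r = rl A"
proof -
  assume "A < N"
  then have "\<exists>!r. (A, r) \<in> rules G" using slp nt by (auto simp: is_slp2d_def)
  from theI'[OF this] this have "(A, rl A) \<in> rules G" "\<And>r. (A, r) \<in> rules G \<Longrightarrow> r = rl A"
    by (auto simp: rl_def)
  then show ?thesis by blast
qed

lemma rulesD: "(A, r) \<in> rules G \<Longrightarrow> A < N \<and> r = rl A \<and> (case r of Letter a \<Rightarrow> a \<in> alphabet G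
   | Horiz B C \<Rightarrow> B < N \<and> C < N | Vert B C \<Rightarrow> B < N \<and> C < N)"
proof -
  assume r: "(A, r) \<in> rules G"
  then have "A \<in> nonterms G \<and> (case r of Letter a \<Rightarrow> a \<in> alphabet G
         | Horiz B C \<Rightarrow> B \<in> nonterms G \<and> C \<in> nonterms G
         | Vert B C \<Rightarrow> B \<in> nonterms G \<and> C \<in> nonterms G)"
    using slp by (auto simp: is_slp2d_def)
  then show ?thesis using rl_iff[of A r] r by (auto simp: nt split: rhs.splits)
qed

lemma rule_unique: "(A, r) \<in> rules G \<Longrightarrow> (A, r') \<in> rules G \<Longrightarrow> r = r'"
  using rulesD by metis

lemma expands_unique: "expands G A X \<Longrightarrow> expands G A Y \<Longrightarrow> X = Y"
proof (induction arbitrary: Y rule: expands.induct)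
  case (letter A a)
  note r = rule_unique[OF letter.hyps(1)]
  from letter.prems show ?case
    by cases (drule r, simp)+
next
  case (horiz A B C X X')
  note r = rule_unique[OF horiz.hyps(1)]
  from horiz.prems show ?case
  proof cases
    case (horiz B' C' Z Z')
    then show ?thesis using r[OF horiz(2)] horiz.IH by auto
  qed (drule r, simp)+
next
  case (vert A B C X X')
  note r = rule_unique[OF vert.hyps(1)]
  from vert.prems show ?case
  proof cases
    case (vert B' C' Z Z')
    then show ?thesis using r[OF vert(2)] vert.IH by auto
  qed (drule r, simp)+
qed

lemma expands_ex: "A < N \<Longrightarrow> expands G A (ex A)"
proof -
  assume "A < N"
  then obtain X where X: "expands G A X" using slp nt unfolding is_slp2d_def by blast
  then have "ex A = X" unfolding ex_def using expands_unique by blast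
  with X show ?thesis by simp
qed

lemma ex_eqI: "expands G A X \<Longrightarrow> ex A = X"
  unfolding ex_def using expands_unique by blast

lemma start_less: "start G < N"
  using slp nt by (auto simp: is_slp2d_def)

lemma ex_start: "ex (start G) = M"
proof -
  have "{X. expands G (start G) X} = {M}" using slp unfolding is_slp2d_def by blast
  then have "expands G (start G) M" by blast
  then show ?thesis by (rule ex_eqI)
qed

lemma ex_letter:
  assumes "A < N" "rl A = Letter a"
  shows "ex A = mat 1 1 (\<lambda>_. a) \<and> a \<in> alphabet G"
proof -
  have r: "(A, Letter a) \<in> rules G" using rl_iff assms by simp
  then show ?thesis using ex_eqI[OF expands.letter[OF r]] rulesD[OF r] by simp
qed

lemma ex_horiz:
  assumes "A < N" "rl A = Horiz B C"
  shows "B < N \<and> C < N \<and> dim_row (ex B) = dim_row (ex C) \<and> ex A = hconcat (ex B) (ex C)"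
proof -
  have r: "(A, Horiz B C) \<in> rules G" using rl_iff assms by simp
  from expands_ex[OF assms(1)] show ?thesis
  proof cases
    case (horiz B' C' X Y)
    then have "B' = B" "C' = C" using rulesD[OF horiz(2)] assms by auto
    with horiz have "ex B = X" "ex C = Y" using ex_eqI by auto
    then show ?thesis using horiz rulesD[OF r] by simp
  qed (use assms rulesD in fastforce)+
qed

lemma ex_vert:
  assumes "A < N" "rl A = Vert B C"
  shows "B < N \<and> C < N \<and> dim_col (ex B) = dim_col (ex C) \<and> ex A = vconcat (ex B) (ex C)"
proof -
  have r: "(A, Vert B C) \<in> rules G" using rl_iff assms by simp
  from expands_ex[OF assms(1)] show ?thesis
  proof cases
    case (vert B' C' X Y)
    then have "B' = B" "C' = C" using rulesD[OF vert(2)] assms by auto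
    with vert have "ex B = X" "ex C = Y" using ex_eqI by auto
    then show ?thesis using vert rulesD[OF r] by simp
  qed (use assms rulesD in fastforce)+
qed

lemma expands_pos: "expands G A X \<Longrightarrow> 0 < dim_row X \<and> 0 < dim_col X"
  by (induction rule: expands.induct) (auto simp: hconcat_def vconcat_def)

definition kind :: "nat \<Rightarrow> nat" where "kind A = encode_rhs (rl A) ! 0"
definition lk :: "nat \<Rightarrow> nat" where "lk A = encode_rhs (rl A) ! 1"
definition rk :: "nat \<Rightarrow> nat" where "rk A = encode_rhs (rl A) ! 2"

lemma encode_rhs_eq: "encode_rhs (rl A) = [kind A, lk A, rk A]"
  by (cases "rl A") (simp_all add: kind_def lk_def rk_def)

lemma slp_locale:
  assumes "alphabet G = {..<\<sigma>}"
  shows "slp N (start G) \<sigma> kind lk rk (\<lambda>A. dim_row (ex A)) (\<lambda>A. dim_col (ex A))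
    (\<lambda>A i j. ex A $$ (i, j))"
proof
  show "start G < N" by (rule start_less)
  fix A assume A: "A < N"
  show "kind A \<le> 2" by (cases "rl A") (simp_all add: kind_def)
  show "0 < dim_row (ex A) \<and> 0 < dim_col (ex A)" using expands_pos[OF expands_ex[OF A]] .

  show "dim_row (ex A) = 1 \<and> dim_col (ex A) = 1 \<and> ex A $$ (0, 0) = lk A \<and> lk A < \<sigma>" if "kind A = 0"
    using that ex_letter[OF A] assms by (cases "rl A") (auto simp: kind_def lk_def)
  show "lk A < N \<and> rk A < N" if "kind A \<noteq> 0"
    using that ex_horiz[OF A] ex_vert[OF A] by (cases "rl A") (auto simp: kind_def lk_def rk_def)
  show "dim_row (ex A) = dim_row (ex (lk A)) \<and> dim_row (ex A) = dim_row (ex (rk A)) \<and>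
      dim_col (ex A) = dim_col (ex (lk A)) + dim_col (ex (rk A))" if "kind A = 1"
    using that ex_horiz[OF A] by (cases "rl A") (auto simp: kind_def lk_def rk_def hconcat_def)
  show "dim_col (ex A) = dim_col (ex (lk A)) \<and> dim_col (ex A) = dim_col (ex (rk A)) \<and>
      dim_row (ex A) = dim_row (ex (lk A)) + dim_row (ex (rk A))" if "kind A = 2"
    using that ex_vert[OF A] by (cases "rl A") (auto simp: kind_def lk_def rk_def vconcat_def)
  fix i j assume ij: "i < dim_row (ex A)" "j < dim_col (ex A)" and k: "kind A \<noteq> 0"
  show "ex A $$ (i, j) = (if i < dim_row (ex (lk A)) \<and> j < dim_col (ex (lk A)) then ex (lk A) $$ (i, j)
    else ex (rk A) $$ (i - (dim_row (ex A) - dim_row (ex (rk A))), j - (dim_col (ex A) - dim_col (ex (rk A)))))"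
  proof (cases "rl A")
    case (Letter a)
    then show ?thesis using k by (simp add: kind_def)
  next
    case (Horiz B C)
    then have "lk A = B" "rk A = C" by (simp_all add: lk_def rk_def)
    with ex_horiz[OF A Horiz] ij show ?thesis by (auto simp: hconcat_def)
  next
    case (Vert B C)
    then have "lk A = B" "rk A = C" by (simp_all add: lk_def rk_def)
    with ex_vert[OF A Vert] ij show ?thesis by (auto simp: vconcat_def)
  qed
qed

lemma card_le_grammar_size: "N \<le> grammar_size G"
proof -
  have f: "finite (rules G)"
    by (rule finite_subset[of _ "(\<lambda>A. (A, rl A)) ` {..<N}"]) (auto dest: rulesD)
  have "(\<lambda>A. (A, rl A)) ` {..<N} \<subseteq> rules G" using rl_iff by auto
  then have "card ((\<lambda>A. (A, rl A)) ` {..<N}) \<le> card (rules G)" using f by (intro card_mono)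
  then have "N \<le> card (rules G)" by (simp add: card_image inj_on_def)
  also have "\<dots> = (\<Sum>x\<in>rules G. 1)" by simp
  also have "\<dots> \<le> grammar_size G"
    unfolding grammar_size_def
  proof (rule sum_mono)
    fix x assume "x \<in> rules G"
    show "1 \<le> (case x of (A, r) \<Rightarrow> rhs_size r)" by (cases x; cases "snd x") auto
  qed
  finally show ?thesis .
qed

lemma concat_triple_nth:
  "A < n \<Longrightarrow> i < 3 \<Longrightarrow> (\<And>x. length (f x) = 3) \<Longrightarrow> concat (map f [0..<n]) ! (3 * A + i) = f A ! i"
proof (induction n)
  case (Suc n)
  have len: "length (concat (map f [0..<n])) = 3 * n"
    using Suc.prems(3) by (induction n) auto
  show ?case
  proof (cases "A = n")
    case False
    then show ?thesis using Suc len by (simp add: nth_append)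
  qed (use len Suc.prems in \<open>simp add: nth_append\<close>)
qed simp

text \<open>Two words precede the rules, hence the offset 2. The zeros behind the input are used
  too: they provide the initial numbering, in which every nonterminal is unfinished.\<close>

lemma memory_of_encode:
  defines "\<mu> \<equiv> memory_of (encode_grammar G)"
  shows "\<mu> 0 = N" "\<mu> 1 = start G"
    "A < N \<Longrightarrow> \<mu> (3 * A + 2) = kind A \<and> \<mu> (3 * A + 3) = lk A \<and> \<mu> (3 * A + 4) = rk A"
    "2 + 3 * N \<le> a \<Longrightarrow> \<mu> a = 0"
proof -
  let ?c = "concat (map (\<lambda>A. encode_rhs (rl A)) [0..<N])"
  have e: "encode_grammar G = N # start G # ?c"
    by (simp add: encode_grammar_def nt rl_def)
  have l3: "length (encode_rhs x) = 3" for x by (cases x) auto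
  have len: "length ?c = 3 * N"
    by (induction N) (simp_all add: l3)
  show "\<mu> 0 = N" "\<mu> 1 = start G" by (simp_all add: \<mu>_def memory_of_def e)
  show "2 + 3 * N \<le> a \<Longrightarrow> \<mu> a = 0" by (simp add: \<mu>_def memory_of_def e len del: length_concat)
  assume A: "A < N"
  have "\<mu> (3 * A + i + 2) = encode_rhs (rl A) ! i" if "i < 3" for i
    using concat_triple_nth[OF A that, of "\<lambda>A. encode_rhs (rl A)"] l3 A that
    by (simp add: \<mu>_def memory_of_def e len del: length_concat)
  from this[of 0] this[of 1] this[of 2]
  show "\<mu> (3 * A + 2) = kind A \<and> \<mu> (3 * A + 3) = lk A \<and> \<mu> (3 * A + 4) = rk A"
    by (simp add: encode_rhs_eq eval_nat_numeral)
qed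

end

text \<open>Memory is used as 14 interleaved arrays. At the index of a node, they hold its height and width, its
  two children (for a leaf: \<open>0\<close> and the letter), and then \<open>p\<close>, \<open>pi\<close>, \<open>hv\<close>, \<open>al\<close>, \<open>be\<close>, \<open>tail\<close>, \<open>lf\<close>, \<open>rg\<close>,
  the next node of larger \<open>z\<close> on the path, and \<open>dz\<close>. Index \<open>0\<close> is the header, which contains the root.
  Indices above the number \<open>N\<close> of nonterminals serve as scratch space: cells \<open>0\<close> to \<open>4\<close> for the three
  words of the rules, the numbers of the nonterminals, and the stack.\<close>

definition cell :: "nat \<Rightarrow> nat \<Rightarrow> nat" where
  "cell f k = 14 * k + f"

lemma cell_eq_iff [simp]: "f < 14 \<Longrightarrow> f' < 14 \<Longrightarrow> cell f k = cell f' k' \<longleftrightarrow> f = f' \<and> k = k'"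
proof
  assume f: "f < 14" "f' < 14" and e: "cell f k = cell f' k'"
  then have "(14 * k + f) mod 14 = (14 * k' + f') mod 14" "(14 * k + f) div 14 = (14 * k' + f') div 14"
    by (simp_all add: cell_def)
  then show "f = f' \<and> k = k'" using f by simp
qed simp

definition cell_ok :: "nat \<Rightarrow> nat \<Rightarrow> nat \<Rightarrow> bool" where
  "cell_ok w f k \<longleftrightarrow> 14 < (2::nat) ^ w \<and> f < 2 ^ w \<and> 14 * k < 2 ^ w \<and> 14 * k + f < 2 ^ w"

lemma cell_okI: "14 * k + 15 \<le> 2 ^ w \<Longrightarrow> f < 14 \<Longrightarrow> cell_ok w f k"
  by (auto simp: cell_ok_def)

definition fd :: "nat \<Rightarrow> expr \<Rightarrow> expr" where
  "fd f e = Ld (Bin Add (Bin Mul (N 14) e) (N f))"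

definition put :: "nat \<Rightarrow> expr \<Rightarrow> expr \<Rightarrow> com" where
  "put f e e' = Sto (Bin Add (Bin Mul (N 14) e) (N f)) e'"

lemma eval_fd [simp]: "eval (fd f e) s = snd s (cell f (eval e s))"
  by (simp add: fd_def cell_def)

lemma safe_fd [simp]: "safe w (fd f e) s \<longleftrightarrow> safe w e s \<and> cell_ok w f (eval e s)"
  by (auto simp: fd_def cell_ok_def)

lemma wp_put [simp]: "wp w (put f e e') Q s \<longleftrightarrow> safe w e s \<and> cell_ok w f (eval e s) \<and> safe w e' s \<and>
    Q (fst s, (snd s)(cell f (eval e s) := eval e' s))"
  by (auto simp: put_def cell_ok_def cell_def)

lemma wfe_fd [simp]: "wfe (fd f e) \<longleftrightarrow> wfe e"
  by (simp add: fd_def)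

lemma wfc_put [simp]: "wfc (put f e e') \<longleftrightarrow> wfe e \<and> wfe e'"
  by (simp add: put_def)

lemma loop_free_put [simp]: "loop_free (put f e e')"
  by (simp add: put_def)

lemma and_of_bool [simp]: "Bit_Operations.and (of_bool P) (of_bool Q) = (of_bool (P \<and> Q) :: nat)"
  by (cases P; cases Q) simp_all

lemma wp_mono: "wp w c P s \<Longrightarrow> (\<And>s'. P s' \<Longrightarrow> Q s') \<Longrightarrow> wp w c Q s"
  by (induction c arbitrary: s P Q) (auto split: if_splits)

text \<open>Here the index counts iterations, each of which costs at most the length of the loop.
  The unspent rest \<open>j\<close> remains in the bound so that the cost of an inner loop can be
  amortised over several executions.\<close>

lemma while_wp:
  assumes "I i s" "loop_free c"
    and "\<And>i s. I i s \<Longrightarrow> safe w e s"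
    and "\<And>i s. I i s \<Longrightarrow> eval e s \<noteq> 0 \<Longrightarrow> wp w c (\<lambda>s'. \<exists>j<i. I j s') s"
  shows "\<exists>k s' j. bs w (Whl e c) s k s' \<and> I j s' \<and> eval e s' = 0 \<and>
    k + (len c + ce e + 3) * j \<le> (len c + ce e + 3) * i + ce e + 1"
proof -
  let ?K = "len c + ce e + 3"
  define I' where "I' = (\<lambda>n s. \<exists>i. I i s \<and> n = ?K * i)"
  have "\<exists>k s' i'. bs w (Whl e c) s k s' \<and> I' i' s' \<and> eval e s' = 0 \<and> k + i' \<le> ?K * i + ce e + 1"
  proof (rule while_bs[of I'])
    show "I' (?K * i) s" using assms(1) by (auto simp: I'_def)
    show "safe w e s" if "I' i s" for i s using that assms(3) unfolding I'_def by blast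
    fix n s assume n: "I' n s" "eval e s \<noteq> 0"
    then obtain i where i: "I i s" "n = ?K * i" by (auto simp: I'_def)
    from wp_bs[OF assms(2) assms(4)[OF i(1) n(2)]] obtain k s' j where
      *: "bs w c s k s'" "k \<le> len c" "j < i" "I j s'" by blast
    have "?K * Suc j \<le> ?K * i" using *(3) by (intro mult_le_mono2) simp
    then have "ce e + 3 + k + ?K * j \<le> n" using *(2) i(2) by simp
    moreover have "I' (?K * j) s'" using *(4) by (auto simp: I'_def)
    ultimately show "\<exists>k s' i'. bs w c s k s' \<and> I' i' s' \<and> ce e + 3 + k + i' \<le> n" using * by blast
  qed
  then show ?thesis unfolding I'_def by blast
qed

lemma while_wp':
  assumes "I i s" "loop_free c"
    and "\<And>i s. I i s \<Longrightarrow> safe w e s"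
    and "\<And>i s. I i s \<Longrightarrow> eval e s \<noteq> 0 \<Longrightarrow> wp w c (\<lambda>s'. \<exists>j<i. I j s') s"
  shows "\<exists>k s' j. bs w (Whl e c) s k s' \<and> I j s' \<and> eval e s' = 0 \<and>
    k \<le> (len c + ce e + 3) * i + ce e + 1"
proof -
  have "\<exists>k s' j. bs w (Whl e c) s k s' \<and> I j s' \<and> eval e s' = 0 \<and>
    k + (len c + ce e + 3) * j \<le> (len c + ce e + 3) * i + ce e + 1"
    by (rule while_wp[of I]) (use assms in blast)+
  then obtain k s' j where "bs w (Whl e c) s k s'" "I j s'" "eval e s' = 0"
    "k + (len c + ce e + 3) * j \<le> (len c + ce e + 3) * i + ce e + 1" by blast
  then show ?thesis using le_trans[OF le_add1] by blast
qed

section \<open>Preprocessing\<close>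

text \<open>The node records start at address 0 and will overwrite the input, so the rules are first
  moved to records above \<open>N\<close>. These begin at address \<open>14 * (N + 1)\<close>,
  behind the \<open>3 * N + 2\<close> words of the input, and no word is lost before it is
  read.\<close>

definition copy_body :: com where
  "copy_body =
     Asg 4 (Bin Mul (N 3) (V 3)) ;;
     put 0 (Bin Add (V 2) (V 3)) (Ld (Bin Add (V 4) (N 2))) ;;
     put 1 (Bin Add (V 2) (V 3)) (Ld (Bin Add (V 4) (N 3))) ;;
     put 2 (Bin Add (V 2) (V 3)) (Ld (Bin Add (V 4) (N 4))) ;;
     Asg 3 (Bin Add (V 3) (N 1))"

definition copy_init :: com where
  "copy_init =
     Asg 0 (Ld (N 0)) ;; Asg 1 (Ld (N 1)) ;; Asg 2 (Bin Add (V 0) (N 1)) ;; Asg 3 (N 0)"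

definition copy_cond :: expr where
  "copy_cond = Bin Less (V 3) (V 0)"

definition copy :: com where
  "copy = copy_init ;; Whl copy_cond copy_body"

definition dfs_init :: com where
  "dfs_init = put 4 (V 2) (V 1) ;; Asg 4 (N 1) ;; Asg 5 (N 0)"

text \<open>Registers 4 and 5 count the stack and the finished nonterminals; 6 is the top of the stack. Register
  10 receives \<open>B + 1\<close> if the child \<open>B\<close> has to be finished first, and \<open>0\<close> if there is none.\<close>

definition dfs_look :: com where
  "dfs_look =
     Asg 6 (fd 4 (Bin Add (V 2) (Bin Sub (V 4) (N 1)))) ;;
     Asg 7 (fd 0 (Bin Add (V 2) (V 6))) ;;
     Asg 8 (fd 1 (Bin Add (V 2) (V 6))) ;;
     Asg 9 (fd 2 (Bin Add (V 2) (V 6))) ;;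
     Asg 10 (N 0) ;;
     Iff (V 7)
       (Asg 13 (fd 3 (Bin Add (V 2) (V 8))) ;;
        Asg 14 (fd 3 (Bin Add (V 2) (V 9))) ;;
        Iff (V 13)
          (Iff (V 14)
             (Asg 11 (fd 0 (V 13)) ;;
              Asg 12 (fd 1 (V 13)) ;;
              Iff (Bin Equal (V 7) (N 1))
                (Asg 12 (Bin Add (V 12) (fd 1 (V 14))))
                (Asg 11 (Bin Add (V 11) (fd 0 (V 14)))))
             (Asg 10 (Bin Add (V 9) (N 1))))
          (Asg 10 (Bin Add (V 8) (N 1))))
       (Asg 11 (N 1) ;; Asg 12 (N 1) ;; Asg 13 (N 0) ;; Asg 14 (V 8))"

definition dfs_act :: com where
  "dfs_act =
     Iff (V 10)
       (put 4 (Bin Add (V 2) (V 4)) (Bin Sub (V 10) (N 1)) ;;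
        Asg 4 (Bin Add (V 4) (N 1)))
       (Asg 5 (Bin Add (V 5) (N 1)) ;;
        put 0 (V 5) (V 11) ;; put 1 (V 5) (V 12) ;; put 2 (V 5) (V 13) ;; put 3 (V 5) (V 14) ;;
        put 4 (V 5) (Bin Mul (V 11) (V 12)) ;; put 5 (V 5) (N 0) ;; put 6 (V 5) (N 0) ;;
        put 7 (V 5) (N 0) ;; put 8 (V 5) (N 0) ;; put 9 (V 5) (N 0) ;; put 10 (V 5) (N 0) ;;
        put 11 (V 5) (N 0) ;; put 12 (V 5) (N 0) ;; put 13 (V 5) (N 0) ;;
        put 3 (Bin Add (V 2) (V 6)) (V 5) ;;
        Asg 4 (Bin Sub (V 4) (N 1)))"

definition dfs :: com where
  "dfs = dfs_init ;; Whl (V 4) (dfs_look ;; dfs_act)"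

section \<open>Copying the rules and numbering the nonterminals in postorder\<close>

locale prep = slp +
  fixes w :: nat
  assumes big: "64 * (N + ar S + \<sigma> + 1) \<le> 2 ^ w"
begin

text \<open>The last scratch record has index \<open>2 * N\<close>. All addresses stay below
  \<open>28 * N + 29\<close>, which the factor 64 in \<open>big\<close> covers.\<close>

lemma cell_ok_prep [simp]: "k \<le> 2 * N + 1 \<Longrightarrow> f < 14 \<Longrightarrow> cell_ok w f k"
  using big by (intro cell_okI) auto

definition input :: "(nat \<Rightarrow> nat) \<Rightarrow> nat \<Rightarrow> bool" where
  "input \<mu> n \<longleftrightarrow> (\<forall>A<n. \<mu> (cell 0 (Suc (N + A))) = kind A \<and>
     \<mu> (cell 1 (Suc (N + A))) = lk A \<and> \<mu> (cell 2 (Suc (N + A))) = rk A)"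

definition raw :: "(nat \<Rightarrow> nat) \<Rightarrow> bool" where
  "raw \<mu> \<longleftrightarrow> \<mu> 0 = N \<and> \<mu> 1 = S \<and>
     (\<forall>A<N. \<mu> (3 * A + 2) = kind A \<and> \<mu> (3 * A + 3) = lk A \<and> \<mu> (3 * A + 4) = rk A)"

definition unnumbered :: "(nat \<Rightarrow> nat) \<Rightarrow> bool" where
  "unnumbered \<mu> \<longleftrightarrow> (\<forall>A<N. \<mu> (cell 3 (Suc (N + A))) = 0)"

definition copy_inv :: "nat \<Rightarrow> state \<Rightarrow> bool" where
  "copy_inv i s \<longleftrightarrow> fst s 0 = N \<and> fst s 1 = S \<and> fst s 2 = Suc N \<and> fst s 3 \<le> N \<and> i = N - fst s 3 \<and>
     input (snd s) (fst s 3) \<and> raw (snd s) \<and> unnumbered (snd s)"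

lemma raw_upd: "raw \<mu> \<Longrightarrow> raw (\<mu>(cell f (Suc (N + A)) := x))"
  by (auto simp: raw_def cell_def)

lemma copy_inv_step:
  assumes "copy_inv i s" "fst s 3 < N"
  shows "wp w copy_body (\<lambda>s'. \<exists>j<i. copy_inv j s') s"
proof -
  obtain R \<mu> where s: "s = (R, \<mu>)" by fastforce
  define A where "A = R 3"
  have R: "R 0 = N" "R 1 = S" "R 2 = Suc N" "R 3 = A" "A < N" "i = N - A" "input \<mu> A" "raw \<mu>"
    "unnumbered \<mu>" using assms by (auto simp: copy_inv_def s A_def)
  have ne: "3 * A + 2 \<noteq> cell f (Suc (N + A'))" "3 * A + 3 \<noteq> cell f (Suc (N + A'))"
    "3 * A + 4 \<noteq> cell f (Suc (N + A'))" for f A'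
    using R(5) by (auto simp: cell_def)
  define \<mu>' where "\<mu>' = \<mu>(cell 0 (Suc (N + A)) := kind A, cell 1 (Suc (N + A)) := lk A,
    cell 2 (Suc (N + A)) := rk A)"
  have raw: "raw \<mu>'" using R(8) raw_upd by (simp add: \<mu>'_def)
  have reads: "\<mu> (3 * A + 2) = kind A" "\<mu> (3 * A + 3) = lk A" "\<mu> (3 * A + 4) = rk A"
    using R(5,8) by (auto simp: raw_def)
  have inp: "input \<mu>' (Suc A)" using R(7) by (auto simp: input_def less_Suc_eq \<mu>'_def)
  have un: "unnumbered \<mu>'" using R(9) by (auto simp: unnumbered_def \<mu>'_def)
  let ?R = "R(4 := 3 * A, 3 := A + 1)"
  have "copy_inv (N - Suc A) (?R, \<mu>')" using R raw inp un by (simp add: copy_inv_def)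
  moreover have "N - Suc A < i" using R by simp
  ultimately have fin: "\<exists>j<i. copy_inv j (?R, \<mu>')" by blast
  have b: "3 * A + 4 < (2::nat) ^ w" "3 * A + 3 < (2::nat) ^ w" "3 * A + 2 < (2::nat) ^ w"
    "N + A < (2::nat) ^ w" "Suc (N + A) < (2::nat) ^ w" "3 * A < (2::nat) ^ w" "4 < (2::nat) ^ w"
    "3 < (2::nat) ^ w" "2 < (2::nat) ^ w" "1 < (2::nat) ^ w" "Suc A < (2::nat) ^ w"
    using big R(5) by simp_all
  show ?thesis
    using R(1-6) b fin[unfolded \<mu>'_def] unfolding copy_body_def s
    by (simp add: ne reads del: add_2_eq_Suc' One_nat_def)
qed

lemma copy_correct:
  assumes "raw (snd s)" "unnumbered (snd s)"
  shows "\<exists>k s'. bs w copy s k s' \<and> fst s' 1 = S \<and> fst s' 2 = Suc N \<and> input (snd s') N \<and>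
    unnumbered (snd s') \<and> k \<le> len copy * (N + 1)"
proof -
  have "1 < (2::nat) ^ w" "N + 1 < (2::nat) ^ w" using big by simp_all
  then have "wp w copy_init (copy_inv N) s"
    using assms by (simp add: copy_init_def copy_inv_def raw_def input_def)
  from wp_bs[OF _ this] obtain k1 s1 where
    1: "bs w copy_init s k1 s1" "k1 \<le> len copy_init" "copy_inv N s1"
    by (auto simp: copy_init_def)
  have e: "eval copy_cond s = of_bool (fst s 3 < fst s 0)" "safe w copy_cond s" for s
    by (simp_all add: copy_cond_def)
  have "\<exists>k s' j. bs w (Whl copy_cond copy_body) s1 k s' \<and> copy_inv j s' \<and>
      eval copy_cond s' = 0 \<and> k \<le> (len copy_body + ce copy_cond + 3) * N + ce copy_cond + 1"
  proof (rule while_wp'[of copy_inv, OF 1(3)])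
    show "loop_free copy_body" by (simp add: copy_body_def)
    fix i s assume *: "copy_inv i s" "eval copy_cond s \<noteq> 0"
    then have "fst s 3 < N" by (auto simp: e copy_inv_def)
    with *(1) show "wp w copy_body (\<lambda>s'. \<exists>j<i. copy_inv j s') s" by (rule copy_inv_step)
  qed (rule e)
  then obtain k2 s2 j where 2: "bs w (Whl copy_cond copy_body) s1 k2 s2"
    "copy_inv j s2" "\<not> fst s2 3 < fst s2 0"
    "k2 \<le> (len copy_body + ce copy_cond + 3) * N + ce copy_cond + 1"
    by (auto simp: e)
  have "k1 + k2 \<le> len copy * (N + 1)" using 1(2) 2(4) by (simp add: copy_def algebra_simps)
  moreover have "bs w copy s (k1 + k2) s2" unfolding copy_def using 1(1) 2(1) by (rule bs_Seq)
  moreover have "fst s2 3 = N" using 2(2,3) by (simp add: copy_inv_def)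
  then have "fst s2 1 = S \<and> fst s2 2 = Suc N \<and> input (snd s2) N \<and> unnumbered (snd s2)"
    using 2(2) by (simp add: copy_inv_def)
  ultimately show ?thesis by blast
qed

definition record_of :: "(nat \<Rightarrow> nat) \<Rightarrow> nat \<Rightarrow> nat \<Rightarrow> (nat \<Rightarrow> nat) \<Rightarrow> bool" where
  "record_of num i A \<mu> \<longleftrightarrow> \<mu> (cell 0 i) = H A \<and> \<mu> (cell 1 i) = W A \<and>
     \<mu> (cell 2 i) = (if kind A = 0 then 0 else num (lk A)) \<and>
     \<mu> (cell 3 i) = (if kind A = 0 then lk A else num (rk A)) \<and>
     \<mu> (cell 4 i) = H A * W A \<and>
     \<mu> (cell 5 i) = 0 \<and> \<mu> (cell 6 i) = 0 \<and> \<mu> (cell 7 i) = 0 \<and> \<mu> (cell 8 i) = 0 \<and>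
     \<mu> (cell 9 i) = 0 \<and> \<mu> (cell 10 i) = 0 \<and> \<mu> (cell 11 i) = 0 \<and> \<mu> (cell 12 i) = 0 \<and>
     \<mu> (cell 13 i) = 0"

definition dfs_mem :: "nat list \<Rightarrow> nat \<Rightarrow> (nat \<Rightarrow> nat) \<Rightarrow> (nat \<Rightarrow> nat) \<Rightarrow> (nat \<Rightarrow> nat) \<Rightarrow> bool" where
  "dfs_mem xs k ord num \<mu> \<longleftrightarrow> dinv xs k ord num \<and> input \<mu> N \<and>
     (\<forall>A<N. \<mu> (cell 3 (Suc (N + A))) = num A) \<and>
     (\<forall>d<length xs. \<mu> (cell 4 (Suc (N + d))) = rev xs ! d) \<and>
     (\<forall>i. 0 < i \<and> i \<le> k \<longrightarrow> record_of num i (ord i) \<mu>)"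

text \<open>A push lengthens the stack by one; finishing a nonterminal shortens it by one and
  increases \<open>k\<close>. Either way \<open>2 * (N - k) - length xs\<close> falls by exactly
  one.\<close>

definition dfs_inv :: "nat \<Rightarrow> state \<Rightarrow> bool" where
  "dfs_inv i s \<longleftrightarrow> (\<exists>xs k ord num. dfs_mem xs k ord num (snd s) \<and> fst s 2 = Suc N \<and>
     fst s 4 = length xs \<and> fst s 5 = k \<and> i = 2 * (N - k) - length xs)"

definition looked :: "nat \<Rightarrow> (nat \<Rightarrow> nat) \<Rightarrow> state \<Rightarrow> bool" where
  "looked A num s \<longleftrightarrow>
     fst s 10 = 0 \<and> fst s 11 = H A \<and> fst s 12 = W A \<and>
     fst s 13 = (if kind A = 0 then 0 else num (lk A)) \<and>
     fst s 14 = (if kind A = 0 then lk A else num (rk A)) \<and>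
     (kind A \<noteq> 0 \<longrightarrow> num (lk A) \<noteq> 0 \<and> num (rk A) \<noteq> 0) \<or>
     (\<exists>B. fst s 10 = Suc B \<and> kind A \<noteq> 0 \<and> (B = lk A \<or> B = rk A) \<and> num B = 0)"

lemma dfs_look_correct:
  assumes m: "dfs_mem (A # xs) k ord num (snd s)" and R: "fst s 2 = Suc N" "fst s 4 = Suc (length xs)"
  shows "wp w dfs_look (\<lambda>s'. snd s' = snd s \<and> fst s' 2 = Suc N \<and> fst s' 4 = Suc (length xs) \<and>
    fst s' 5 = fst s 5 \<and> fst s' 6 = A \<and>
    looked A num s') s"
proof -
  have d: "dinv (A # xs) k ord num" using m by (simp add: dfs_mem_def)
  have A: "A < N" "ar A \<le> ar S" using dinv_topD[OF d] by auto
  have len: "length xs + k < N" using dinv_bound[OF d] by simp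
  have top: "snd s (cell 4 (Suc (N + length xs))) = A"
    using m by (simp add: dfs_mem_def nth_append)
  have inp: "snd s (cell 0 (Suc (N + A))) = kind A" "snd s (cell 1 (Suc (N + A))) = lk A"
    "snd s (cell 2 (Suc (N + A))) = rk A"
    using m A by (auto simp: dfs_mem_def input_def)
  have num: "snd s (cell 3 (Suc (N + B))) = num B" if "B < N" for B
    using m that by (simp add: dfs_mem_def)
  have rec: "snd s (cell 0 (num B)) = H B \<and> snd s (cell 1 (num B)) = W B \<and> num B \<le> N"
    if "B < N" "0 < num B" for B
  proof -
    have "num B \<le> k" "ord (num B) = B" using d that unfolding dinv_def by auto
    then show ?thesis using m that len by (auto simp: dfs_mem_def record_of_def)
  qed
  have okn: "cell_ok w f (num B)" if "B < N" "0 < num B" "f < 14" for f B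
    using rec[OF that(1,2)] that(3) by simp
  have b: "N < 2 ^ w" "Suc N < 2 ^ w" "length xs < 2 ^ w" "Suc (length xs) < 2 ^ w"
    "Suc (N + length xs) < 2 ^ w" "0 < (2::nat) ^ w" "1 < (2::nat) ^ w" "Suc 0 < (2::nat) ^ w"
    "\<And>B. B < N \<Longrightarrow> Suc (N + B) < 2 ^ w" "\<And>B. B < N \<Longrightarrow> Suc B < 2 ^ w"
    using big len by auto
  show ?thesis
  proof (cases "kind A = 0")
    case True
    then show ?thesis unfolding dfs_look_def looked_def
      using R A len b letter[OF A(1)] by (simp add: top inp[unfolded One_nat_def])
  next
    case False
    then have kids: "lk A < N" "rk A < N" using kids[OF A(1)] by auto
    have "H A < 2 ^ w" "W A < 2 ^ w" using dims_le_ar[OF A(1)] A(2) big by auto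
    moreover have "kind A = 1 \<or> kind A = 2" using kind_cases[OF A(1)] False by simp
    ultimately show ?thesis unfolding dfs_look_def looked_def
      using False R A len b kids horiz[OF A(1)] vert[OF A(1)]
      by (auto simp: top inp[unfolded One_nat_def] num okn rec[unfolded One_nat_def])
  qed
qed

lemma dfs_step:
  assumes "dfs_inv i s" "fst s 4 \<noteq> 0"
  shows "wp w (dfs_look ;; dfs_act) (\<lambda>s'. \<exists>j<i. dfs_inv j s') s"
proof -
  obtain xs' k ord num where m: "dfs_mem xs' k ord num (snd s)" and R: "fst s 2 = Suc N"
     "fst s 4 = length xs'" "fst s 5 = k" "i = 2 * (N - k) - length xs'"
    using assms(1) unfolding dfs_inv_def by blast
  obtain A xs where xs: "xs' = A # xs" using assms(2) R by (cases xs') auto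
  have d: "dinv (A # xs) k ord num" using m xs by (simp add: dfs_mem_def)
  have A: "A < N" "num A = 0" "ar A \<le> ar S" using dinv_topD[OF d] by auto
  have len: "length xs + k < N" using dinv_bound[OF d] by simp
  have act: "wp w dfs_act (\<lambda>s'. \<exists>j<i. dfs_inv j s') s'"
    if s': "snd s' = snd s \<and> fst s' 2 = Suc N \<and> fst s' 4 = Suc (length xs) \<and>
    fst s' 5 = fst s 5 \<and> fst s' 6 = A \<and>
    looked A num s'" for s'
  proof (cases "fst s' 10 = 0")
    case False
    then obtain B where B: "fst s' 10 = Suc B" "kind A \<noteq> 0" "B = lk A \<or> B = rk A" "num B = 0"
      using s' by (auto simp: looked_def)
    let ?\<mu> = "(snd s)(cell 4 (Suc (N + Suc (length xs))) := B)"
    have d': "dinv (B # A # xs) k ord num" using dinv_push[OF d B(2-4)] .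
    have len': "length xs + k + 2 \<le> N" using dinv_bound[OF d'] by simp
    have BN: "B < N" using kids[OF A(1) B(2)] B(3) by auto
    have "dfs_mem (B # A # xs) k ord num ?\<mu>"
      using m d' len' unfolding xs dfs_mem_def
      by (auto simp: input_def record_of_def nth_append less_Suc_eq)
    then have "dfs_inv (2 * (N - k) - length (B # A # xs))
        ((fst s')(4 := length (B # A # xs)), ?\<mu>)"
      using s' R(3) unfolding dfs_inv_def by fastforce
    moreover have "2 * (N - k) - length (B # A # xs) < i" using R(4) xs len' by simp
    ultimately have fin: "\<exists>j<i. dfs_inv j ((fst s')(4 := length (B # A # xs)), ?\<mu>)" by blast
    have "Suc (N + Suc (length xs)) < 2 ^ w" "Suc (length (A # xs)) < 2 ^ w" "Suc B < 2 ^ w"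
      "1 < (2::nat) ^ w" using big len' BN by auto
    then show ?thesis unfolding dfs_act_def using s' B(1) fin len' by simp
  next
    case True
    then have s'': "fst s' 2 = Suc N" "fst s' 4 = Suc (length xs)" "fst s' 5 = k" "fst s' 6 = A"
      "fst s' 11 = H A" "fst s' 12 = W A" "fst s' 13 = (if kind A = 0 then 0 else num (lk A))"
      "fst s' 14 = (if kind A = 0 then lk A else num (rk A))"
      "kind A \<noteq> 0 \<Longrightarrow> num (lk A) \<noteq> 0 \<and> num (rk A) \<noteq> 0" "snd s' = snd s"
      using s' R(3) by (auto simp: looked_def)
    let ?bb = "if kind A = 0 then 0 else num (lk A)" and ?cc = "if kind A = 0 then lk A else num (rk A)"
    let ?\<mu> = "(snd s)(cell 0 (Suc k) := H A, cell 1 (Suc k) := W A, cell 2 (Suc k) := ?bb,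
      cell 3 (Suc k) := ?cc, cell 4 (Suc k) := H A * W A, cell 5 (Suc k) := 0,
      cell 6 (Suc k) := 0, cell 7 (Suc k) := 0, cell 8 (Suc k) := 0, cell 9 (Suc k) := 0,
      cell 10 (Suc k) := 0, cell 11 (Suc k) := 0, cell 12 (Suc k) := 0, cell 13 (Suc k) := 0,
      cell 3 (Suc (N + A)) := Suc k)"
    let ?ord = "ord(Suc k := A)" and ?num = "num(A := Suc k)"
    have d': "dinv xs (Suc k) ?ord ?num" using dinv_finish[OF d s''(9)] .
    have kA: "lk A \<noteq> A \<and> rk A \<noteq> A" if "kind A \<noteq> 0"
      using ar_edge[of A "lk A"] ar_edge[of A "rk A"] that A by (auto simp: edge_def)
    have "dfs_mem xs (Suc k) ?ord ?num ?\<mu>"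
      unfolding dfs_mem_def
    proof (intro conjI allI impI)
      show "dinv xs (Suc k) ?ord ?num" by (rule d')
      show "input ?\<mu> N" using m len by (auto simp: dfs_mem_def input_def)
      show "?\<mu> (cell 3 (Suc (N + B))) = ?num B" if "B < N" for B
        using m len that by (auto simp: dfs_mem_def)
      show "?\<mu> (cell 4 (Suc (N + e))) = rev xs ! e" if "e < length xs" for e
        using m len that by (auto simp: dfs_mem_def xs nth_append less_Suc_eq)
      fix i assume i: "0 < i \<and> i \<le> Suc k"
      show "record_of ?num i (?ord i) ?\<mu>"
      proof (cases "i = Suc k")
        case True
        then show ?thesis using kA len A by (auto simp: record_of_def)
      next
        case False
        then have ik: "0 < i" "i \<le> k" using i by auto
        then have r: "record_of num i (ord i) (snd s)" using m by (simp add: dfs_mem_def)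
        have "0 < num (lk (ord i)) \<and> 0 < num (rk (ord i))" if "kind (ord i) \<noteq> 0"
          using d ik that unfolding dinv_def by blast
        then have "lk (ord i) \<noteq> A \<and> rk (ord i) \<noteq> A" if "kind (ord i) \<noteq> 0"
          using A(2) that by auto
        then show ?thesis using r False ik len A(1) by (auto simp: record_of_def)
      qed
    qed
    then have "dfs_inv (2 * (N - Suc k) - length xs)
        ((fst s')(5 := Suc k, 4 := length xs), ?\<mu>)"
      using s'' R(3) unfolding dfs_inv_def by fastforce
    moreover have "2 * (N - Suc k) - length xs < i" using R(4) xs len by simp
    ultimately have fin: "\<exists>j<i. dfs_inv j ((fst s')(5 := Suc k, 4 := length xs), ?\<mu>)" by blast
    have "H A * W A \<le> ar S" using A(3) by (simp add: ar_def)
    then have b: "Suc k < 2 ^ w" "H A * W A < 2 ^ w" "Suc (length xs) < 2 ^ w" "1 < (2::nat) ^ w"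
      "0 < (2::nat) ^ w" "Suc (N + A) < 2 ^ w" "Suc 0 < (2::nat) ^ w"
      using big len A by auto
    show ?thesis unfolding dfs_act_def using s'' b fin len A(1) True by simp
  qed
  show ?thesis
    using wp_mono[OF dfs_look_correct[OF m[unfolded xs] R(1)]] act R(2) xs by simp
qed

lemma dfs_correct:
  assumes "input (snd s) N" "unnumbered (snd s)" "fst s 1 = S" "fst s 2 = Suc N"
  shows "\<exists>t s' r ord num. bs w dfs s t s' \<and> dfs_mem [] r ord num (snd s') \<and> fst s' 5 = r \<and>
    t \<le> len dfs * (2 * N + 1)"
proof -
  have "dfs_mem [S] 0 id (\<lambda>_. 0) ((snd s)(cell 4 (Suc N) := S))"
    using assms dinv_init by (auto simp: dfs_mem_def input_def unnumbered_def)
  then have "dfs_inv (2 * N - 1) ((fst s)(4 := 1, 5 := 0), (snd s)(cell 4 (Suc N) := S))"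
    using assms(4) unfolding dfs_inv_def by fastforce
  moreover have "1 < (2::nat) ^ w" "0 < (2::nat) ^ w" using big by simp_all
  ultimately have "wp w dfs_init (dfs_inv (2 * N - 1)) s"
    using assms(3,4) by (simp add: dfs_init_def)
  from wp_bs[OF _ this] obtain k1 s1 where
    1: "bs w dfs_init s k1 s1" "k1 \<le> len dfs_init" "dfs_inv (2 * N - 1) s1"
    by (auto simp: dfs_init_def)
  have "\<exists>k s' j. bs w (Whl (Submission.V 4) (dfs_look ;; dfs_act)) s1 k s' \<and> dfs_inv j s' \<and>
      eval (Submission.V 4) s' = 0 \<and>
      k \<le> (len (dfs_look ;; dfs_act) + ce (Submission.V 4) + 3) * (2 * N - 1) + ce (Submission.V 4) + 1"
  proof (rule while_wp'[of dfs_inv, OF 1(3)])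
    show "loop_free (dfs_look ;; dfs_act)" by (simp add: dfs_look_def dfs_act_def)
  qed (use dfs_step in auto)
  then obtain k2 s2 j where 2: "bs w (Whl (Submission.V 4) (dfs_look ;; dfs_act)) s1 k2 s2"
    "dfs_inv j s2" "fst s2 4 = 0"
    "k2 \<le> (len (dfs_look ;; dfs_act) + ce (Submission.V 4) + 3) * (2 * N - 1) + ce (Submission.V 4) + 1"
    by auto
  have "k2 \<le> (len (dfs_look ;; dfs_act) + ce (Submission.V 4) + 3) * (2 * N) + ce (Submission.V 4) + 1"
    using 2(4) mult_le_mono2[of "2 * N - 1" "2 * N" "len (dfs_look ;; dfs_act) + ce (Submission.V 4) + 3"]
    by linarith
  then have "k1 + k2 \<le> len dfs * (2 * N + 1)" using 1(2) by (simp add: dfs_def algebra_simps)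
  moreover have "bs w dfs s (k1 + k2) s2" unfolding dfs_def using 1(1) 2(1) by (rule bs_Seq)
  moreover obtain r ord num where "dfs_mem [] r ord num (snd s2)" "fst s2 5 = r"
    using 2(2,3) by (auto simp: dfs_inv_def)
  ultimately show ?thesis by blast
qed

end

text \<open>Record 0 still contains input words and is cleared, so that a size read through the null
  pointer is 0, in accordance with \<open>p 0 = 0\<close>. Only its first cell is set, to the
  root.\<close>

definition pis_init :: com where
  "pis_init =
     put 0 (N 0) (V 5) ;; put 1 (N 0) (N 0) ;; put 2 (N 0) (N 0) ;; put 3 (N 0) (N 0) ;;
     put 4 (N 0) (N 0) ;; put 5 (N 0) (N 0) ;; put 6 (N 0) (N 0) ;; put 7 (N 0) (N 0) ;;
     put 8 (N 0) (N 0) ;; put 9 (N 0) (N 0) ;; put 10 (N 0) (N 0) ;; put 11 (N 0) (N 0) ;;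
     put 12 (N 0) (N 0) ;; put 13 (N 0) (N 0) ;;
     put 5 (V 5) (N 1) ;; Asg 6 (V 5)"

definition pis_body :: com where
  "pis_body =
     Asg 7 (fd 2 (V 6)) ;;
     Iff (V 7)
       (Asg 8 (fd 3 (V 6)) ;;
        put 5 (V 7) (Bin Add (fd 5 (V 7)) (fd 5 (V 6))) ;;
        put 5 (V 8) (Bin Add (fd 5 (V 8)) (fd 5 (V 6))))
       Skip ;;
     Asg 6 (Bin Sub (V 6) (N 1))"

definition pis :: com where
  "pis = pis_init ;; Whl (V 6) pis_body"

definition heavy :: "nat \<Rightarrow> expr" where
  "heavy v = Bin And (Bin Less (Bin Xor (V 12) (fd 4 (V v))) (fd 4 (V v)))
     (Bin Less (fd 5 (V v)) (Bin Add (V 13) (V 13)))"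

definition paths_head :: com where
  "paths_head =
     Asg 7 (fd 2 (V 6)) ;; Asg 8 (fd 3 (V 6)) ;; Asg 9 (N 0) ;; Asg 10 (N 0) ;; Asg 11 (N 0) ;;
     Asg 12 (fd 4 (V 6)) ;; Asg 13 (fd 5 (V 6)) ;;
     Iff (V 7)
       (Iff (heavy 7) (Asg 9 (V 7))
         (Iff (heavy 8)
           (Asg 9 (V 8) ;; Asg 10 (Bin Sub (fd 0 (V 6)) (fd 0 (V 8))) ;;
            Asg 11 (Bin Sub (fd 1 (V 6)) (fd 1 (V 8))))
           Skip))
       Skip ;;
     put 6 (V 6) (V 9) ;; Asg 16 (Bin Xor (V 12) (fd 4 (V 9))) ;; put 13 (V 6) (V 16) ;;
     Asg 14 (V 9) ;; Asg 15 (N 0)"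

text \<open>\<open>And\<close> evaluates all its operands, so record 0 is read when register 14 is
  0; that access is safe and the first comparison makes the result false.\<close>

definition scan_cond :: expr where
  "scan_cond = Bin And (Bin Less (N 0) (V 14)) (Bin And (Bin Less (fd 13 (V 14)) (V 16))
     (Bin Less (fd 13 (V 14)) (Bin Xor (fd 13 (V 14)) (V 16))))"

definition scan_body :: com where
  "scan_body = Asg 15 (V 14) ;; Asg 14 (fd 12 (V 14))"

definition paths_post :: com where
  "paths_post =
     Iff (V 9)
       (put 7 (V 6) (Bin Add (fd 7 (V 9)) (V 10)) ;;
        put 8 (V 6) (Bin Add (fd 8 (V 9)) (V 11)) ;;
        put 9 (V 6) (fd 9 (V 9)) ;;
        put 11 (V 6) (V 15) ;; put 10 (V 14) (V 6) ;; put 12 (V 6) (V 14))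
       (put 7 (V 6) (N 0) ;; put 8 (V 6) (N 0) ;; put 9 (V 6) (V 6)) ;;
     Asg 6 (Bin Add (V 6) (N 1))"

definition paths_cond :: expr where
  "paths_cond = Bin Less (V 6) (Bin Add (V 5) (N 1))"

definition paths_body :: com where
  "paths_body = paths_head ;; Whl scan_cond scan_body ;; paths_post"

definition paths :: com where
  "paths = Asg 6 (N 1) ;; Whl paths_cond paths_body"

section \<open>The program that counts occurrences\<close>

context dag
begin

definition header :: "(nat \<Rightarrow> nat) \<Rightarrow> bool" where
  "header \<mu> \<longleftrightarrow> \<mu> (cell 0 0) = r \<and> (\<forall>f. 0 < f \<and> f < 14 \<longrightarrow> \<mu> (cell f 0) = 0)"

definition fixed :: "(nat \<Rightarrow> nat) \<Rightarrow> bool" where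
  "fixed \<mu> \<longleftrightarrow> (\<forall>k. 0 < k \<and> k \<le> r \<longrightarrow> \<mu> (cell 0 k) = h k \<and> \<mu> (cell 1 k) = w k \<and> \<mu> (cell 2 k) = b k \<and>
     \<mu> (cell 3 k) = c k \<and> \<mu> (cell 4 k) = p k)"

definition blank :: "(nat \<Rightarrow> nat) \<Rightarrow> bool" where
  "blank \<mu> \<longleftrightarrow> (\<forall>k f. 0 < k \<and> k \<le> r \<and> 6 \<le> f \<and> f < 14 \<longrightarrow> \<mu> (cell f k) = 0)"

end

locale dag_word = dag +
  fixes wl :: nat
  assumes big: "64 * (r + p r + 1) \<le> 2 ^ wl"
begin

lemma cell_ok_word [simp]: "k \<le> r \<Longrightarrow> f < 14 \<Longrightarrow> cell_ok wl f k"
  using big by (intro cell_okI) auto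

definition pis_inv :: "nat \<Rightarrow> state \<Rightarrow> bool" where
  "pis_inv i s \<longleftrightarrow> fst s 5 = r \<and> fst s 6 = i \<and> i \<le> r \<and> header (snd s) \<and> fixed (snd s) \<and> blank (snd s) \<and>
     pinv i (\<lambda>k. snd s (cell 5 k))"

lemma pinv_le: "pinv u A \<Longrightarrow> 1 \<le> k \<Longrightarrow> k \<le> r \<Longrightarrow> A k * p k \<le> p r"
proof -
  assume "pinv u A" and k: "1 \<le> k" "k \<le> r"
  then have "\<forall>k\<in>{1..r}. A k * p k \<le> p r" unfolding pinv_def by (elim conjE) assumption
  from bspec[OF this, of k] k show ?thesis by (simp only: atLeastAtMost_iff)
qed

lemma push_le:
  assumes "pinv u A" "1 \<le> u" "u \<le> r" "1 \<le> k" "k \<le> r"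
  shows "push u A k \<le> p r"
proof -
  have "push u A k * p k \<le> p r" using pinv_step[OF assms(1-3)] assms(4,5) by (rule pinv_le)
  moreover have "push u A k * 1 \<le> push u A k * p k" using p_pos[OF assms(4,5)] by (intro mult_le_mono2) simp
  ultimately show ?thesis by linarith
qed

lemma pis_step:
  assumes "pis_inv i s" "fst s 6 \<noteq> 0"
  shows "wp wl pis_body (\<lambda>s'. \<exists>j<i. pis_inv j s') s"
proof -
  obtain R \<mu> where s: "s = (R, \<mu>)" by fastforce
  define A where "A = (\<lambda>k. \<mu> (cell 5 k))"
  have R: "R 5 = r" "R 6 = i" "0 < i" "i \<le> r" "header \<mu>" "fixed \<mu>" "blank \<mu>" "pinv i A"
    using assms by (auto simp: pis_inv_def s A_def)
  have rec: "\<mu> (cell 2 i) = b i" "\<mu> (cell 3 i) = c i" using R by (auto simp: fixed_def)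
  have one: "1 < (2::nat) ^ wl" using big by simp
  have st: "pinv (i - 1) (push i A)" using pinv_step R by simp
  show ?thesis
  proof (cases "b i = 0")
    case True
    then have "push i A = A" by (simp add: push_def)
    then have "pis_inv (i - 1) (R(7 := 0, 6 := i - 1), \<mu>)"
      using R st unfolding pis_inv_def A_def by simp
    moreover have "i - 1 < i" using R by simp
    ultimately have "\<exists>j<i. pis_inv j (R(7 := 0, 6 := i - 1), \<mu>)" by blast
    moreover have "i < 2 ^ wl" using big R by simp
    ultimately show ?thesis using R True rec one unfolding pis_body_def s by simp
  next
    case False
    let ?\<mu>1 = "\<mu>(cell 5 (b i) := A (b i) + A i)"
    let ?x = "?\<mu>1 (cell 5 (c i)) + A i"
    let ?\<mu>2 = "?\<mu>1(cell 5 (c i) := ?x)"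
    let ?R = "R(7 := b i, 8 := c i, 6 := i - 1)"
    have kids: "b i < i" "0 < c i" "c i < i" "b i \<le> r" "c i \<le> r" using inner[of i] R False by auto
    have eq: "(\<lambda>k. ?\<mu>2 (cell 5 k)) = push i A"
      using False by (auto simp: push_def A_def fun_eq_iff)
    have "pis_inv (i - 1) (?R, ?\<mu>2)"
      using R(1-7) st kids False unfolding pis_inv_def eq fst_conv snd_conv
      by (simp add: header_def fixed_def blank_def)
    moreover have "i - 1 < i" using R by simp
    ultimately have fin: "\<exists>j<i. pis_inv j (?R, ?\<mu>2)" by blast
    \<comment> \<open>The first sum is at most the final value even if both children coincide, so
      the bound on the final values excludes overflow on the way.\<close>
    have "A (b i) + A i \<le> push i A (b i)" "?x = push i A (c i)"
      using False by (auto simp: push_def A_def)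
    then have b: "A (b i) + A i < 2 ^ wl" "?x < 2 ^ wl"
      using push_le[of i A "b i"] push_le[of i A "c i"] R kids False big by auto
    have Ai: "?\<mu>1 (cell 5 i) = A i" "\<mu> (cell 5 i) = A i" "\<mu> (cell 5 (b i)) = A (b i)"
      using kids by (auto simp: A_def)
    have "i < 2 ^ wl" using big R by simp
    then show ?thesis
      using R(1-4) False rec kids one b fin Ai unfolding pis_body_def s
      by (simp del: fun_upd_apply add: fun_upd_same fun_upd_other)
  qed
qed

lemma pis_correct:
  assumes "fst s 5 = r" "fixed (snd s)" "blank (snd s)"
    and z: "\<And>k. 0 < k \<Longrightarrow> k \<le> r \<Longrightarrow> snd s (cell 5 k) = 0"
  shows "\<exists>t s'. bs wl pis s t s' \<and> pis_inv 0 s' \<and> t \<le> len pis * (r + 1)"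
proof -
  obtain R \<mu> where s: "s = (R, \<mu>)" by fastforce
  let ?\<mu> = "\<mu>(cell 0 0 := r, cell 1 0 := 0, cell 2 0 := 0, cell 3 0 := 0, cell 4 0 := 0, cell 5 0 := 0,
    cell 6 0 := 0, cell 7 0 := 0, cell 8 0 := 0, cell 9 0 := 0, cell 10 0 := 0, cell 11 0 := 0,
    cell 12 0 := 0, cell 13 0 := 0, cell 5 r := 1)"
  have r0: "r \<noteq> 0" using r_pos by simp
  have "pinv r (\<lambda>k. ?\<mu> (cell 5 k))"
    by (rule pinv_init) (use z s in \<open>auto simp: s\<close>)
  moreover have "header ?\<mu>"
    unfolding header_def
  proof (intro conjI allI impI)
    fix f :: nat assume "0 < f \<and> f < 14"
    then have "f \<in> {1, 2, 3, 4, 5, 6, 7, 8, 9, 10, 11, 12, 13}" by (simp, arith)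
    then show "?\<mu> (cell f 0) = 0" using r0 by (elim insertE emptyE) simp_all
  qed (use r0 in simp)
  moreover have "fixed ?\<mu>" "blank ?\<mu>" using assms(2,3) by (auto simp: s fixed_def blank_def)
  ultimately have "pis_inv r (R(6 := r), ?\<mu>)" using assms(1) by (simp add: pis_inv_def s)
  moreover have "1 < (2::nat) ^ wl" "0 < (2::nat) ^ wl" using big by simp_all
  ultimately have "wp wl pis_init (pis_inv r) s"
    using assms(1) by (simp add: pis_init_def s)
  from wp_bs[OF _ this] obtain k1 s1 where
    1: "bs wl pis_init s k1 s1" "k1 \<le> len pis_init" "pis_inv r s1"
    by (auto simp: pis_init_def)
  have "\<exists>k s' j. bs wl (Whl (V 6) pis_body) s1 k s' \<and> pis_inv j s' \<and> eval (V 6) s' = 0 \<and>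
      k \<le> (len pis_body + ce (V 6) + 3) * r + ce (V 6) + 1"
  proof (rule while_wp'[of pis_inv, OF 1(3)])
    show "loop_free pis_body" by (simp add: pis_body_def)
  qed (use pis_step in auto)
  then obtain k2 s2 j where 2: "bs wl (Whl (V 6) pis_body) s1 k2 s2"
    "pis_inv j s2" "fst s2 6 = 0" "k2 \<le> (len pis_body + ce (V 6) + 3) * r + ce (V 6) + 1" by auto
  have "k1 + k2 \<le> len pis * (r + 1)" using 1(2) 2(4) by (simp add: pis_def algebra_simps)
  moreover have "bs wl pis s (k1 + k2) s2" unfolding pis_def using 1(1) 2(1) by (rule bs_Seq)
  moreover have "j = 0" using 2(2,3) by (simp add: pis_inv_def)
  then have "pis_inv 0 s2" using 2(2) by simp
  ultimately show ?thesis by blast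
qed

end

section \<open>The program that builds the heavy paths and the Cartesian trees\<close>

locale weighted_dag_word = weighted_dag + dag_word
begin

text \<open>Holds from the start, when these fields are 0, and at every later time. It yields both
  the absence of overflow and the number of bits per field.\<close>

definition small :: "(nat \<Rightarrow> nat) \<Rightarrow> bool" where
  "small \<mu> \<longleftrightarrow> (\<forall>k. 0 < k \<and> k \<le> r \<longrightarrow> \<mu> (cell 6 k) \<le> r \<and> \<mu> (cell 7 k) \<le> h k \<and> \<mu> (cell 8 k) \<le> w k \<and>
     \<mu> (cell 9 k) \<le> r \<and> \<mu> (cell 10 k) \<le> r \<and> \<mu> (cell 11 k) \<le> r \<and> \<mu> (cell 12 k) \<le> r \<and>
     \<mu> (cell 13 k) \<le> 2 * p r)"

abbreviation mem_stage :: "nat \<Rightarrow> (nat \<Rightarrow> nat) \<Rightarrow> bool" where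
  "mem_stage u \<mu> \<equiv> stage u (\<lambda>k. \<mu> (cell 7 k)) (\<lambda>k. \<mu> (cell 8 k)) (\<lambda>k. \<mu> (cell 9 k))
     (\<lambda>k. \<mu> (cell 10 k)) (\<lambda>k. \<mu> (cell 11 k)) (\<lambda>k. \<mu> (cell 12 k))"

definition paths_mem :: "nat \<Rightarrow> (nat \<Rightarrow> nat) \<Rightarrow> bool" where
  "paths_mem u \<mu> \<longleftrightarrow> header \<mu> \<and> fixed \<mu> \<and> small \<mu> \<and>
     (\<forall>k. 0 < k \<and> k \<le> r \<longrightarrow> \<mu> (cell 5 k) = pi k) \<and>
     (\<forall>k. 0 < k \<and> k < u \<longrightarrow> \<mu> (cell 6 k) = hv k \<and> \<mu> (cell 13 k) = dz k) \<and>
     mem_stage u \<mu>"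

definition paths_mid :: "nat \<Rightarrow> state \<Rightarrow> nat \<Rightarrow> nat \<Rightarrow> bool" where
  "paths_mid u s j l \<longleftrightarrow> paths_mem u (snd s) \<and> 0 < u \<and> u \<le> r \<and> fst s 5 = r \<and> fst s 6 = u \<and> fst s 9 = hv u \<and>
     (hv u \<noteq> 0 \<longrightarrow> fst s 10 = offi u \<and> fst s 11 = offj u) \<and> fst s 16 = dz u \<and>
     snd s (cell 6 u) = hv u \<and> snd s (cell 13 u) = dz u \<and> fst s 14 = j \<and> fst s 15 = l"

lemma fixedD: "fixed \<mu> \<Longrightarrow> 0 < k \<Longrightarrow> k \<le> r \<Longrightarrow> \<mu> (cell 0 k) = h k \<and> \<mu> (cell (Suc 0) k) = w k \<and>
    \<mu> (cell 2 k) = b k \<and> \<mu> (cell 3 k) = c k \<and> \<mu> (cell 4 k) = p k"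
  by (simp add: fixed_def)

lemma pi_less_word: "0 < k \<Longrightarrow> k \<le> r \<Longrightarrow> pi k + pi k < 2 ^ wl"
  using pi_le[of k] big by simp

lemma paths_head_correct:
  assumes m: "paths_mem u (snd s)" and R: "fst s 5 = r" "fst s 6 = u" "0 < u" "u \<le> r"
  shows "wp wl paths_head (\<lambda>s'. paths_mid u s' (hv u) 0) s"
proof -
  obtain Rg \<mu> where s: "s = (Rg, \<mu>)" by fastforce
  have fx: "fixed \<mu>" "header \<mu>" "\<And>k. 0 < k \<Longrightarrow> k \<le> r \<Longrightarrow> \<mu> (cell 5 k) = pi k"
    using m by (auto simp: paths_mem_def s)
  have p4: "\<mu> (cell 4 k) = p k" if "k \<le> r" for k
    using that fx by (cases "k = 0") (auto simp: fixed_def header_def)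
  note rec = fixedD[OF fx(1) R(3,4)]
  have one: "1 < (2::nat) ^ wl" "0 < (2::nat) ^ wl" using big by simp_all
  let ?\<mu> = "\<mu>(cell 6 u := hv u, cell 13 u := dz u)"
  have mem: "paths_mem u ?\<mu>"
  proof -
    have "mem_stage u ?\<mu>"
      using m by (simp add: paths_mem_def s)
    moreover have "small ?\<mu>" using m hv_le dz_le R by (auto simp: paths_mem_def small_def s)
    ultimately show ?thesis using m R by (auto simp: paths_mem_def s fixed_def header_def)
  qed
  have fin: "paths_mid u (Rg', ?\<mu>) (hv u) 0"
    if "Rg' 5 = r" "Rg' 6 = u" "Rg' 9 = hv u" "hv u \<noteq> 0 \<Longrightarrow> Rg' 10 = offi u \<and> Rg' 11 = offj u"
      "Rg' 16 = dz u" "Rg' 14 = hv u" "Rg' 15 = 0" for Rg'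
    using that mem R by (simp add: paths_mid_def)
  have dzu: "dz u = Bit_Operations.xor (p u) (\<mu> (cell 4 (hv u)))"
    using p4[OF hv_le] by (simp add: dz_def)
  show ?thesis
  proof (cases "b u = 0")
    case True
    then have hv: "hv u = 0" by (simp add: hv_def)
    show ?thesis using R(1-4) one rec True fx(3)[OF R(3,4)] unfolding paths_head_def s
      by (simp add: hv) (rule fin[unfolded dzu hv]; simp)
  next
    case False
    have kids: "0 < b u" "b u \<le> r" "0 < c u" "c u \<le> r" "b u < u" "c u < u"
      using inner[of u] R False by auto
    have off: "h (c u) \<le> h u" "w (c u) \<le> w u" using dims[of u] R False by auto
    have hw: "h u < 2 ^ wl" "w u < 2 ^ wl" using dims_le_root[of u] R big by auto
    note rb = fixedD[OF fx(1) kids(1,2)] and rc = fixedD[OF fx(1) kids(3,4)]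
    have hb: "hev u (b u) \<longleftrightarrow> Bit_Operations.xor (p u) (p (b u)) < p (b u) \<and> pi (b u) < pi u + pi u"
      using heavy_test[OF R(3,4) False, of "b u"] unfolding mult_2 by blast
    have hc: "hev u (c u) \<longleftrightarrow> Bit_Operations.xor (p u) (p (c u)) < p (c u) \<and> pi (c u) < pi u + pi u"
      using heavy_test[OF R(3,4) False, of "c u"] unfolding mult_2 by blast
    have pw: "pi u + pi u < 2 ^ wl" using pi_less_word R by simp
    consider (1) "hv u = b u" "hev u (b u)" | (2) "hv u = c u" "\<not> hev u (b u)" "hev u (c u)"
      | (3) "hv u = 0" "\<not> hev u (b u)" "\<not> hev u (c u)"
      using R False by (auto simp: hv_def)
    then show ?thesis
    proof cases
      case 1
      then show ?thesis using R(1-4) one rec rb False fx(3)[OF R(3,4)] fx(3)[OF kids(1,2)] kids hb pw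
        unfolding paths_head_def s heavy_def
        by (simp add: 1(1)) (rule fin[unfolded dz_def 1(1)]; simp add: 1 offi_def offj_def p4)
    next
      case 2
      have "c u \<noteq> b u" using 2 by auto
      then show ?thesis using R(1-4) one rec rb rc False fx(3)[OF R(3,4)] fx(3)[OF kids(1,2)]
          fx(3)[OF kids(3,4)] kids hb hc 2 pw off hw
        unfolding paths_head_def s heavy_def
        by (simp add: 2(1)) (rule fin[unfolded dz_def 2(1)]; simp add: 2 offi_def offj_def p4)
    next
      case 3
      then show ?thesis using R(1-4) one rec rb rc False fx(3)[OF R(3,4)] fx(3)[OF kids(1,2)]
          fx(3)[OF kids(3,4)] kids hb hc pw
        unfolding paths_head_def s heavy_def
        by (simp add: 3(1)) (rule fin[unfolded dzu 3(1)]; simp add: 3)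
    qed
  qed
qed

lemma paths_midD:
  assumes "paths_mid u s j l" "0 < k" "k < u"
  shows "snd s (cell 13 k) = dz k" "hv k \<noteq> 0 \<Longrightarrow> ngp k (snd s (cell 12 k))"
  using assms by (auto simp: paths_mid_def paths_mem_def stage_def)

definition scan_inv :: "nat \<Rightarrow> nat \<Rightarrow> state \<Rightarrow> bool" where
  "scan_inv u i s \<longleftrightarrow> (\<exists>j l. paths_mid u s j l \<and>
     (if hv u = 0 then j = 0 \<and> i = 0 else scan u j l \<and> i = card (unscanned u j)))"

lemma scan_inv_init:
  "paths_mid u s (hv u) 0 \<Longrightarrow> scan_inv u (if hv u = 0 then 0 else card (unpopped u)) s"
  using scan_init[of u] unfolding scan_inv_def by (intro exI[of _ "hv u"] exI[of _ 0]) auto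

lemma scan_cond_eval:
  assumes "paths_mid u s j l" "j = 0 \<or> scan u j l"
  shows "safe wl scan_cond s" "eval scan_cond s = of_bool (j \<noteq> 0 \<and> z j < z u)"
proof -
  have u: "0 < u" "u \<le> r" "fst s 14 = j" "fst s 16 = dz u" using assms(1) by (auto simp: paths_mid_def)
  have j: "j \<le> r" "j \<noteq> 0 \<Longrightarrow> j < u" using assms(2) u by (auto simp: scan_def)
  then show "safe wl scan_cond s" using u big by (simp add: scan_cond_def)
  show "eval scan_cond s = of_bool (j \<noteq> 0 \<and> z j < z u)"
  proof (cases "j = 0")
    case False
    then show ?thesis
      using z_less_test[of j u] u j paths_midD(1)[OF assms(1), of j] by (simp add: scan_cond_def)
  qed (use u in \<open>simp add: scan_cond_def\<close>)
qed

text \<open>The cost is charged to the nodes popped on behalf of \<open>u\<close>, apart from one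
  failing test. Summed over all \<open>u\<close> the cardinalities telescope, which makes the total
  linear.\<close>

lemma scan_correct:
  assumes "paths_mid u s (hv u) 0"
  shows "\<exists>t s' j l. bs wl (Whl scan_cond scan_body) s t s' \<and> paths_mid u s' j l \<and>
    (hv u \<noteq> 0 \<longrightarrow> ngp u j \<and> is_max (Rg u) l \<and> l < u) \<and>
    t + (len scan_body + ce scan_cond + 3) * card (unpopped (Suc u)) \<le>
    (len scan_body + ce scan_cond + 3) * card (unpopped u) + ce scan_cond + 1"
proof -
  let ?K = "len scan_body + ce scan_cond + 3"
  let ?i = "if hv u = 0 then 0 else card (unpopped u)"
  have ev: "safe wl scan_cond s \<and> (\<exists>j l. paths_mid u s j l \<and> eval scan_cond s = of_bool (j \<noteq> 0 \<and> z j < z u) \<and>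
      (if hv u = 0 then j = 0 \<and> i = 0 else scan u j l \<and> i = card (unscanned u j)))"
    if "scan_inv u i s" for i s
  proof -
    from that obtain j l where *: "paths_mid u s j l"
      "if hv u = 0 then j = 0 \<and> i = 0 else scan u j l \<and> i = card (unscanned u j)"
      unfolding scan_inv_def by blast
    then have "j = 0 \<or> scan u j l" by (auto split: if_splits)
    from scan_cond_eval[OF *(1) this] * show ?thesis by blast
  qed
  have "\<exists>k s' j. bs wl (Whl scan_cond scan_body) s k s' \<and> scan_inv u j s' \<and> eval scan_cond s' = 0 \<and>
    k + ?K * j \<le> ?K * ?i + ce scan_cond + 1"
  proof (rule while_wp[of "scan_inv u"])
    show "scan_inv u ?i s" using scan_inv_init[OF assms] .
    show "loop_free scan_body" by (simp add: scan_body_def)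
    show "safe wl scan_cond s" if "scan_inv u i s" for i s using ev[OF that] by blast
    fix i s assume i: "scan_inv u i s" and c: "eval scan_cond s \<noteq> 0"
    from ev[OF i] c obtain j l where j: "paths_mid u s j l" "j \<noteq> 0" "z j < z u" "hv u \<noteq> 0"
      "scan u j l" "i = card (unscanned u j)" by (auto split: if_splits)
    let ?j = "snd s (cell 12 j)"
    have ju: "j < u" "u \<le> r" "fst s 14 = j" using j(1,5) by (auto simp: paths_mid_def scan_def)
    have "ngp j ?j" using paths_midD(2)[OF j(1) _ ju(1)] scan_hv[OF j(5,3)] j(2) by simp
    note st = scan_step[OF j(5,3) this]
    have "paths_mid u ((fst s)(15 := j, 14 := ?j), snd s) ?j j"
      using j(1) by (simp add: paths_mid_def)
    then have "scan_inv u (card (unscanned u ?j)) ((fst s)(15 := j, 14 := ?j), snd s)"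
      using st(1) j(4) unfolding scan_inv_def by auto
    then have "\<exists>j'<i. scan_inv u j' ((fst s)(15 := j, 14 := ?j), snd s)"
      using st(2) j(6) by blast
    then show "wp wl scan_body (\<lambda>s'. \<exists>j<i. scan_inv u j s') s"
      using ju by (simp add: scan_body_def)
  qed
  then obtain t s' i where *: "bs wl (Whl scan_cond scan_body) s t s'" "scan_inv u i s'"
    "eval scan_cond s' = 0" "t + ?K * i \<le> ?K * ?i + ce scan_cond + 1" by blast
  from ev[OF *(2)] *(3) obtain j l where j: "paths_mid u s' j l" "j = 0 \<or> \<not> z j < z u"
    "if hv u = 0 then j = 0 \<and> i = 0 else scan u j l \<and> i = card (unscanned u j)" by auto
  have mono: "card (unpopped (Suc u)) \<le> card (unpopped u)"
    by (rule card_mono[OF finite_unpopped unpopped_Suc])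
  show ?thesis
  proof (cases "hv u = 0")
    case True
    then have "t \<le> ce scan_cond + 1" using *(4) by simp
    moreover have "?K * card (unpopped (Suc u)) \<le> ?K * card (unpopped u)"
      using mono by (rule mult_le_mono2)
    ultimately have "t + ?K * card (unpopped (Suc u)) \<le> ?K * card (unpopped u) + ce scan_cond + 1"
      by linarith
    with True *(1) j(1) show ?thesis by blast
  next
    case False
    then have sc: "scan u j l" "i = card (unscanned u j)" using j(3) by auto
    then have "0 < j" using descD[of u j] by (auto simp: scan_def)
    then have nz: "\<not> z j < z u" using j(2) by simp
    note e = scan_end[OF sc(1) nz]
    have "card (unpopped (Suc u)) \<le> i" unfolding sc(2)
      by (rule card_mono[OF finite_unscanned e(3)])
    then have "?K * card (unpopped (Suc u)) \<le> ?K * i" by (rule mult_le_mono2)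
    moreover have "t + ?K * i \<le> ?K * card (unpopped u) + ce scan_cond + 1"
      using *(4) False by (simp only: if_False)
    ultimately have "t + ?K * card (unpopped (Suc u)) \<le> ?K * card (unpopped u) + ce scan_cond + 1"
      by linarith
    moreover have "l < u" using sc(1) by (auto simp: scan_def split: if_splits)
    ultimately show ?thesis using *(1) j(1) e(1,2) by blast
  qed
qed

lemma paths_post_correct:
  assumes m: "paths_mid u s j l" and j: "hv u \<noteq> 0 \<Longrightarrow> ngp u j \<and> is_max (Rg u) l \<and> l < u"
  shows "wp wl paths_post (\<lambda>s'. paths_mem (Suc u) (snd s') \<and> fst s' 5 = r \<and> fst s' 6 = Suc u) s"
proof -
  obtain R \<mu> where s: "s = (R, \<mu>)" by fastforce
  have pm: "header \<mu>" "fixed \<mu>" "small \<mu>" "\<And>k. 0 < k \<Longrightarrow> k \<le> r \<Longrightarrow> \<mu> (cell 5 k) = pi k"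
    "\<And>k. 0 < k \<Longrightarrow> k < u \<Longrightarrow> \<mu> (cell 6 k) = hv k \<and> \<mu> (cell 13 k) = dz k"
    "mem_stage u \<mu>"
    using m by (auto simp: paths_mid_def paths_mem_def s)
  have R: "0 < u" "u \<le> r" "R 5 = r" "R 6 = u" "R 9 = hv u" "R 14 = j" "R 15 = l"
    "\<mu> (cell 6 u) = hv u" "\<mu> (cell 13 u) = dz u" "hv u \<noteq> 0 \<Longrightarrow> R 10 = offi u \<and> R 11 = offj u"
    using m by (auto simp: paths_mid_def s)
  have w: "1 < (2::nat) ^ wl" "Suc u < 2 ^ wl" "0 < (2::nat) ^ wl" using big R by simp_all
  show ?thesis
  proof (cases "hv u = 0")
    case True
    let ?\<mu> = "\<mu>(cell 7 u := 0, cell 8 u := 0, cell 9 u := u)"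
    have e: "(\<lambda>k. ?\<mu> (cell 7 k)) = (\<lambda>k. \<mu> (cell 7 k))(u := 0)"
      "(\<lambda>k. ?\<mu> (cell 8 k)) = (\<lambda>k. \<mu> (cell 8 k))(u := 0)"
      "(\<lambda>k. ?\<mu> (cell 9 k)) = (\<lambda>k. \<mu> (cell 9 k))(u := u)"
      "(\<lambda>k. ?\<mu> (cell 10 k)) = (\<lambda>k. \<mu> (cell 10 k))"
      "(\<lambda>k. ?\<mu> (cell 11 k)) = (\<lambda>k. \<mu> (cell 11 k))"
      "(\<lambda>k. ?\<mu> (cell 12 k)) = (\<lambda>k. \<mu> (cell 12 k))" by (auto simp: fun_eq_iff)
    have "mem_stage (Suc u) ?\<mu>"
      unfolding e by (rule stage_step_tail[OF pm(6) True])
    moreover have "small ?\<mu>" using pm(3) R by (auto simp: small_def)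
    moreover have "header ?\<mu>" "fixed ?\<mu>" using pm(1,2) R by (auto simp: header_def fixed_def)
    ultimately have "paths_mem (Suc u) ?\<mu>"
      using pm(4,5) R True by (auto simp: paths_mem_def less_Suc_eq)
    then show ?thesis using R w True by (simp add: paths_post_def s)
  next
    case False
    let ?v = "hv u"
    let ?\<mu> = "\<mu>(cell 7 u := \<mu> (cell 7 ?v) + offi u, cell 8 u := \<mu> (cell 8 ?v) + offj u,
      cell 9 u := \<mu> (cell 9 ?v), cell 11 u := l, cell 10 j := u, cell 12 u := j)"
    have n: "ngp u j" "is_max (Rg u) l" "l < u" using j False by auto
    have jr: "0 < j" "j \<le> r" "j < u" using n(1) R descD[of u j] by (auto simp: ngp_def)
    have v: "0 < ?v" "?v < u" "?v \<le> r" using hvD[OF False] by auto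
    have e: "(\<lambda>k. ?\<mu> (cell 7 k)) = (\<lambda>k. \<mu> (cell 7 k))(u := \<mu> (cell 7 ?v) + offi u)"
      "(\<lambda>k. ?\<mu> (cell 8 k)) = (\<lambda>k. \<mu> (cell 8 k))(u := \<mu> (cell 8 ?v) + offj u)"
      "(\<lambda>k. ?\<mu> (cell 9 k)) = (\<lambda>k. \<mu> (cell 9 k))(u := \<mu> (cell 9 ?v))"
      "(\<lambda>k. ?\<mu> (cell 10 k)) = (\<lambda>k. \<mu> (cell 10 k))(j := u)"
      "(\<lambda>k. ?\<mu> (cell 11 k)) = (\<lambda>k. \<mu> (cell 11 k))(u := l)"
      "(\<lambda>k. ?\<mu> (cell 12 k)) = (\<lambda>k. \<mu> (cell 12 k))(u := j)" by (auto simp: fun_eq_iff)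
    have "mem_stage (Suc u) ?\<mu>"
      unfolding e by (rule stage_step[OF pm(6) False n(1,2)])
    moreover have sm: "\<mu> (cell 7 ?v) \<le> h ?v" "\<mu> (cell 8 ?v) \<le> w ?v" "\<mu> (cell 9 ?v) \<le> r"
      using pm(3) v by (auto simp: small_def)
    then have le: "\<mu> (cell 7 ?v) + offi u \<le> h u" "\<mu> (cell 8 ?v) + offj u \<le> w u"
      using off_le[OF False] by auto
    then have "small ?\<mu>" using pm(3) R jr n(3) sm(3) by (auto simp: small_def)
    moreover have "header ?\<mu>" "fixed ?\<mu>" using pm(1,2) R jr by (auto simp: header_def fixed_def)
    ultimately have "paths_mem (Suc u) ?\<mu>"
      using pm(4,5) R jr by (auto simp: paths_mem_def less_Suc_eq)
    moreover have "h u < 2 ^ wl" "w u < 2 ^ wl" using dims_le_root[of u] R big by auto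
    then have "\<mu> (cell 7 ?v) + offi u < 2 ^ wl" "\<mu> (cell 8 ?v) + offj u < 2 ^ wl" using le by auto
    ultimately show ?thesis using R w False v jr by (simp add: paths_post_def s)
  qed
qed

text \<open>The first summand pays, for each remaining node, the straight-line code, the loop test
  and the last test of its scan; the second pays one iteration of a scan for each node not yet
  popped.\<close>

definition paths_inv :: "nat \<Rightarrow> state \<Rightarrow> bool" where
  "paths_inv i s \<longleftrightarrow> (\<exists>u. 0 < u \<and> u \<le> Suc r \<and> paths_mem u (snd s) \<and> fst s 5 = r \<and> fst s 6 = u \<and>
     i = (len paths_body + ce paths_cond + ce scan_cond + 4) * (Suc r - u) +
       (len scan_body + ce scan_cond + 3) * card (unpopped u))"

lemma paths_body_correct:
  assumes "paths_inv i s" "eval paths_cond s \<noteq> 0"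
  shows "\<exists>k s' i'. bs wl paths_body s k s' \<and> paths_inv i' s' \<and> ce paths_cond + 3 + k + i' \<le> i"
proof -
  define K where "K = len scan_body + ce scan_cond + 3"
  define L where "L = len paths_body + ce paths_cond + ce scan_cond + 4"
  obtain u where u: "0 < u" "u \<le> Suc r" "paths_mem u (snd s)" "fst s 5 = r" "fst s 6 = u"
     "i = L * (Suc r - u) + K * card (unpopped u)" using assms(1) by (auto simp: paths_inv_def K_def L_def)
  have ur: "u \<le> r" using assms(2) u by (simp add: paths_cond_def)
  have "loop_free paths_head" by (simp add: paths_head_def)
  from wp_bs[OF this paths_head_correct[OF u(3-5,1) ur]] obtain k1 s1 where
    1: "bs wl paths_head s k1 s1" "k1 \<le> len paths_head" "paths_mid u s1 (hv u) 0" by blast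
  from scan_correct[OF 1(3), folded K_def] obtain k2 s2 j l where
    2: "bs wl (Whl scan_cond scan_body) s1 k2 s2" "paths_mid u s2 j l"
      "hv u \<noteq> 0 \<longrightarrow> ngp u j \<and> is_max (Rg u) l \<and> l < u"
      "k2 + K * card (unpopped (Suc u)) \<le> K * card (unpopped u) + ce scan_cond + 1"
    by (elim exE conjE) (rule that)
  have "loop_free paths_post" by (simp add: paths_post_def)
  moreover have "wp wl paths_post (\<lambda>s'. paths_mem (Suc u) (snd s') \<and> fst s' 5 = r \<and> fst s' 6 = Suc u) s2"
    using 2(2) by (rule paths_post_correct) (use 2(3) in blast)
  ultimately have "\<exists>n s'. bs wl paths_post s2 n s' \<and> n \<le> len paths_post \<and>
      paths_mem (Suc u) (snd s') \<and> fst s' 5 = r \<and> fst s' 6 = Suc u"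
    by (rule wp_bs)
  then obtain k3 s3 where
    3: "bs wl paths_post s2 k3 s3" "k3 \<le> len paths_post" "paths_mem (Suc u) (snd s3)"
      "fst s3 5 = r" "fst s3 6 = Suc u" by (elim exE conjE) (rule that)
  have "bs wl paths_body s (k1 + (k2 + k3)) s3"
    unfolding paths_body_def using 1(1) 2(1) 3(1) by (intro bs_Seq)
  moreover have "paths_inv (L * (Suc r - Suc u) + K * card (unpopped (Suc u))) s3"
    using 3 ur unfolding paths_inv_def K_def L_def by (intro exI[of _ "Suc u"]) simp
  moreover have "ce paths_cond + 3 + (k1 + (k2 + k3)) +
      (L * (Suc r - Suc u) + K * card (unpopped (Suc u))) \<le> i"
  proof -
    have "Suc r - u = Suc (Suc r - Suc u)" using ur by simp
    then have "L * (Suc r - u) = L + L * (Suc r - Suc u)" by simp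
    moreover have "len paths_body =
        len paths_head + (ce scan_cond + len scan_body + 3 + len paths_post)"
      by (simp add: paths_body_def)
    ultimately show ?thesis using 1(2) 2(4) 3(2) u(6) L_def by linarith
  qed
  ultimately show ?thesis by blast
qed

lemma paths_correct:
  assumes "fst s 5 = r" "header (snd s)" "fixed (snd s)" "blank (snd s)"
    and "\<And>k. 0 < k \<Longrightarrow> k \<le> r \<Longrightarrow> snd s (cell 5 k) = pi k"
  shows "\<exists>t s'. bs wl paths s t s' \<and> paths_mem (Suc r) (snd s') \<and>
    t \<le> (2 * len paths + ce scan_cond) * (r + 1)"
proof -
  let ?K = "len scan_body + ce scan_cond + 3" and ?L = "len paths_body + ce paths_cond + ce scan_cond + 4"
  let ?i = "?L * (Suc r - 1) + ?K * card (unpopped 1)"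
  let ?s = "((fst s)(6 := 1), snd s)"
  have "1 < (2::nat) ^ wl" using big by simp
  then have "safe wl (N 1) s" by simp
  from bs_Asg[OF this, of 6] have 1: "bs wl (Asg 6 (N 1)) s 2 ?s" by (simp add: numeral_2_eq_2)
  have "paths_mem 1 (snd s)"
    using assms(2-5) by (auto simp: paths_mem_def blank_def small_def stage_def)
  then have i: "paths_inv ?i ?s" using assms(1) unfolding paths_inv_def by (intro exI[of _ 1]) simp
  have "\<exists>k s' i'. bs wl (Whl paths_cond paths_body) ?s k s' \<and> paths_inv i' s' \<and> eval paths_cond s' = 0 \<and>
      k + i' \<le> ?i + ce paths_cond + 1"
  proof (rule while_bs[of paths_inv, OF i])
    show "safe wl paths_cond s" if "paths_inv i s" for i s
      using that big by (auto simp: paths_inv_def paths_cond_def)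
  qed (rule paths_body_correct)
  then obtain k s' i' where 2: "bs wl (Whl paths_cond paths_body) ?s k s'" "paths_inv i' s'"
    "eval paths_cond s' = 0" "k + i' \<le> ?i + ce paths_cond + 1" by blast
  have "paths_mem (Suc r) (snd s')"
  proof -
    obtain u where "u \<le> Suc r" "paths_mem u (snd s')" "fst s' 5 = r" "fst s' 6 = u"
      using 2(2) by (auto simp: paths_inv_def)
    moreover from this 2(3) have "u = Suc r" by (simp add: paths_cond_def)
    ultimately show ?thesis by simp
  qed
  moreover have "?K * card (unpopped 1) \<le> ?K * r" using card_unpopped by (rule mult_le_mono2)
  then have "2 + k \<le> (?L + ?K) * r + ce paths_cond + 3"
    using 2(4) by (simp add: algebra_simps)
  then have "2 + k \<le> (2 * len paths + ce scan_cond) * (r + 1)"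
    by (simp add: paths_def paths_body_def algebra_simps)
  moreover have "bs wl paths s (2 + k) s'" unfolding paths_def using 1 2(1) by (rule bs_Seq)
  ultimately show ?thesis by blast
qed

end

section \<open>Queries\<close>

text \<open>Registers 0 and 1 are the position in a node \<open>u0\<close>, 3 and 4 are \<open>al u0\<close> and \<open>be u0\<close>, 2 is the current
  node of the Cartesian tree of the path of \<open>u0\<close>, and 5 is \<open>0\<close> once the letter has been found.\<close>

definition inside :: expr where
  "inside = Bin And
     (Bin And (Bin Equal (N 0) (Bin Less (V 6) (V 3))) (Bin Less (V 6) (Bin Add (V 3) (fd 0 (V 2)))))
     (Bin And (Bin Equal (N 0) (Bin Less (V 7) (V 4))) (Bin Less (V 7) (Bin Add (V 4) (fd 1 (V 2)))))"

definition query_init :: com where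
  "query_init =
     Asg 8 (fd 0 (N 0)) ;; Asg 3 (fd 7 (V 8)) ;; Asg 4 (fd 8 (V 8)) ;; Asg 2 (fd 9 (V 8)) ;;
     Asg 5 (N 1)"

text \<open>Registers 6 and 7 are coordinates within the current node. They are copied to registers
  0 and 1 only when the path is left, so that during the search on a path the position remains
  relative to \<open>u0\<close>.\<close>

definition query_body :: com where
  "query_body =
     Asg 6 (Bin Add (V 0) (fd 7 (V 2))) ;; Asg 7 (Bin Add (V 1) (fd 8 (V 2))) ;;
     Iff inside
       (Asg 6 (Bin Sub (V 6) (V 3)) ;; Asg 7 (Bin Sub (V 7) (V 4)) ;;
        Asg 9 (fd 2 (V 2)) ;; Asg 8 (fd 3 (V 2)) ;;
        Iff (V 9)
          (Iff (Bin And (Bin Less (V 6) (fd 0 (V 9))) (Bin Less (V 7) (fd 1 (V 9))))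
             (Asg 8 (V 9))
             (Asg 6 (Bin Sub (V 6) (Bin Sub (fd 0 (V 2)) (fd 0 (V 8)))) ;;
              Asg 7 (Bin Sub (V 7) (Bin Sub (fd 1 (V 2)) (fd 1 (V 8))))) ;;
           Iff (Bin Equal (V 8) (fd 6 (V 2)))
             (Asg 2 (fd 11 (V 2)))
             (Asg 0 (V 6) ;; Asg 1 (V 7) ;;
              Asg 3 (fd 7 (V 8)) ;; Asg 4 (fd 8 (V 8)) ;; Asg 2 (fd 9 (V 8))))
          (Asg 0 (V 8) ;; Asg 5 (N 0)))
       (Asg 2 (fd 10 (V 2)))"

definition access :: com where
  "access = query_init ;; Whl (V 5) query_body"

section \<open>Correctness and running time of a query\<close>

locale query_tree = chain_tree + dag_word +
  fixes \<mu> :: "nat \<Rightarrow> nat"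
  assumes \<mu>_root: "\<mu> (cell 0 0) = r"
    and \<mu>_node: "0 < k \<Longrightarrow> k \<le> r \<Longrightarrow> \<mu> (cell 0 k) = h k \<and> \<mu> (cell 1 k) = w k \<and> \<mu> (cell 2 k) = b k \<and>
      \<mu> (cell 3 k) = c k \<and> \<mu> (cell 6 k) = hv k \<and> \<mu> (cell 7 k) = al k \<and> \<mu> (cell 8 k) = be k \<and>
      \<mu> (cell 9 k) = tail k \<and> \<mu> (cell 10 k) = lf k \<and> \<mu> (cell 11 k) = rg k"
    and off_small: "0 < k \<Longrightarrow> k \<le> r \<Longrightarrow> al k \<le> h k \<and> be k \<le> w k"
begin

lemma \<mu>_node': "0 < k \<Longrightarrow> k \<le> r \<Longrightarrow> \<mu> (cell 0 k) = h k \<and> \<mu> (cell (Suc 0) k) = w k \<and> \<mu> (cell 2 k) = b k \<and>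
      \<mu> (cell 3 k) = c k \<and> \<mu> (cell 6 k) = hv k \<and> \<mu> (cell 7 k) = al k \<and> \<mu> (cell 8 k) = be k \<and>
      \<mu> (cell 9 k) = tail k \<and> \<mu> (cell 10 k) = lf k \<and> \<mu> (cell 11 k) = rg k"
  using \<mu>_node by simp

text \<open>The memory equals \<open>\<mu>\<close> throughout: a query works in registers alone,
  hence the data structure is intact afterwards.\<close>

definition query_inv :: "nat \<Rightarrow> nat \<Rightarrow> state \<Rightarrow> bool" where
  "query_inv a i s \<longleftrightarrow> snd s = \<mu> \<and> (fst s 5 = 0 \<and> fst s 0 = a \<or>
     fst s 5 = 1 \<and> (\<exists>u0 t. fst s 3 = al u0 \<and> fst s 4 = be u0 \<and>
       qinv a t u0 (fst s 0) (fst s 1) (fst s 2) \<and> i = Suc t))"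

lemma query_invI:
  assumes "snd s = \<mu>" "fst s 5 = 1" "fst s 3 = al u" "fst s 4 = be u"
    and "0 < t \<and> qinv a (t - 1) u (fst s 0) (fst s 1) (fst s 2)"
  shows "query_inv a t s"
  unfolding query_inv_def using assms
  by (intro conjI disjI2 exI[of _ u] exI[of _ "t - 1"]) auto

lemma bounds:
  assumes "0 < k" "k \<le> r"
  shows "h k \<le> p r" "w k \<le> p r" "al k \<le> p r" "be k \<le> p r"
  using dims_le_root[of k] off_small[of k] assms by auto

lemma query_step:
  assumes inv: "query_inv a i s" and "fst s 5 \<noteq> 0"
  shows "wp wl query_body (\<lambda>s'. \<exists>j<i. query_inv a j s') s"
proof -
  obtain R where s: "s = (R, \<mu>)" using inv by (cases s) (auto simp: query_inv_def)
  obtain u0 t where q: "R 5 = 1" "R 3 = al u0" "R 4 = be u0" "qinv a t u0 (R 0) (R 1) (R 2)" "i = Suc t"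
    using inv assms(2) by (auto simp: query_inv_def s)
  define x where "x = R 2"
  have R2: "R 2 = x" by (simp add: x_def)
  have u0: "0 < u0" "u0 \<le> r" and x: "0 < x" "x \<le> r" and ij: "R 0 < h u0" "R 1 < w u0"
    using qinvD[OF q(4)] by (auto simp: x_def)
  note q4 = q(4)[folded x_def]
  note nx = \<mu>_node'[OF x]
  let ?t = "R 0 + al x" and ?u = "R 1 + be x"
  have b: "?t < 2 ^ wl" "?u < 2 ^ wl" "al u0 + h x < 2 ^ wl" "be u0 + w x < 2 ^ wl"
     "1 < (2::nat) ^ wl" "0 < (2::nat) ^ wl"
    using bounds[OF u0] bounds[OF x] ij big by auto
  show ?thesis
  proof (cases "ins u0 (R 0) (R 1) x")
    case False
    from qinv_left[OF q4 False] have "query_inv a t (R(6 := ?t, 7 := ?u, 2 := lf x), \<mu>)"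
      using q(1-3) by (intro query_invI[where u = u0]) auto
    then have fin: "\<exists>j<i. query_inv a j (R(6 := ?t, 7 := ?u, 2 := lf x), \<mu>)" using q(5) by blast
    have "eval inside (R(6 := ?t, 7 := ?u), \<mu>) = 0" "safe wl inside (R(6 := ?t, 7 := ?u), \<mu>)"
      using False b x q(1-3) nx R2 by (auto simp: inside_def ins_def not_less)
    then show ?thesis unfolding query_body_def s using q(1-3) b x nx fin R2 by simp
  next
    case True
    then have ins: "al u0 \<le> ?t" "?t < al u0 + h x" "be u0 \<le> ?u" "?u < be u0 + w x"
      by (auto simp: ins_def)
    have ev: "eval inside (R(6 := ?t, 7 := ?u), \<mu>) = 1" "safe wl inside (R(6 := ?t, 7 := ?u), \<mu>)"
      using True b x q(1-3) nx R2 by (auto simp: inside_def ins_def not_less)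
    note ev = ev[unfolded One_nat_def]
    let ?i = "?t - al u0" and ?j = "?u - be u0"
    show ?thesis
    proof (cases "b x = 0")
      case bx: True
      have "query_inv a 0 (R(6 := ?i, 7 := ?j, 9 := 0, 8 := c x, 0 := c x, 5 := 0), \<mu>)"
        using qinv_leaf[OF q4 True bx] by (simp add: query_inv_def)
      then have fin: "\<exists>j<i. query_inv a j (R(6 := ?i, 7 := ?j, 9 := 0, 8 := c x, 0 := c x, 5 := 0), \<mu>)"
        using q(5) by blast
      show ?thesis unfolding query_body_def s using q(1-3) b x nx fin ins R2 bx
        by (simp add: ev)
    next
      case bx: False
      have kids: "0 < b x" "b x \<le> r" "0 < c x" "c x \<le> r" using inner[of x] x bx by auto
      note nb = \<mu>_node'[OF kids(1,2)] and nc = \<mu>_node'[OF kids(3,4)]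
      have hw: "h x < 2 ^ wl" "w x < 2 ^ wl" "h (c x) \<le> h x" "w (c x) \<le> w x"
        using bounds[OF x] big dims[of x] x bx by auto
      let ?first = "?i < h (b x) \<and> ?j < w (b x)"
      let ?v = "if ?first then b x else c x"
      let ?i' = "if ?first then ?i else ?i - (h x - h ?v)" and ?j' = "if ?first then ?j else ?j - (w x - w ?v)"
      note st = qinv_step[OF q4 True bx]
      have fin1: "\<exists>j<i. query_inv a j (R', \<mu>)"
        if "?v = hv x" "R' 5 = 1" "R' 3 = al u0" "R' 4 = be u0" "R' 0 = R 0" "R' 1 = R 1" "R' 2 = rg x" for R'
      proof -
        have "query_inv a t (R', \<mu>)"
          using st(1)[OF that(1)] that(2-) by (intro query_invI[where u = u0]) auto
        then show ?thesis using q(5) by blast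
      qed
      have fin2: "\<exists>j<i. query_inv a j (R', \<mu>)"
        if "?v \<noteq> hv x" "R' 5 = 1" "R' 3 = al ?v" "R' 4 = be ?v" "R' 0 = ?i'" "R' 1 = ?j'" "R' 2 = tail ?v" for R'
      proof -
        have "query_inv a t (R', \<mu>)"
          using st(2)[OF that(1)] that(2-) by (intro query_invI[where u = ?v]) (simp_all only: fst_conv snd_conv)
        then show ?thesis using q(5) by blast
      qed
      \<comment> \<open>Machine subtraction wraps around, so the cell must not lie before the origin
        of the second child in either coordinate.\<close>
      have second: "h x - h (c x) \<le> ?i \<and> w x - w (c x) \<le> ?j" if "\<not> ?first"
      proof -
        have "h x = h (b x) \<and> h x = h (c x) \<and> w x = w (b x) + w (c x) \<or>
          w x = w (b x) \<and> w x = w (c x) \<and> h x = h (b x) + h (c x)"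
          using dims[of x] x bx by simp
        then show ?thesis using that ins by auto
      qed
      define ii jj where "ii = ?i" and "jj = ?j"
      have ij: "ii < 2 ^ wl" "jj < 2 ^ wl" using b by (auto simp: ii_def jj_def)
      note simps = q(1-3) x nx R2 bx nb nc kids hw b[unfolded One_nat_def] ins[unfolded One_nat_def]
        ev ij ii_def[symmetric, unfolded One_nat_def] jj_def[symmetric, unfolded One_nat_def]
      show ?thesis
      proof (cases ?first)
        case f: True
        note f' = f[folded ii_def jj_def] and fin1' = fin1[unfolded if_P[OF f]]
          and fin2' = fin2[unfolded if_P[OF f]]
        show ?thesis
        proof (cases "b x = hv x")
          case True
          show ?thesis unfolding query_body_def s
            by (simp add: simps f' True[symmetric]) (rule fin1'; use q R2 True in \<open>simp add: ii_def jj_def\<close>)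
        next
          case False
          show ?thesis unfolding query_body_def s
            by (simp add: simps f' False) (rule fin2'; use q R2 False hw in \<open>simp add: ii_def jj_def\<close>)
        qed
      next
        case f: False
        note fin1' = fin1[unfolded if_not_P[OF f]] and fin2' = fin2[unfolded if_not_P[OF f]]
        have sec: "h x - h (c x) \<le> ii" "w x - w (c x) \<le> jj"
          using second[OF f] by (simp_all add: ii_def jj_def)
        show ?thesis
        proof (cases "ii < h (b x)")
          case g: True
          then have g': "\<not> jj < w (b x)" using f by (simp add: ii_def jj_def)
          show ?thesis
          proof (cases "c x = hv x")
            case True
            show ?thesis unfolding query_body_def s
              by (simp add: simps g g' sec True[symmetric]) (rule fin1'; use q R2 True in \<open>simp add: ii_def jj_def\<close>)
          next
            case False
            show ?thesis unfolding query_body_def s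
              by (simp add: simps g g' sec False) (rule fin2'; use q R2 False hw in \<open>simp add: ii_def jj_def\<close>)
          qed
        next
          case g: False
          show ?thesis
          proof (cases "c x = hv x")
            case True
            show ?thesis unfolding query_body_def s
              by (simp add: simps g sec True[symmetric]) (rule fin1'; use q R2 True in \<open>simp add: ii_def jj_def\<close>)
          next
            case False
            show ?thesis unfolding query_body_def s
              by (simp add: simps g sec False) (rule fin2'; use q R2 False hw in \<open>simp add: ii_def jj_def\<close>)
          qed
        qed
      qed
    qed
  qed
qed

lemma query_correct:
  assumes "snd s = \<mu>" "fst s 0 < h r" "fst s 1 < w r"
  shows "\<exists>t s'. bs wl access s t s' \<and> snd s' = \<mu> \<and> fst s' 0 = val r (fst s 0) (fst s 1) \<and>
    t \<le> len access * (3 * floor_log (p r) + 2)"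
proof -
  let ?i = "Suc (3 * floor_log (p r))" and ?a = "val r (fst s 0) (fst s 1)"
  have r: "0 < r" "r \<le> r" using r_pos by auto
  note nr = \<mu>_node'[OF r]
  let ?R = "(fst s)(8 := r, 3 := al r, 4 := be r, 2 := tail r, 5 := 1)"
  have "query_inv ?a ?i (?R, \<mu>)"
    using qinv_init[OF assms(2,3)] unfolding query_inv_def by auto
  moreover have "1 < (2::nat) ^ wl" "0 < (2::nat) ^ wl" using big by simp_all
  ultimately have "wp wl query_init (query_inv ?a ?i) s"
    using nr r assms(1) \<mu>_root by (simp add: query_init_def)
  from wp_bs[OF _ this] obtain k1 s1 where
    1: "bs wl query_init s k1 s1" "k1 \<le> len query_init" "query_inv ?a ?i s1"
    by (auto simp: query_init_def)
  have "\<exists>k s' j. bs wl (Whl (V 5) query_body) s1 k s' \<and> query_inv ?a j s' \<and> eval (V 5) s' = 0 \<and>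
      k \<le> (len query_body + ce (V 5) + 3) * ?i + ce (V 5) + 1"
  proof (rule while_wp'[of "query_inv ?a", OF 1(3)])
    show "loop_free query_body" by (simp add: query_body_def)
  qed (use query_step in auto)
  then obtain k2 s2 j where 2: "bs wl (Whl (V 5) query_body) s1 k2 s2"
    "query_inv ?a j s2" "fst s2 5 = 0" "k2 \<le> (len query_body + ce (V 5) + 3) * ?i + ce (V 5) + 1"
    by auto
  have "k1 + k2 \<le> len access * (3 * floor_log (p r) + 2)"
    using 1(2) 2(4) by (simp add: access_def algebra_simps)
  moreover have "bs wl access s (k1 + k2) s2" unfolding access_def using 1(1) 2(1) by (rule bs_Seq)
  moreover have "snd s2 = \<mu>" "fst s2 0 = ?a" using 2(2,3) by (auto simp: query_inv_def)
  ultimately show ?thesis by blast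
qed

end

section \<open>The data structure\<close>

definition preprocess :: com where
  "preprocess = copy ;; dfs ;; pis ;; paths"

lemma wfc_preprocess: "wfc preprocess"
  by (simp add: preprocess_def copy_def copy_init_def copy_cond_def copy_body_def dfs_def dfs_init_def
      dfs_look_def dfs_act_def pis_def pis_init_def pis_body_def paths_def paths_cond_def paths_body_def
      paths_head_def heavy_def scan_cond_def scan_body_def paths_post_def)

lemma wfc_query: "wfc access"
  by (simp add: access_def query_init_def query_body_def inside_def)

context weighted_dag_word
begin

text \<open>Queries may start from a memory \<open>\<mu>'\<close> that agrees with the preprocessed
  one only on the records \<open>0..r\<close>; what lies beyond them is arbitrary.\<close>

lemma paths_mem_query_tree:
  assumes "paths_mem (Suc r) \<mu>"
    and "\<And>f k. f < 14 \<Longrightarrow> k \<le> r \<Longrightarrow> \<mu>' (cell f k) = \<mu> (cell f k)"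
  shows "query_tree r b c h w val pi (\<lambda>k. \<mu> (cell 7 k)) (\<lambda>k. \<mu> (cell 8 k)) (\<lambda>k. \<mu> (cell 9 k))
    (\<lambda>k. \<mu> (cell 10 k)) (\<lambda>k. \<mu> (cell 11 k)) wl \<mu>'"
proof -
  have m: "header \<mu>" "fixed \<mu>" "small \<mu>" "\<And>k. 0 < k \<Longrightarrow> k \<le> r \<Longrightarrow> \<mu> (cell 6 k) = hv k"
    "mem_stage (Suc r) \<mu>"
    using assms(1) by (auto simp: paths_mem_def)
  interpret chain_tree r b c h w val pi "\<lambda>k. \<mu> (cell 7 k)" "\<lambda>k. \<mu> (cell 8 k)" "\<lambda>k. \<mu> (cell 9 k)"
    "\<lambda>k. \<mu> (cell 10 k)" "\<lambda>k. \<mu> (cell 11 k)"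
    by (rule stage_end[OF m(5)])
  show ?thesis
    by unfold_locales (use m assms(2) in \<open>auto simp: header_def fixed_def small_def\<close>)
qed

text \<open>The largest fields are \<open>dz\<close>, below \<open>2 ^ (z u + 1)\<close> and so at
  most \<open>2 * p r\<close>, and the letters, below \<open>\<sigma>\<close>. Node numbers are
  covered by \<open>r_less\<close>.\<close>

lemma paths_mem_le:
  assumes "paths_mem (Suc r) \<mu>" "f < 14" "k \<le> r"
    and c: "\<And>k. 0 < k \<Longrightarrow> k \<le> r \<Longrightarrow> b k = 0 \<Longrightarrow> c k < \<sigma>"
  shows "\<mu> (cell f k) \<le> 2 * p r + \<sigma>"
proof (cases "k = 0")
  case True
  then show ?thesis using assms(1,2) r_less by (cases "f = 0") (auto simp: paths_mem_def header_def)
next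
  case False
  then have k: "0 < k" "k \<le> r" using assms(3) by auto
  have m: "fixed \<mu>" "small \<mu>" "\<mu> (cell 5 k) = pi k"
    using assms(1) k by (auto simp: paths_mem_def)
  note d = dims_le_root[of k] p_le_root[of k] pi_le[of k] r_less
  have bc: "b k \<le> r" "c k \<le> r + \<sigma>"
    using inner[of k] c[of k] k by (cases "b k = 0"; force)+
  have "f \<in> {0, 1, 2, 3, 4, 5, 6, 7, 8, 9, 10, 11, 12, 13}" using assms(2) by (simp, arith)
  then show ?thesis
    using m k d bc unfolding fixed_def small_def
    by (elim insertE emptyE) force+
qed

end

context prep
begin

definition answers :: "(nat \<Rightarrow> nat) \<Rightarrow> bool" where
  "answers \<mu> \<longleftrightarrow> (\<forall>R. R 0 < H S \<and> R 1 < W S \<longrightarrow> (\<exists>t R'. bs w access (R, \<mu>) t (R', \<mu>) \<and>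
     R' 0 = V S (R 0) (R 1) \<and> t \<le> len access * (3 * floor_log (ar S) + 2)))"

lemma preprocess_correct:
  assumes "raw (snd s)" "unnumbered (snd s)"
  shows "\<exists>t s' r. bs w preprocess s t s' \<and> r \<le> N \<and>
    t \<le> (len copy + 2 * len dfs + len pis + 2 * len paths + ce scan_cond) * (N + 1) \<and>
    (\<forall>f<14. \<forall>k\<le>r. snd s' (cell f k) \<le> 2 * ar S + \<sigma>) \<and>
    (\<forall>\<mu>. (\<forall>f<14. \<forall>k\<le>r. \<mu> (cell f k) = snd s' (cell f k)) \<longrightarrow> answers \<mu>)"
proof -
  from copy_correct[OF assms] obtain t1 s1 where
    1: "bs w copy s t1 s1" "fst s1 1 = S" "fst s1 2 = Suc N" "input (snd s1) N"
      "unnumbered (snd s1)" "t1 \<le> len copy * (N + 1)" by blast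
  from dfs_correct[OF 1(4,5,2,3)] obtain t2 s2 r ord num where
    2: "bs w dfs s1 t2 s2" "dfs_mem [] r ord num (snd s2)" "fst s2 5 = r"
      "t2 \<le> len dfs * (2 * N + 1)" by blast
  define hh ww bb cc where "hh = (\<lambda>i. snd s2 (cell 0 i))" and "ww = (\<lambda>i. snd s2 (cell 1 i))"
    and "bb = (\<lambda>i. snd s2 (cell 2 i))" and "cc = (\<lambda>i. snd s2 (cell 3 i))"
  note defs = hh_def ww_def bb_def cc_def
  have d: "dinv [] r ord num" and rec: "\<And>i. 0 < i \<Longrightarrow> i \<le> r \<Longrightarrow> record_of num i (ord i) (snd s2)"
    using 2(2) by (auto simp: dfs_mem_def)
  have f: "hh i = H (ord i) \<and> ww i = W (ord i) \<and> bb i = (if kind (ord i) = 0 then 0 else num (lk (ord i))) \<and>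
      cc i = (if kind (ord i) = 0 then lk (ord i) else num (rk (ord i)))" if "0 < i" "i \<le> r" for i
    using rec[OF that] by (simp add: record_of_def defs)
  have dag: "dag r bb cc hh ww (\<lambda>i. V (ord i))" "dag.p hh ww r = ar S"
    "\<And>i j. V (ord r) i j = V S i j" "hh r = H S" "ww r = W S" "r \<le> N"
    by (rule dinv_dag[OF d, of hh ww bb cc]; rule f; assumption)+
  interpret dag r bb cc hh ww "\<lambda>i. V (ord i)" by (rule dag(1))
  interpret dag_word r bb cc hh ww "\<lambda>i. V (ord i)" w
    by unfold_locales (use big dag(2,6) in simp)
  have fx: "fixed (snd s2)" "blank (snd s2)" "\<And>k. 0 < k \<Longrightarrow> k \<le> r \<Longrightarrow> snd s2 (cell 5 k) = 0"
  proof -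
    show "fixed (snd s2)" unfolding fixed_def p_def using rec by (auto simp: record_of_def defs)
    show "\<And>k. 0 < k \<Longrightarrow> k \<le> r \<Longrightarrow> snd s2 (cell 5 k) = 0" using rec by (auto simp: record_of_def)
    show "blank (snd s2)"
      unfolding blank_def
    proof (intro allI impI)
      fix k f assume k: "0 < k \<and> k \<le> r \<and> 6 \<le> f \<and> f < (14 :: nat)"
      then have "f \<in> {6, 7, 8, 9, 10, 11, 12, 13}" by (simp, arith)
      then show "snd s2 (cell f k) = 0" using rec[of k] k unfolding record_of_def
        by (elim insertE emptyE) simp_all
    qed
  qed
  from pis_correct[OF 2(3) fx] obtain t3 s3 where
    3: "bs w pis s2 t3 s3" "pis_inv 0 s3" "t3 \<le> len pis * (r + 1)" by blast
  let ?pi = "\<lambda>k. snd s3 (cell 5 k)"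
  have pv: "pinv 0 ?pi" using 3(2) by (simp add: pis_inv_def)
  interpret weighted_dag_word r bb cc hh ww "\<lambda>i. V (ord i)" ?pi w
  proof unfold_locales
    fix k assume k: "1 \<le> k" "k \<le> r"
    show "?pi k * p k \<le> p r" using pinv_le[OF pv k] .
    have "\<forall>k\<in>{1..r}. ?pi k = of_bool (k = r) + (\<Sum>v\<in>{0<..r}. cnt v k * ?pi v)"
      using pv unfolding pinv_def by (elim conjE) assumption
    from bspec[OF this, of k] k
    show "?pi k = of_bool (k = r) + (\<Sum>v\<in>{0<..r}. cnt v k * ?pi v)" by (simp only: atLeastAtMost_iff)
  qed
  from 3(2) have "fst s3 5 = r" "header (snd s3)" "fixed (snd s3)" "blank (snd s3)"
    by (auto simp: pis_inv_def)
  from paths_correct[OF this HOL.refl] obtain t4 s4 where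
    4: "bs w paths s3 t4 s4" "paths_mem (Suc r) (snd s4)" "t4 \<le> (2 * len paths + ce scan_cond) * (r + 1)"
    by blast
  have run: "bs w preprocess s (t1 + (t2 + (t3 + t4))) s4"
    unfolding preprocess_def using 1(1) 2(1) 3(1) 4(1) by (intro bs_Seq)
  have mono: "len pis * (r + 1) \<le> len pis * (N + 1)" "(2 * len paths + ce scan_cond) * (r + 1) \<le>
      (2 * len paths + ce scan_cond) * (N + 1)" using dag(6) by (auto intro!: mult_le_mono2)
  have time: "t1 + (t2 + (t3 + t4)) \<le>
      (len copy + 2 * len dfs + len pis + 2 * len paths + ce scan_cond) * (N + 1)"
  proof -
    have "len dfs * (2 * N + 1) \<le> 2 * len dfs * (N + 1)" by (simp add: algebra_simps)
    moreover have "(len copy + 2 * len dfs + len pis + 2 * len paths + ce scan_cond) * (N + 1) =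
        len copy * (N + 1) + 2 * len dfs * (N + 1) + len pis * (N + 1) +
        (2 * len paths + ce scan_cond) * (N + 1)"
      by (simp add: algebra_simps)
    ultimately show ?thesis using mono 1(6) 2(4) 3(3) 4(3) by linarith
  qed
  have letter: "cc k < \<sigma>" if "0 < k" "k \<le> r" "bb k = 0" for k
  proof -
    have "ord k < N" "kind (ord k) \<noteq> 0 \<longrightarrow> 0 < num (lk (ord k))" using d that unfolding dinv_def by blast+
    then show ?thesis using f[OF that(1,2)] that(3) letter[of "ord k"] by (auto split: if_splits)
  qed
  have le: "\<forall>f<14. \<forall>k\<le>r. snd s4 (cell f k) \<le> 2 * ar S + \<sigma>"
  proof (intro allI impI)
    fix f k :: nat assume "f < 14" "k \<le> r"
    then have "snd s4 (cell f k) \<le> 2 * p r + \<sigma>"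
      by (rule paths_mem_le[OF 4(2)]) (rule letter)
    then show "snd s4 (cell f k) \<le> 2 * ar S + \<sigma>" unfolding dag(2) .
  qed
  have "answers \<mu>" if "\<forall>f<14. \<forall>k\<le>r. \<mu> (cell f k) = snd s4 (cell f k)" for \<mu>
    unfolding answers_def
  proof (intro allI impI)
    fix R :: "nat \<Rightarrow> nat" assume R: "R 0 < H S \<and> R 1 < W S"
    interpret q: query_tree r bb cc hh ww "\<lambda>i. V (ord i)" ?pi "\<lambda>k. snd s4 (cell 7 k)" "\<lambda>k. snd s4 (cell 8 k)"
      "\<lambda>k. snd s4 (cell 9 k)" "\<lambda>k. snd s4 (cell 10 k)" "\<lambda>k. snd s4 (cell 11 k)" w \<mu>
      by (rule paths_mem_query_tree[OF 4(2)]) (use that in blast)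
    from q.query_correct[of "(R, \<mu>)"] R dag(2-5)
    show "\<exists>t R'. bs w access (R, \<mu>) t (R', \<mu>) \<and>
        R' 0 = V S (R 0) (R 1) \<and> t \<le> len access * (3 * floor_log (ar S) + 2)" by fastforce
  qed
  then show ?thesis using run time le dag(6) by blast
qed

end

section \<open>Word length, bit counts and constants\<close>

lemma floor_log_le_lg: "0 < x \<Longrightarrow> real (floor_log x) \<le> lg (real x)"
  by (simp add: floor_log_altdef lg_def le_max_iff_disj)

lemma lglg_ge_1: "1 \<le> lglg x"
  by (simp add: lglg_def)

lemma lg_ge_1: "1 \<le> lg x"
  by (simp add: lg_def)

text \<open>The origin of \<open>\<kappa> = 8\<close>: one power of \<open>X\<close> remains, and
  the other seven provide the factor \<open>2 ^ 7 = 128\<close>.\<close>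

lemma word_large:
  assumes "2 \<le> X" "8 * log 2 (real X) \<le> real w"
  shows "128 * X \<le> 2 ^ w"
proof -
  have "real X ^ 8 = (2 powr log 2 (real X)) powr 8"
    using assms(1) by (simp add: powr_realpow)
  also have "\<dots> = 2 powr (8 * log 2 (real X))" by (simp add: powr_powr mult.commute)
  also have "\<dots> \<le> 2 powr real w" using assms(2) by simp
  also have "\<dots> = real (2 ^ w)" by (simp add: powr_realpow)
  finally have "X ^ 8 \<le> 2 ^ w" by (metis of_nat_le_iff of_nat_power)
  moreover have "2 ^ 7 \<le> X ^ 7" using assms(1) by (rule power_mono) simp
  then have "128 * X \<le> X ^ 7 * X" by (intro mult_le_mono1) simp
  moreover have "X ^ 7 * X = X ^ 8" using power_Suc2[of X 7] by simp
  ultimately show ?thesis by linarith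
qed

text \<open>The constant of the space bound may depend on \<open>\<sigma>\<close>, so
  \<open>\<sigma> + 1\<close> bits are reserved generously for the letters and
  \<open>floor_log x + 2\<close> for the other numbers. A sum of two numbers that are at least 2 is
  at most their product, so the widths add up to \<open>n\<close>. The factor 28 stems from 14
  fields and \<open>r + 1 \<le> 2 * r'\<close>.\<close>

lemma memory_bits:
  fixes \<sigma> r r' x :: nat
  assumes "0 < x" "r \<le> r'" "0 < r'"
  defines "n \<equiv> floor_log x + \<sigma> + 3"
  shows "2 * x + \<sigma> < 2 ^ n" "real (14 * (r + 1) * n) \<le> 28 * real (\<sigma> + 4) * real r' * lg (real x)"
proof -
  have "x < 2 * 2 ^ floor_log x" by (rule floor_log_exp2_gt)
  then have x: "2 * x \<le> 2 ^ (floor_log x + 2)" by simp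
  have s: "\<sigma> < 2 ^ (\<sigma> + 1)" by (rule order.strict_trans[OF less_exp]) simp
  have sum: "a + b \<le> a * b" if "2 \<le> a" "2 \<le> b" for a b :: nat
  proof -
    have "a + b \<le> 2 * max a b" by simp
    also have "\<dots> \<le> min a b * max a b" using that by (intro mult_le_mono1) simp
    also have "\<dots> = a * b" by (simp add: min_def max_def)
    finally show ?thesis .
  qed
  have "2 \<le> (2::nat) ^ (floor_log x + 2)" "2 \<le> (2::nat) ^ (\<sigma> + 1)"
    by (simp_all add: self_le_power)
  from sum[OF this] have "2 ^ (floor_log x + 2) + 2 ^ (\<sigma> + 1) \<le> (2::nat) ^ (floor_log x + 2) * 2 ^ (\<sigma> + 1)" .
  also have "\<dots> = 2 ^ n" unfolding n_def by (simp add: power_add)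
  finally show "2 * x + \<sigma> < 2 ^ n" using x s by linarith
  have "real n \<le> lg (real x) + real (\<sigma> + 3) * 1"
    using floor_log_le_lg[OF assms(1)] by (simp add: n_def)
  also have "\<dots> \<le> lg (real x) + real (\<sigma> + 3) * lg (real x)"
    using lg_ge_1[of "real x"] by (intro add_left_mono mult_left_mono) auto
  also have "\<dots> = real (\<sigma> + 4) * lg (real x)" by (simp add: algebra_simps)
  finally have n: "real n \<le> real (\<sigma> + 4) * lg (real x)" .
  have "real (14 * (r + 1)) \<le> 28 * real r'" using assms(2,3) by simp
  then have "real (14 * (r + 1)) * real n \<le> (28 * real r') * (real (\<sigma> + 4) * lg (real x))"
    using n by (intro mult_mono) auto
  then show "real (14 * (r + 1) * n) \<le> 28 * real (\<sigma> + 4) * real r' * lg (real x)"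
    by (simp add: algebra_simps)
qed

lemma direct_accessI:
  assumes stores: "stores \<mu> D" and len: "length D = 14 * (r + 1)"
    and q: "\<And>\<mu>'. (\<forall>f<14. \<forall>k\<le>r. \<mu>' (cell f k) = \<mu> (cell f k)) \<Longrightarrow>
      (\<forall>R. R 0 < dim_row M \<and> R 1 < dim_col M \<longrightarrow> (\<exists>t R'. bs w access (R, \<mu>') t (R', \<mu>') \<and>
        R' 0 = M $$ (R 0, R 1) \<and> real t \<le> T))"
  shows "direct_access w (cp access 0) D M T"
  unfolding direct_access_def
proof (intro allI impI)
  fix i j \<mu>' assume i: "i < dim_row M" and j: "j < dim_col M" and s: "stores \<mu>' D"
  have "\<mu>' (cell f k) = \<mu> (cell f k)" if "f < 14" "k \<le> r" for f k
  proof -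
    have "cell f k < length D" using that by (simp add: len cell_def)
    then show ?thesis using s stores by (simp add: stores_def)
  qed
  moreover let ?s = "init_state [i, j] \<mu>'"
  have "reg ?s 0 = i" "reg ?s 1 = j" by (simp_all add: init_state_def)
  ultimately obtain t R' where *: "bs w access (reg ?s, \<mu>') t (R', \<mu>')" "R' 0 = M $$ (i, j)" "real t \<le> T"
    using q[of \<mu>'] i j by metis
  have "agree (reg ?s, \<mu>') ?s" "pc ?s = 0" by (simp_all add: agree_def init_state_def)
  from cp_halts[OF *(1) wfc_query this *(3)] obtain s' where
    "halts_within w (cp access 0) ?s T s'" "agree (R', \<mu>') s'" by blast
  then show "\<exists>s. halts_within w (cp access 0) (init_state [i, j] \<mu>') T s \<and>
      reg s 0 = M $$ (i, j) \<and> stores (mem s) D"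
    using *(2) s by (auto simp: agree_def)
qed

text \<open>In \<open>K\<close>, the factor 2 comes from
  \<open>N + 1 \<le> 2 * grammar_size G\<close> and the 5 from bounding
  \<open>3 * floor_log (m * n) + 2\<close> by \<open>5 * lg (m * n)\<close>. The image
  \<open>D\<close> consists of the records \<open>0..r\<close>, without the scratch space behind
  them.\<close>

lemma slp_data_structure:
  fixes G :: "(nat, nat) grammar" and M :: "nat mat"
  assumes slp: "is_slp2d G M" and M: "M \<in> carrier_mat m n" and nt: "nonterms G = {..<card (nonterms G)}"
    and al: "alphabet G = {..<\<sigma>}"
    and w: "8 * log 2 (real (m * n + grammar_size G + \<sigma>)) \<le> real w"
  defines "K \<equiv> 2 * (len copy + 2 * len dfs + len pis + 2 * len paths + ce scan_cond) + 5 * len access"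
  shows "\<exists>s D. halts_within w (cp preprocess 0) (init_state [] (memory_of (encode_grammar G)))
      (real K * real (grammar_size G)) s \<and> stores (mem s) D \<and>
    fits_in_bits D (28 * real (\<sigma> + 4) * real (grammar_size G) * lg (real (m * n))) \<and>
    direct_access w (cp access 0) D M (real K * lg (real (m * n)) * lglg (real (max m n)))"
proof -
  define N where "N = card (nonterms G)"
  note nt' = nt[folded N_def]
  interpret slp N "start G" \<sigma> "kind G" "lk G" "rk G" "\<lambda>A. dim_row (ex G A)" "\<lambda>A. dim_col (ex G A)"
    "\<lambda>A i j. ex G A $$ (i, j)"
    by (rule slp_locale[OF slp nt' al])
  have ex: "ex G (start G) = M" by (rule ex_start[OF slp nt'])
  have dim: "dim_row M = m" "dim_col M = n" using M by auto
  have ar: "ar (start G) = m * n" by (simp add: ar_def ex dim)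
  have mn: "0 < m * n" using ar_pos[OF S_less] ar by simp
  have Ng: "N \<le> grammar_size G" by (rule card_le_grammar_size[OF slp nt'])
  have N0: "0 < N" using S_less by simp
  have w128: "128 * (m * n + grammar_size G + \<sigma>) \<le> 2 ^ w"
  proof (rule word_large[OF _ w])
    show "2 \<le> m * n + grammar_size G + \<sigma>" using mn Ng N0 by linarith
  qed
  \<comment> \<open>As \<open>m * n\<close> is at least 1, it absorbs the summand 1 at the cost of a
    factor 2; hence the 128 required of the word length.\<close>
  have big: "64 * (N + ar (start G) + \<sigma> + 1) \<le> 2 ^ w"
  proof -
    have "1 \<le> m * n" using mn by (simp only: One_nat_def Suc_leI)
    then have "(N + 1) + (m * n + \<sigma>) \<le> (grammar_size G + m * n) + (m * n + \<sigma>)"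
      by (rule add_right_mono[OF add_mono[OF Ng]])
    also have "\<dots> \<le> 2 * (m * n + grammar_size G + \<sigma>)" by simp
    finally have "N + m * n + \<sigma> + 1 \<le> 2 * (m * n + grammar_size G + \<sigma>)"
      by (simp only: add_ac)
    then have "64 * (N + m * n + \<sigma> + 1) \<le> 64 * (2 * (m * n + grammar_size G + \<sigma>))"
      by (rule mult_le_mono2)
    then show ?thesis using w128 unfolding ar by simp
  qed
  interpret prep N "start G" \<sigma> "kind G" "lk G" "rk G" "\<lambda>A. dim_row (ex G A)" "\<lambda>A. dim_col (ex G A)"
    "\<lambda>A i j. ex G A $$ (i, j)" w
    by unfold_locales (rule big)
  let ?\<mu> = "memory_of (encode_grammar G)"
  let ?s = "init_state [] ?\<mu>"
  note mem = memory_of_encode[OF slp nt']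
  have "raw (snd (reg ?s, ?\<mu>))" "unnumbered (snd (reg ?s, ?\<mu>))"
    using mem by (simp_all add: raw_def unnumbered_def cell_def)
  from preprocess_correct[OF this] obtain t s' r where
    pre: "bs w preprocess (reg ?s, ?\<mu>) t s'" "r \<le> N"
      "t \<le> (len copy + 2 * len dfs + len pis + 2 * len paths + ce scan_cond) * (N + 1)"
      "\<forall>f<14. \<forall>k\<le>r. snd s' (cell f k) \<le> 2 * ar (start G) + \<sigma>"
      "\<forall>\<mu>. (\<forall>f<14. \<forall>k\<le>r. \<mu> (cell f k) = snd s' (cell f k)) \<longrightarrow> answers \<mu>"
    by (elim exE conjE) (rule that)
  define D where "D = map (snd s') [0..<14 * (r + 1)]"
  have len: "length D = 14 * (r + 1)" by (simp add: D_def)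
  have st: "stores (snd s') D" by (simp add: stores_def D_def)
  have "real t \<le> real K * real (grammar_size G)"
  proof -
    let ?L = "len copy + 2 * len dfs + len pis + 2 * len paths + ce scan_cond"
    have "t \<le> ?L * (2 * grammar_size G)"
      using pre(3) mult_le_mono2[of "N + 1" "2 * grammar_size G" ?L] Ng N0 by linarith
    also have "\<dots> \<le> K * grammar_size G" unfolding K_def by (simp add: algebra_simps)
    finally show ?thesis by (metis of_nat_le_iff of_nat_mult)
  qed
  moreover have "agree (reg ?s, ?\<mu>) ?s" "pc ?s = 0" by (simp_all add: agree_def init_state_def)
  ultimately obtain s where s: "halts_within w (cp preprocess 0) ?s (real K * real (grammar_size G)) s"
    "agree s' s" using cp_halts[OF pre(1) wfc_preprocess] by blast
  have "mem s = snd s'" using s(2) by (simp add: agree_def)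
  moreover have "fits_in_bits D (28 * real (\<sigma> + 4) * real (grammar_size G) * lg (real (m * n)))"
    unfolding fits_in_bits_def
  proof (intro exI conjI ballI)
    let ?n = "floor_log (m * n) + \<sigma> + 3"
    have rg: "r \<le> grammar_size G" "0 < grammar_size G" using pre(2) Ng N0 by auto
    note bits = memory_bits[OF mn rg, of \<sigma>]
    show "real (length D * ?n) \<le> 28 * real (\<sigma> + 4) * real (grammar_size G) * lg (real (m * n))"
      unfolding len by (rule bits(2))
    fix x assume "x \<in> set D"
    then obtain a where a: "a < 14 * (r + 1)" "x = snd s' a" by (auto simp: D_def)
    have "a = cell (a mod 14) (a div 14)" by (simp add: cell_def)
    moreover have "a div 14 \<le> r" using a(1) by (simp add: less_mult_imp_div_less less_Suc_eq_le[symmetric] mult.commute)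
    ultimately have "x \<le> 2 * (m * n) + \<sigma>" using pre(4) a(2) ar by (metis mod_less_divisor zero_less_numeral)
    then show "x < 2 ^ ?n" using bits(1) by simp
  qed
  moreover have "direct_access w (cp access 0) D M (real K * lg (real (m * n)) * lglg (real (max m n)))"
  proof (rule direct_accessI[OF st len])
    fix \<mu>' assume same: "\<forall>f<14. \<forall>k\<le>r. \<mu>' (cell f k) = snd s' (cell f k)"
    have "real t \<le> real K * lg (real (m * n)) * lglg (real (max m n))"
      if "t \<le> len access * (3 * floor_log (ar (start G)) + 2)" for t
    proof -
      let ?l = "lg (real (m * n))"
      have "real t \<le> real (len access * (3 * floor_log (m * n) + 2))" using that unfolding ar by (simp only: of_nat_le_iff)
      also have "\<dots> = real (len access) * (3 * real (floor_log (m * n)) + 2)"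
        by (simp add: algebra_simps)
      also have "\<dots> \<le> real (len access) * (5 * ?l)"
        using floor_log_le_lg[OF mn] lg_ge_1[of "real (m * n)"] by (intro mult_left_mono) auto
      also have "\<dots> \<le> real K * ?l"
        using lg_ge_1[of "real (m * n)"] by (simp add: K_def algebra_simps)
      \<comment> \<open>The time is bounded by a multiple of the logarithm, and \<open>lglg\<close>
        is at least 1.\<close>
      also have "\<dots> \<le> real K * ?l * lglg (real (max m n))"
      proof -
        have "0 \<le> real K * ?l" using lg_ge_1[of "real (m * n)"] by simp
        from mult_left_mono[OF lglg_ge_1 this] show ?thesis by simp
      qed
      finally show ?thesis .
    qed
    then show "\<forall>R. R 0 < dim_row M \<and> R 1 < dim_col M \<longrightarrow> (\<exists>t R'. bs w access (R, \<mu>') t (R', \<mu>') \<and>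
        R' 0 = M $$ (R 0, R 1) \<and> real t \<le> real K * lg (real (m * n)) * lglg (real (max m n)))"
      using pre(5)[rule_format, OF same[rule_format]] unfolding answers_def ex by blast
  qed
  ultimately show ?thesis using s(1) st by metis
qed

theorem theorem1:
  "\<exists>(prep :: program) (query :: program) (\<kappa> :: real) (C :: real).
     \<forall>\<sigma> :: nat. \<exists>C' :: real.
     \<forall>(G :: (nat, nat) grammar) (M :: nat mat) (m :: nat) (n :: nat) (w :: nat).
       M \<in> carrier_mat m n \<longrightarrow> is_slp2d G M \<longrightarrow>
       nonterms G = {..<card (nonterms G)} \<longrightarrow> alphabet G = {..<\<sigma>} \<longrightarrow>
       \<kappa> * log 2 (real (m * n + grammar_size G + \<sigma>)) \<le> real w \<longrightarrow>
       (\<exists>s D.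
          halts_within w prep (init_state [] (memory_of (encode_grammar G)))
            (C * real (grammar_size G)) s \<and>
          stores (mem s) D \<and>
          fits_in_bits D (C' * real (grammar_size G) * lg (real (m * n))) \<and>
          direct_access w query D M
            (C * lg (real (m * n)) * lglg (real (max m n))))"
  by (rule exI[of _ "cp preprocess 0"], rule exI[of _ "cp access 0"], rule exI[of _ 8],
      rule exI[of _ "real (2 * (len copy + 2 * len dfs + len pis + 2 * len paths + ce scan_cond) +
        5 * len access)"], rule allI, rule_tac x = "28 * real (\<sigma> + 4)" in exI, intro allI impI)
    (rule slp_data_structure)

end
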